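(* For $a\models p$ let $\varphi^*_a:\mathrm{Aut}(\mathcal M)\to H^*_1(p)$ be the map $\varphi^*_a(\sigma)=[a,\sigma(a)]$. Then: (1) each $\varphi^*_a$ is an epimorphism (surjective group homomorphism); (2) for $a,b\models p$, $\varphi^*_a=\varphi^*_b$; so there is a canonical map $\varphi^*_p:=\varphi^*_a$ (for some/any $a\models p$) from $\mathrm{Aut}(\mathcal M)$ into $H^*_1(p)$; (3) there is a canonical epimorphism $\Phi^*_p$ (the one induced by $\varphi^*_p$) from the Lascar group $\mathrm{Gal}_L(\mathcal M)$ onto $H^*_1(p)$.
   Context: **Setting.** $T$ is a complete theory and $\mathcal M=\mathcal M^{\mathrm{eq}}$ a large saturated (monster) model; sets and tuples are small, tuples possibly infinite; $a\equiv b$ means equality of types over $\emptyset$. Fix an $\mathrm{Aut}(\mathcal M)$-invariant ternary relation $A\perp^*_C D$ between small sets satisfying, for all sets: (finite character) $A\perp^*_CD$ iff $a\perp^*_Cd$ for all finite tuples $a\in A$, $d\in D$; (normality) $A\perp^*_CD$ implies $A\perp^*_C\mathrm{acl}(DC)$; (symmetry) $A\perp^*_CD$ iff $D\perp^*_CA$; (transitivity) for $E\subseteq C\subseteq D$, $A\perp^*_ED$ iff $A\perp^*_EC$ and $A\perp^*_CD$; (extension) for $E\subseteq C$ there is $A'\equiv_E A$ with $A'\perp^*_EC$. A family is $*$-independent over $C$ if each member is $*$-independent over $C$ from the union of the others; no mention of $C$ means over $\emptyset$. Fix a strong type $p$ over $B=\mathrm{acl}(B)$; the elements of $B$ are named by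 constants, so that $B=\mathrm{acl}(\emptyset)=\mathrm{dcl}(\emptyset)$ and "over $\emptyset$" means "over $B$". It is assumed that $p=\mathrm{tp}(a)$ where either $a$ enumerates $\mathrm{acl}(a)$, or $\mathrm{acl}(a)=\mathrm{dcl}(a)$. **Simplices and homology.** For a finite $s\subset\omega$, the power set $\mathcal P(s)$ is a category with one morphism $u\to v$ when $u\subseteq v$ and none otherwise. $\mathcal C$ is the category of small subsets of $\mathcal M$ containing $B$, with elementary maps over $B$ as morphisms. For a functor $f$ write $f^u_v:f(u)\to f(v)$ for the image of $u\to v$, and $f^u_v(u)$ for the set $f^u_v[f(u)]$. An $n$-simplex of $p$ is a functor $f:\mathcal P(s)\to\mathcal C$ with $|s|=n+1$ such that $f(\emptyset)=B$, each $f(\{i\})$ is of the form $\mathrm{acl}(b)$ with $b\models p$, and for nonempty $u\subseteq s$, $f(u)=\mathrm{acl}(\bigcup_{i\in u}f^{\{i\}}_u(\{i\}))$ and $\{f^{\{i\}}_u(\{i\}): i\in u\}$ is $*$-independent over $B$. Put $\mathrm{supp}(f)=s$. $C_n$ is the free abelian group on $n$-simplices ($n$-chains). For $s=\{s_0<\dots<s_n\}$ put $\partial^i f=f\restriction\mathcal P(s\setminus\{s_i\})$, $\partial f=\sum_{i}(-1)^i\partial^i f$ (extended linearly), and $H^*_n(p)=\ker\partial_n/\mathrm{Im}\,\partial_{n+1}$; $[c]$ is the class of a cycle $c$. **Shells and the bracket $[a,b]$.** A $1$-shell is a $1$-chain $s=f_0-f_1+f_2$ of $1$-simplices with $\partial^if_j=\partial^{j-1}f_i$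 for $0\le i<j\le 2$; its support (the union of the supports of the $f_i$) is $\{n_0<n_1<n_2\}$ and we write $s=f_{12}-f_{02}+f_{01}$ with $\mathrm{supp}(f_{ij})=\{n_i,n_j\}$. A representation of $s$ is a quadruple $(a_0,a_1,a_2,a_3)$ of realizations of $p$ such that, for some realizations $e_i\models p$ with $\mathrm{acl}(e_i)$ equal to the common vertex set $f_{jk}(\{n_i\})$ ($i=0,1,2$), writing $e_i^{jk}$ for the image of $e_i$ under the map $f_{jk}(\{n_i\})\to f_{jk}(\{n_j,n_k\})$, one has $a_0a_1\equiv e_0^{01}e_1^{01}$, $a_1a_2\equiv e_1^{12}e_2^{12}$, $a_3a_2\equiv e_0^{02}e_2^{02}$. Then $(a_0,a_3)$ is called an endpoint pair of $s$. Every pair $(a,b)$ of realizations of $p$ is an endpoint pair of some $1$-shell with support $\{0,1,2\}$, and the class of such a shell in $H_1^*(p)$ depends only on $(a,b)$; it is denoted $[a,b]$. **Lascar group.** $\mathrm{Autf}(\mathcal M)$ is the subgroup of $\mathrm{Aut}(\mathcal M)$ generated by the automorphisms fixing pointwise some small elementary submodel, and $\mathrm{Gal}_L(\mathcal M)=\mathrm{Gal}_L(T)=\mathrm{Aut}(\mathcal M)/\mathrm{Autf}(\mathcal M)$. *)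

theory Defs
  imports
    "HOL-Algebra.Free_Abelian_Groups"
    "HOL-Algebra.Generated_Groups"
    "HOL-Algebra.Coset"
    "HOL-Library.Equipollence"
begin

section \<open>Many-sorted first-order logic\<close>

text \<open>
  The universe of a structure is the whole type \<open>'m\<close>; the sorts of the language are the values
  taken by \<open>sort_of\<close>, so every sort is inhabited.  Function and relation symbols form
  arbitrary (possibly empty) sets; a constant is a function symbol with empty list of argument sorts.
  The interpretation of a symbol at ill-sorted arguments is irrelevant: no well-formed formula,
  and no condition below, refers to it.
\<close>

record ('s, 'f, 'r, 'm) mstruct =
  sort_of :: "'m \<Rightarrow> 's"
  funs :: "'f set"
  fun_dom :: "'f \<Rightarrow> 's list"
  fun_cod :: "'f \<Rightarrow> 's"
  rels :: "'r set"
  rel_dom :: "'r \<Rightarrow> 's list"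
  fun_int :: "'f \<Rightarrow> 'm list \<Rightarrow> 'm"
  rel_int :: "'r \<Rightarrow> 'm list \<Rightarrow> bool"

definition sorts :: "('s, 'f, 'r, 'm) mstruct \<Rightarrow> 's set" where
  "sorts M = range (sort_of M)"

definition is_structure :: "('s, 'f, 'r, 'm) mstruct \<Rightarrow> bool" where
  "is_structure M \<longleftrightarrow>
     (\<forall>f\<in>funs M. \<forall>xs. map (sort_of M) xs = fun_dom M f \<longrightarrow> sort_of M (fun_int M f xs) = fun_cod M f)"

text \<open>The variable \<open>(s, n)\<close> is the \<open>n\<close>-th variable of sort \<open>s\<close>.\<close>

type_synonym 's var = "'s \<times> nat"

datatype ('s, 'f) tm = Var "'s var" | Fn 'f "('s, 'f) tm list"

datatype ('s, 'f, 'r) fm =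
    Eq "('s, 'f) tm" "('s, 'f) tm"
  | Rel 'r "('s, 'f) tm list"
  | Neg "('s, 'f, 'r) fm"
  | Conj "('s, 'f, 'r) fm" "('s, 'f, 'r) fm"
  | Ex "'s var" "('s, 'f, 'r) fm"

primrec tm_sort :: "('s, 'f, 'r, 'm) mstruct \<Rightarrow> ('s, 'f) tm \<Rightarrow> 's" where
  "tm_sort M (Var x) = fst x"
| "tm_sort M (Fn f ts) = fun_cod M f"

fun wf_tm :: "('s, 'f, 'r, 'm) mstruct \<Rightarrow> ('s, 'f) tm \<Rightarrow> bool" where
  "wf_tm M (Var x) \<longleftrightarrow> fst x \<in> sorts M"
| "wf_tm M (Fn f ts) \<longleftrightarrow> f \<in> funs M \<and> (\<forall>t\<in>set ts. wf_tm M t) \<and> map (tm_sort M) ts = fun_dom M f"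

primrec wf_fm :: "('s, 'f, 'r, 'm) mstruct \<Rightarrow> ('s, 'f, 'r) fm \<Rightarrow> bool" where
  "wf_fm M (Eq t u) \<longleftrightarrow> wf_tm M t \<and> wf_tm M u \<and> tm_sort M t = tm_sort M u"
| "wf_fm M (Rel r ts) \<longleftrightarrow> r \<in> rels M \<and> (\<forall>t\<in>set ts. wf_tm M t) \<and> map (tm_sort M) ts = rel_dom M r"
| "wf_fm M (Neg \<phi>) \<longleftrightarrow> wf_fm M \<phi>"
| "wf_fm M (Conj \<phi> \<psi>) \<longleftrightarrow> wf_fm M \<phi> \<and> wf_fm M \<psi>"
| "wf_fm M (Ex x \<phi>) \<longleftrightarrow> fst x \<in> sorts M \<and> wf_fm M \<phi>"

fun fv_tm :: "('s, 'f) tm \<Rightarrow> 's var set" where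
  "fv_tm (Var x) = {x}"
| "fv_tm (Fn f ts) = (\<Union>t\<in>set ts. fv_tm t)"

primrec fv :: "('s, 'f, 'r) fm \<Rightarrow> 's var set" where
  "fv (Eq t u) = fv_tm t \<union> fv_tm u"
| "fv (Rel r ts) = (\<Union>t\<in>set ts. fv_tm t)"
| "fv (Neg \<phi>) = fv \<phi>"
| "fv (Conj \<phi> \<psi>) = fv \<phi> \<union> fv \<psi>"
| "fv (Ex x \<phi>) = fv \<phi> - {x}"

fun eval :: "('s, 'f, 'r, 'm) mstruct \<Rightarrow> ('s var \<Rightarrow> 'm) \<Rightarrow> ('s, 'f) tm \<Rightarrow> 'm" where
  "eval M v (Var x) = v x"
| "eval M v (Fn f ts) = fun_int M f (map (eval M v) ts)"

text \<open>Satisfaction in the substructure of \<open>M\<close> with universe \<open>U\<close>.\<close>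

primrec sat :: "('s, 'f, 'r, 'm) mstruct \<Rightarrow> 'm set \<Rightarrow> ('s var \<Rightarrow> 'm) \<Rightarrow> ('s, 'f, 'r) fm \<Rightarrow> bool" where
  "sat M U v (Eq t u) \<longleftrightarrow> eval M v t = eval M v u"
| "sat M U v (Rel r ts) \<longleftrightarrow> rel_int M r (map (eval M v) ts)"
| "sat M U v (Neg \<phi>) \<longleftrightarrow> \<not> sat M U v \<phi>"
| "sat M U v (Conj \<phi> \<psi>) \<longleftrightarrow> sat M U v \<phi> \<and> sat M U v \<psi>"
| "sat M U v (Ex x \<phi>) \<longleftrightarrow> (\<exists>y\<in>U. sort_of M y = fst x \<and> sat M U (v(x := y)) \<phi>)"

text \<open>\<open>v\<close> assigns to the variables in \<open>X\<close> elements of \<open>A\<close> of the right sort.\<close>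

definition params_in :: "('s, 'f, 'r, 'm) mstruct \<Rightarrow> 'm set \<Rightarrow> 's var set \<Rightarrow> ('s var \<Rightarrow> 'm) \<Rightarrow> bool" where
  "params_in M A X v \<longleftrightarrow> (\<forall>x\<in>X. v x \<in> A \<and> sort_of M (v x) = fst x)"

section \<open>Model theory inside a structure\<close>

text \<open>\<open>solutions M x \<phi> v\<close> is the set defined by \<open>\<phi>\<close> in the free variable \<open>x\<close>, the other
  free variables being interpreted by the parameters \<open>v\<close>.\<close>

definition solutions ::
    "('s, 'f, 'r, 'm) mstruct \<Rightarrow> 's var \<Rightarrow> ('s, 'f, 'r) fm \<Rightarrow> ('s var \<Rightarrow> 'm) \<Rightarrow> 'm set" where
  "solutions M x \<phi> v = {y. sort_of M y = fst x \<and> sat M UNIV (v(x := y)) \<phi>}"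

definition acl :: "('s, 'f, 'r, 'm) mstruct \<Rightarrow> 'm set \<Rightarrow> 'm set" where
  "acl M A = {a. \<exists>x \<phi> v. wf_fm M \<phi> \<and> params_in M A (fv \<phi> - {x}) v \<and>
                   a \<in> solutions M x \<phi> v \<and> finite (solutions M x \<phi> v)}"

definition dcl :: "('s, 'f, 'r, 'm) mstruct \<Rightarrow> 'm set \<Rightarrow> 'm set" where
  "dcl M A = {a. \<exists>x \<phi> v. wf_fm M \<phi> \<and> params_in M A (fv \<phi> - {x}) v \<and>
                   solutions M x \<phi> v = {a}}"

text \<open>
  The complete type of the tuple \<open>a\<close> (indexed by \<open>'i\<close>) over \<open>C\<close>.  An element \<open>(\<phi>, \<tau>)\<close> of it is a
  formula together with a substitution of its free variables by type variables \<open>Inl i\<close>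
  (\<open>i :: 'i\<close>) and parameters \<open>Inr c\<close> (\<open>c \<in> C\<close>).
\<close>

type_synonym ('s, 'f, 'r, 'm, 'i) ctype = "(('s, 'f, 'r) fm \<times> ('s var \<Rightarrow> 'i + 'm)) set"

definition tp ::
    "('s, 'f, 'r, 'm) mstruct \<Rightarrow> 'm set \<Rightarrow> ('i \<Rightarrow> 'm) \<Rightarrow> ('s, 'f, 'r, 'm, 'i) ctype" where
  "tp M C a = {(\<phi>, \<tau>). wf_fm M \<phi> \<and>
      (\<forall>x\<in>fv \<phi>. \<tau> x \<in> range Inl \<union> Inr ` C \<and> sort_of M (case_sum a id (\<tau> x)) = fst x) \<and>
      sat M UNIV (case_sum a id \<circ> \<tau>) \<phi>}"

definition elementary_map :: "('s, 'f, 'r, 'm) mstruct \<Rightarrow> 'm set \<Rightarrow> ('m \<Rightarrow> 'm) \<Rightarrow> bool" where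
  "elementary_map M A g \<longleftrightarrow>
     (\<forall>x\<in>A. sort_of M (g x) = sort_of M x) \<and>
     (\<forall>\<phi> v. wf_fm M \<phi> \<and> params_in M A (fv \<phi>) v \<longrightarrow> (sat M UNIV (g \<circ> v) \<phi> \<longleftrightarrow> sat M UNIV v \<phi>))"

definition elementary_submodel :: "('s, 'f, 'r, 'm) mstruct \<Rightarrow> 'm set \<Rightarrow> bool" where
  "elementary_submodel M N \<longleftrightarrow>
     (\<forall>f\<in>funs M. \<forall>xs. set xs \<subseteq> N \<and> map (sort_of M) xs = fun_dom M f \<longrightarrow> fun_int M f xs \<in> N) \<and>
     (\<forall>\<phi> v. wf_fm M \<phi> \<and> params_in M N (fv \<phi>) v \<longrightarrow> (sat M N v \<phi> \<longleftrightarrow> sat M UNIV v \<phi>))"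

text \<open>\<open>R\<close> is a \<open>\<emptyset>\<close>-definable relation on the product of the sorts in the list \<open>ss\<close>.\<close>

definition definable_rel :: "('s, 'f, 'r, 'm) mstruct \<Rightarrow> 's list \<Rightarrow> 'm list set \<Rightarrow> bool" where
  "definable_rel M ss R \<longleftrightarrow>
     (\<exists>\<phi> xs. wf_fm M \<phi> \<and> fv \<phi> \<subseteq> set xs \<and> map fst xs = ss \<and>
        R = {map v xs |v. params_in M UNIV (set xs) v \<and> sat M UNIV v \<phi>})"

text \<open>
  The meaning of ``\<open>M = M\<^sup>e\<^sup>q\<close>'': for every \<open>\<emptyset>\<close>-definable equivalence relation \<open>E\<close> on a
  finite product of sorts there is a sort carrying the classes of \<open>E\<close>, with \<open>\<emptyset>\<close>-definable
  projection \<open>F\<close>.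
\<close>

definition is_eq_closed :: "('s, 'f, 'r, 'm) mstruct \<Rightarrow> bool" where
  "is_eq_closed M \<longleftrightarrow>
     (\<forall>ss E. set ss \<subseteq> sorts M \<and> equiv {xs. map (sort_of M) xs = ss} E \<and>
             definable_rel M (ss @ ss) {xs @ ys |xs ys. (xs, ys) \<in> E} \<longrightarrow>
        (\<exists>s\<in>sorts M. \<exists>F.
           (\<forall>xs. map (sort_of M) xs = ss \<longrightarrow> sort_of M (F xs) = s) \<and>
           definable_rel M (ss @ [s]) {xs @ [F xs] |xs. map (sort_of M) xs = ss} \<and>
           (\<forall>xs ys. map (sort_of M) xs = ss \<and> map (sort_of M) ys = ss \<longrightarrow>
              (F xs = F ys \<longleftrightarrow> (xs, ys) \<in> E))))"

section \<open>The monster model\<close>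

text \<open>Smallness is relative to the cardinality of the universe \<open>'m\<close> of the monster model.\<close>

definition small :: "('s, 'f, 'r, 'm) mstruct \<Rightarrow> 'a set \<Rightarrow> bool" where
  "small M A \<longleftrightarrow> A \<prec> (UNIV :: 'm set)"

text \<open>Below, \<open>\<Gamma>\<close> is a partial type over \<open>A\<close> in one variable of sort \<open>s\<close>, namely \<open>(s, 0)\<close>.\<close>

definition saturated :: "('s, 'f, 'r, 'm) mstruct \<Rightarrow> bool" where
  "saturated M \<longleftrightarrow>
     (\<forall>A s \<Gamma>. small M A \<and> s \<in> sorts M \<and>
        (\<forall>(\<phi>, v)\<in>\<Gamma>. wf_fm M \<phi> \<and> params_in M A (fv \<phi> - {(s, 0)}) v) \<and>
        (\<forall>\<Gamma>0\<subseteq>\<Gamma>. finite \<Gamma>0 \<longrightarrow>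
           (\<exists>y. sort_of M y = s \<and> (\<forall>(\<phi>, v)\<in>\<Gamma>0. y \<in> solutions M (s, 0) \<phi> v))) \<longrightarrow>
        (\<exists>y. sort_of M y = s \<and> (\<forall>(\<phi>, v)\<in>\<Gamma>. y \<in> solutions M (s, 0) \<phi> v)))"

text \<open>``Large'': the cardinality of the universe is an uncountable strong limit exceeding that of
  the language.\<close>

definition large :: "('s, 'f, 'r, 'm) mstruct \<Rightarrow> bool" where
  "large M \<longleftrightarrow>
     small M (UNIV :: nat set) \<and> small M (sorts M) \<and> small M (funs M) \<and> small M (rels M) \<and>
     (\<forall>A :: 'm set. small M A \<longrightarrow> small M (Pow A))"

definition monster :: "('s, 'f, 'r, 'm) mstruct \<Rightarrow> bool" where
  "monster M \<longleftrightarrow> is_structure M \<and> is_eq_closed M \<and> large M \<and> saturated M"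

definition automorphism :: "('s, 'f, 'r, 'm) mstruct \<Rightarrow> ('m \<Rightarrow> 'm) \<Rightarrow> bool" where
  "automorphism M \<sigma> \<longleftrightarrow>
     bij \<sigma> \<and> (\<forall>x. sort_of M (\<sigma> x) = sort_of M x) \<and>
     (\<forall>f\<in>funs M. \<forall>xs. map (sort_of M) xs = fun_dom M f \<longrightarrow>
        \<sigma> (fun_int M f xs) = fun_int M f (map \<sigma> xs)) \<and>
     (\<forall>r\<in>rels M. \<forall>xs. map (sort_of M) xs = rel_dom M r \<longrightarrow>
        (rel_int M r (map \<sigma> xs) \<longleftrightarrow> rel_int M r xs))"

definition Aut :: "('s, 'f, 'r, 'm) mstruct \<Rightarrow> ('m \<Rightarrow> 'm) monoid" where
  "Aut M = \<lparr>carrier = {\<sigma>. automorphism M \<sigma>}, mult = (\<circ>), one = id\<rparr>"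

definition Autf :: "('s, 'f, 'r, 'm) mstruct \<Rightarrow> ('m \<Rightarrow> 'm) set" where
  "Autf M = generate (Aut M)
     {\<sigma> \<in> carrier (Aut M). \<exists>N. small M N \<and> elementary_submodel M N \<and> (\<forall>x\<in>N. \<sigma> x = x)}"

definition Gal_L :: "('s, 'f, 'r, 'm) mstruct \<Rightarrow> ('m \<Rightarrow> 'm) set monoid" where
  "Gal_L M = Aut M Mod Autf M"

section \<open>Abstract independence\<close>

text \<open>\<open>ind A C D\<close> stands for \<open>A \<bottom>\<^sup>*\<^sub>C D\<close>; only its values at small sets matter.  In the extension
  axiom \<open>A' \<equiv>\<^sub>E A\<close> refers to an enumeration of \<open>A\<close>, i.e. \<open>A'\<close> is the image of \<open>A\<close> under an
  elementary map which is the identity on \<open>E\<close>.\<close>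

definition independence_relation ::
    "('s, 'f, 'r, 'm) mstruct \<Rightarrow> ('m set \<Rightarrow> 'm set \<Rightarrow> 'm set \<Rightarrow> bool) \<Rightarrow> bool" where
  "independence_relation M ind \<longleftrightarrow>
     \<comment> \<open>invariance\<close>
     (\<forall>\<sigma> A C D. \<sigma> \<in> carrier (Aut M) \<and> small M A \<and> small M C \<and> small M D \<longrightarrow>
        (ind (\<sigma> ` A) (\<sigma> ` C) (\<sigma> ` D) \<longleftrightarrow> ind A C D)) \<and>
     \<comment> \<open>finite character\<close>
     (\<forall>A C D. small M A \<and> small M C \<and> small M D \<longrightarrow>
        (ind A C D \<longleftrightarrow> (\<forall>A0 D0. finite A0 \<and> A0 \<subseteq> A \<and> finite D0 \<and> D0 \<subseteq> D \<longrightarrow> ind A0 C D0))) \<and>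
     \<comment> \<open>normality\<close>
     (\<forall>A C D. small M A \<and> small M C \<and> small M D \<and> ind A C D \<longrightarrow> ind A C (acl M (D \<union> C))) \<and>
     \<comment> \<open>symmetry\<close>
     (\<forall>A C D. small M A \<and> small M C \<and> small M D \<longrightarrow> (ind A C D \<longleftrightarrow> ind D C A)) \<and>
     \<comment> \<open>transitivity\<close>
     (\<forall>A E C D. small M A \<and> small M D \<and> E \<subseteq> C \<and> C \<subseteq> D \<longrightarrow>
        (ind A E D \<longleftrightarrow> ind A E C \<and> ind A C D)) \<and>
     \<comment> \<open>extension\<close>
     (\<forall>A E C. small M A \<and> small M C \<and> E \<subseteq> C \<longrightarrow>
        (\<exists>g. elementary_map M (A \<union> E) g \<and> (\<forall>e\<in>E. g e = e) \<and> ind (g ` A) E C))"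

definition independent_family ::
    "('m set \<Rightarrow> 'm set \<Rightarrow> 'm set \<Rightarrow> bool) \<Rightarrow> 'm set \<Rightarrow> 'j set \<Rightarrow> ('j \<Rightarrow> 'm set) \<Rightarrow> bool" where
  "independent_family ind C J A \<longleftrightarrow> (\<forall>i\<in>J. ind (A i) C (\<Union>j\<in>J - {i}. A j))"

section \<open>The strong type\<close>

definition realizes ::
    "('s, 'f, 'r, 'm) mstruct \<Rightarrow> 'm set \<Rightarrow> ('s, 'f, 'r, 'm, 'i) ctype \<Rightarrow> ('i \<Rightarrow> 'm) \<Rightarrow> bool" where
  "realizes M B p a \<longleftrightarrow> tp M B a = p"

text \<open>Naming the elements of \<open>B = acl(B)\<close> by constants gives \<open>B = acl(\<emptyset>) = dcl(\<emptyset>)\<close>.\<close>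

definition named_base :: "('s, 'f, 'r, 'm) mstruct \<Rightarrow> 'm set \<Rightarrow> bool" where
  "named_base M B \<longleftrightarrow> small M B \<and> acl M B = B \<and>
     (\<forall>b\<in>B. \<exists>c\<in>funs M. fun_dom M c = [] \<and> fun_int M c [] = b)"

definition strong_type ::
    "('s, 'f, 'r, 'm) mstruct \<Rightarrow> 'm set \<Rightarrow> ('s, 'f, 'r, 'm, 'i) ctype \<Rightarrow> bool" where
  "strong_type M B p \<longleftrightarrow> small M (UNIV :: 'i set) \<and>
     (\<exists>a :: 'i \<Rightarrow> 'm. p = tp M B a \<and>
        (range a = acl M (range a) \<or> acl M (range a) = dcl M (range a)))"

section \<open>Simplices and homology\<close>

text \<open>
  A functor on the power set of \<open>supp f\<close>: \<open>obj f u\<close> is \<open>f(u)\<close> and \<open>mor f u v\<close> is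
  \<open>f\<^sup>u\<^sub>v : f(u) \<rightarrow> f(v)\<close>.  For these to be equal as records exactly when they are equal as functors,
  all values outside the respective domains are required to be \<open>undefined\<close>.
\<close>

record 'm psimplex =
  supp :: "nat set"
  obj :: "nat set \<Rightarrow> 'm set"
  mor :: "nat set \<Rightarrow> nat set \<Rightarrow> 'm \<Rightarrow> 'm"

definition is_functor :: "('s, 'f, 'r, 'm) mstruct \<Rightarrow> 'm set \<Rightarrow> 'm psimplex \<Rightarrow> bool" where
  "is_functor M B f \<longleftrightarrow>
     (\<forall>u. u \<subseteq> supp f \<longrightarrow> small M (obj f u) \<and> B \<subseteq> obj f u) \<and>
     (\<forall>u v. u \<subseteq> v \<and> v \<subseteq> supp f \<longrightarrow>
        mor f u v ` obj f u \<subseteq> obj f v \<and> elementary_map M (obj f u) (mor f u v) \<and>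
        (\<forall>b\<in>B. mor f u v b = b) \<and> mor f u v \<in> extensional (obj f u)) \<and>
     (\<forall>u. u \<subseteq> supp f \<longrightarrow> (\<forall>x\<in>obj f u. mor f u u x = x)) \<and>
     (\<forall>u v w. u \<subseteq> v \<and> v \<subseteq> w \<and> w \<subseteq> supp f \<longrightarrow>
        (\<forall>x\<in>obj f u. mor f v w (mor f u v x) = mor f u w x)) \<and>
     (\<forall>u. \<not> u \<subseteq> supp f \<longrightarrow> obj f u = undefined) \<and>
     (\<forall>u v. \<not> (u \<subseteq> v \<and> v \<subseteq> supp f) \<longrightarrow> mor f u v = undefined)"

text \<open>The set \<open>f\<^sup>u\<^sub>v(u)\<close>.\<close>

definition img :: "'m psimplex \<Rightarrow> nat set \<Rightarrow> nat set \<Rightarrow> 'm set" where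
  "img f u v = mor f u v ` obj f u"

definition is_simplex ::
    "('s, 'f, 'r, 'm) mstruct \<Rightarrow> ('m set \<Rightarrow> 'm set \<Rightarrow> 'm set \<Rightarrow> bool) \<Rightarrow> 'm set \<Rightarrow>
     ('s, 'f, 'r, 'm, 'i) ctype \<Rightarrow> nat \<Rightarrow> 'm psimplex \<Rightarrow> bool" where
  "is_simplex M ind B p n f \<longleftrightarrow>
     finite (supp f) \<and> card (supp f) = n + 1 \<and> is_functor M B f \<and> obj f {} = B \<and>
     (\<forall>i\<in>supp f. \<exists>b. realizes M B p b \<and> obj f {i} = acl M (range b)) \<and>
     (\<forall>u. u \<subseteq> supp f \<and> u \<noteq> {} \<longrightarrow>
        obj f u = acl M (\<Union>i\<in>u. img f {i} u) \<and>
        independent_family ind B u (\<lambda>i. img f {i} u))"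

definition face :: "nat \<Rightarrow> 'm psimplex \<Rightarrow> 'm psimplex" where
  "face i f =
     (let t = supp f - {sorted_list_of_set (supp f) ! i}
      in \<lparr>supp = t,
          obj = (\<lambda>u. if u \<subseteq> t then obj f u else undefined),
          mor = (\<lambda>u v. if u \<subseteq> v \<and> v \<subseteq> t then mor f u v else undefined)\<rparr>)"

definition chains ::
    "('s, 'f, 'r, 'm) mstruct \<Rightarrow> ('m set \<Rightarrow> 'm set \<Rightarrow> 'm set \<Rightarrow> bool) \<Rightarrow> 'm set \<Rightarrow>
     ('s, 'f, 'r, 'm, 'i) ctype \<Rightarrow> nat \<Rightarrow> ('m psimplex \<Rightarrow>\<^sub>0 int) monoid" where
  "chains M ind B p n = free_Abelian_group {f. is_simplex M ind B p n f}"

text \<open>The boundary map is zero on \<open>0\<close>-chains.\<close>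

definition boundary :: "nat \<Rightarrow> ('m psimplex \<Rightarrow>\<^sub>0 int) \<Rightarrow> ('m psimplex \<Rightarrow>\<^sub>0 int)" where
  "boundary n c =
     (if n = 0 then 0
      else frag_extend (\<lambda>f. \<Sum>i\<le>n. frag_cmul ((-1) ^ i) (frag_of (face i f))) c)"

definition cycles ::
    "('s, 'f, 'r, 'm) mstruct \<Rightarrow> ('m set \<Rightarrow> 'm set \<Rightarrow> 'm set \<Rightarrow> bool) \<Rightarrow> 'm set \<Rightarrow>
     ('s, 'f, 'r, 'm, 'i) ctype \<Rightarrow> nat \<Rightarrow> ('m psimplex \<Rightarrow>\<^sub>0 int) monoid" where
  "cycles M ind B p n =
     subgroup_generated (chains M ind B p n)
       (kernel (chains M ind B p n) (chains M ind B p (n - 1)) (boundary n))"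

definition boundaries ::
    "('s, 'f, 'r, 'm) mstruct \<Rightarrow> ('m set \<Rightarrow> 'm set \<Rightarrow> 'm set \<Rightarrow> bool) \<Rightarrow> 'm set \<Rightarrow>
     ('s, 'f, 'r, 'm, 'i) ctype \<Rightarrow> nat \<Rightarrow> ('m psimplex \<Rightarrow>\<^sub>0 int) set" where
  "boundaries M ind B p n = boundary (n + 1) ` carrier (chains M ind B p (n + 1))"

definition homology ::
    "('s, 'f, 'r, 'm) mstruct \<Rightarrow> ('m set \<Rightarrow> 'm set \<Rightarrow> 'm set \<Rightarrow> bool) \<Rightarrow> 'm set \<Rightarrow>
     ('s, 'f, 'r, 'm, 'i) ctype \<Rightarrow> nat \<Rightarrow> ('m psimplex \<Rightarrow>\<^sub>0 int) set monoid" where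
  "homology M ind B p n = cycles M ind B p n Mod boundaries M ind B p n"

definition homology_class ::
    "('s, 'f, 'r, 'm) mstruct \<Rightarrow> ('m set \<Rightarrow> 'm set \<Rightarrow> 'm set \<Rightarrow> bool) \<Rightarrow> 'm set \<Rightarrow>
     ('s, 'f, 'r, 'm, 'i) ctype \<Rightarrow> nat \<Rightarrow> ('m psimplex \<Rightarrow>\<^sub>0 int) \<Rightarrow> ('m psimplex \<Rightarrow>\<^sub>0 int) set" where
  "homology_class M ind B p n c = boundaries M ind B p n #>\<^bsub>cycles M ind B p n\<^esub> c"

section \<open>Shells and endpoint pairs\<close>

text \<open>The shell \<open>f\<^sub>0 - f\<^sub>1 + f\<^sub>2\<close> is presented by its three terms; the face conditions force the
  supports to be \<open>{n\<^sub>1, n\<^sub>2}\<close>, \<open>{n\<^sub>0, n\<^sub>2}\<close>, \<open>{n\<^sub>0, n\<^sub>1}\<close> with \<open>n\<^sub>0 < n\<^sub>1 < n\<^sub>2\<close>, in this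
  order, so that the chain determines its terms.\<close>

definition is_shell ::
    "('s, 'f, 'r, 'm) mstruct \<Rightarrow> ('m set \<Rightarrow> 'm set \<Rightarrow> 'm set \<Rightarrow> bool) \<Rightarrow> 'm set \<Rightarrow>
     ('s, 'f, 'r, 'm, 'i) ctype \<Rightarrow> 'm psimplex \<Rightarrow> 'm psimplex \<Rightarrow> 'm psimplex \<Rightarrow> bool" where
  "is_shell M ind B p f0 f1 f2 \<longleftrightarrow>
     (\<forall>f\<in>{f0, f1, f2}. is_simplex M ind B p 1 f) \<and>
     face 0 f1 = face 0 f0 \<and> face 0 f2 = face 1 f0 \<and> face 1 f2 = face 1 f1"

definition shell_chain :: "'m psimplex \<Rightarrow> 'm psimplex \<Rightarrow> 'm psimplex \<Rightarrow> ('m psimplex \<Rightarrow>\<^sub>0 int)" where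
  "shell_chain f0 f1 f2 = frag_of f0 - frag_of f1 + frag_of f2"

definition shell_supp :: "'m psimplex \<Rightarrow> 'm psimplex \<Rightarrow> 'm psimplex \<Rightarrow> nat set" where
  "shell_supp f0 f1 f2 = supp f0 \<union> supp f1 \<union> supp f2"

text \<open>For tuples \<open>a\<close>, \<open>b\<close> the concatenation \<open>ab\<close> is \<open>case_sum a b\<close>.\<close>

definition is_representation ::
    "('s, 'f, 'r, 'm) mstruct \<Rightarrow> 'm set \<Rightarrow> ('s, 'f, 'r, 'm, 'i) ctype \<Rightarrow>
     'm psimplex \<Rightarrow> 'm psimplex \<Rightarrow> 'm psimplex \<Rightarrow>
     ('i \<Rightarrow> 'm) \<Rightarrow> ('i \<Rightarrow> 'm) \<Rightarrow> ('i \<Rightarrow> 'm) \<Rightarrow> ('i \<Rightarrow> 'm) \<Rightarrow> bool" where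
  "is_representation M B p f12 f02 f01 a0 a1 a2 a3 \<longleftrightarrow>
     (let ns = sorted_list_of_set (shell_supp f12 f02 f01);
          n0 = ns ! 0; n1 = ns ! 1; n2 = ns ! 2
      in realizes M B p a0 \<and> realizes M B p a1 \<and> realizes M B p a2 \<and> realizes M B p a3 \<and>
         (\<exists>e0 e1 e2. realizes M B p e0 \<and> realizes M B p e1 \<and> realizes M B p e2 \<and>
            acl M (range e0) = obj f01 {n0} \<and> acl M (range e0) = obj f02 {n0} \<and>
            acl M (range e1) = obj f01 {n1} \<and> acl M (range e1) = obj f12 {n1} \<and>
            acl M (range e2) = obj f02 {n2} \<and> acl M (range e2) = obj f12 {n2} \<and>
            tp M {} (case_sum a0 a1) =
              tp M {} (case_sum (mor f01 {n0} {n0, n1} \<circ> e0) (mor f01 {n1} {n0, n1} \<circ> e1)) \<and>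
            tp M {} (case_sum a1 a2) =
              tp M {} (case_sum (mor f12 {n1} {n1, n2} \<circ> e1) (mor f12 {n2} {n1, n2} \<circ> e2)) \<and>
            tp M {} (case_sum a3 a2) =
              tp M {} (case_sum (mor f02 {n0} {n0, n2} \<circ> e0) (mor f02 {n2} {n0, n2} \<circ> e2))))"

definition is_endpoint_pair ::
    "('s, 'f, 'r, 'm) mstruct \<Rightarrow> 'm set \<Rightarrow> ('s, 'f, 'r, 'm, 'i) ctype \<Rightarrow>
     'm psimplex \<Rightarrow> 'm psimplex \<Rightarrow> 'm psimplex \<Rightarrow> ('i \<Rightarrow> 'm) \<Rightarrow> ('i \<Rightarrow> 'm) \<Rightarrow> bool" where
  "is_endpoint_pair M B p f12 f02 f01 a b \<longleftrightarrow>
     (\<exists>a1 a2. is_representation M B p f12 f02 f01 a a1 a2 b)"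

text \<open>The class \<open>[a, b]\<close>: the common value in \<open>H\<^sub>1\<close> of all \<open>1\<close>-shells with support \<open>{0, 1, 2}\<close>
  and endpoint pair \<open>(a, b)\<close>.\<close>

definition bracket ::
    "('s, 'f, 'r, 'm) mstruct \<Rightarrow> ('m set \<Rightarrow> 'm set \<Rightarrow> 'm set \<Rightarrow> bool) \<Rightarrow> 'm set \<Rightarrow>
     ('s, 'f, 'r, 'm, 'i) ctype \<Rightarrow> ('i \<Rightarrow> 'm) \<Rightarrow> ('i \<Rightarrow> 'm) \<Rightarrow> ('m psimplex \<Rightarrow>\<^sub>0 int) set" where
  "bracket M ind B p a b =
     (THE h. \<exists>f12 f02 f01. is_shell M ind B p f12 f02 f01 \<and> shell_supp f12 f02 f01 = {0, 1, 2} \<and>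
        is_endpoint_pair M B p f12 f02 f01 a b \<and>
        h = homology_class M ind B p 1 (shell_chain f12 f02 f01))"

definition phi_star ::
    "('s, 'f, 'r, 'm) mstruct \<Rightarrow> ('m set \<Rightarrow> 'm set \<Rightarrow> 'm set \<Rightarrow> bool) \<Rightarrow> 'm set \<Rightarrow>
     ('s, 'f, 'r, 'm, 'i) ctype \<Rightarrow> ('i \<Rightarrow> 'm) \<Rightarrow> ('m \<Rightarrow> 'm) \<Rightarrow> ('m psimplex \<Rightarrow>\<^sub>0 int) set" where
  "phi_star M ind B p a = (\<lambda>\<sigma>\<in>carrier (Aut M). bracket M ind B p a (\<sigma> \<circ> a))"

end

theory Submission
  imports Defs
begin

text \<open>
  Fix vertices \<open>i \<noteq> k\<close> and realizations \<open>x\<close>, \<open>y\<close> of \<open>p\<close>.  For a realization \<open>z\<close> independent from each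
  of \<open>x\<close> and \<open>y\<close>, subtract from the edge placed at \<open>(x, z)\<close> the edge placed at \<open>(y, z)\<close>, both with
  the same two vertex sets.  Independent triples bound triangles, so modulo boundaries the result
  \<open>D x y\<close> depends neither on \<open>z\<close> nor on the vertices, it is invariant under automorphisms, and
  \<open>D x y + D y t = D x t\<close>.  A shell with endpoint pair \<open>(a, b)\<close> is homologous to \<open>D a b\<close>, and every
  cycle is homologous to some \<open>D a b\<close>, since its edges are such differences up to a potential on the
  vertices.  Hence \<open>\<sigma> \<mapsto> [a, \<sigma> a]\<close> is an epimorphism that does not depend on \<open>a\<close>.  If \<open>\<sigma>\<close> fixes a
  small model pointwise, then by compactness some realization \<open>c\<close> satisfies \<open>c a \<equiv> c \<sigma>(a)\<close>, so
  \<open>\<sigma>\<close> has the same value as an automorphism fixing \<open>c\<close>, which is \<open>[c, c] = 0\<close>.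
\<close>

text \<open>Two obstacles shape the proof. First, a simplex is a functor and not a configuration in
  the monster, and a map between closures need not be determined by its values on a generating
  tuple. The hypothesis on \<open>p\<close> repairs this: an automorphism fixing a realization
  \<open>a\<close> fixes acl(\<open>a\<close>) pointwise, so an edge is determined by enumerations
  of its two vertices and the images of these in its top object. Re-embedding the top object costs
  only a boundary; up to boundaries an edge is therefore the type of an independent pair together
  with two vertex enumerations. Second, no amalgamation axiom is assumed, so three edges with
  matching vertices need not bound a triangle. The only triangles at hand come from extension, by
  adding a point independent from finitely many given ones; for this reason everything is expressed
  by differences of edges towards a common apex.

  Saturation is given for one variable only. Compactness in a small set of variables and the
  extension of small elementary maps to automorphisms are built from it; the former produces the
  realization \<open>c\<close> belonging to an automorphism that fixes a model.\<close>

section \<open>Formulas, and definable predicates on tuples with arbitrary index sets\<close>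

section \<open>Formulas\<close>

lemma finite_fv_tm [simp]: "finite (fv_tm t)"
  by (induction t) auto

lemma finite_fv [simp]: "finite (fv \<phi>)"
  by (induction \<phi>) auto

lemma eval_cong: "(\<And>x. x \<in> fv_tm t \<Longrightarrow> v x = w x) \<Longrightarrow> eval M v t = eval M w t"
proof (induction t)
  case (Fn f ts)
  then have "map (eval M v) ts = map (eval M w) ts" by auto
  then show ?case by (simp del: map_eq_conv)
qed simp

lemma map_eval_cong:
  "(\<And>x. x \<in> (\<Union>t\<in>set ts. fv_tm t) \<Longrightarrow> v x = w x) \<Longrightarrow> map (eval M v) ts = map (eval M w) ts"
  by (intro map_cong refl eval_cong) blast

lemma sat_cong: "(\<And>x. x \<in> fv \<phi> \<Longrightarrow> v x = w x) \<Longrightarrow> sat M U v \<phi> = sat M U w \<phi>"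
proof (induction \<phi> arbitrary: v w)
  case (Eq t u)
  then have "eval M v t = eval M w t" "eval M v u = eval M w u" by (auto intro: eval_cong)
  then show ?case by simp
next
  case (Rel r ts)
  then have "map (eval M v) ts = map (eval M w) ts" by (intro map_eval_cong) auto
  then show ?case by (simp del: map_eq_conv)
next
  case (Neg \<phi>)
  from Neg.IH[of v w] Neg.prems show ?case by simp
next
  case (Conj \<phi> \<psi>)
  from Conj.IH(1)[of v w] Conj.IH(2)[of v w] Conj.prems show ?case by simp
next
  case (Ex x \<phi>)
  have "sat M U (v(x := y)) \<phi> = sat M U (w(x := y)) \<phi>" for y
    by (rule Ex.IH) (use Ex.prems in auto)
  then show ?case by simp
qed

lemma eval_sort:
  assumes "is_structure M" "wf_tm M t" "\<And>x. x \<in> fv_tm t \<Longrightarrow> sort_of M (v x) = fst x"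
  shows "sort_of M (eval M v t) = tm_sort M t"
  using assms(2,3)
proof (induction t)
  case (Fn f ts)
  then have "sort_of M (eval M v t) = tm_sort M t" if "t \<in> set ts" for t
    using that by fastforce
  then have "map (sort_of M) (map (eval M v) ts) = map (tm_sort M) ts" by simp
  with Fn.prems assms(1) show ?case by (simp add: is_structure_def)
qed simp

lemma map_eval_sort:
  assumes "is_structure M" "\<forall>t\<in>set ts. wf_tm M t"
    "\<And>x. x \<in> (\<Union>t\<in>set ts. fv_tm t) \<Longrightarrow> sort_of M (v x) = fst x"
  shows "map (sort_of M) (map (eval M v) ts) = map (tm_sort M) ts"
proof -
  have "sort_of M (eval M v t) = tm_sort M t" if "t \<in> set ts" for t
    by (rule eval_sort[OF assms(1)]) (use assms that in blast)+
  then show ?thesis by simp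
qed

fun subst_tm :: "('s var \<Rightarrow> 's var) \<Rightarrow> ('s, 'f) tm \<Rightarrow> ('s, 'f) tm" where
  "subst_tm \<rho> (Var x) = Var (\<rho> x)"
| "subst_tm \<rho> (Fn f ts) = Fn f (map (subst_tm \<rho>) ts)"

lemma eval_subst_tm: "eval M v (subst_tm \<rho> t) = eval M (v \<circ> \<rho>) t"
proof (induction t)
  case (Fn f ts)
  then have "map (eval M v) (map (subst_tm \<rho>) ts) = map (eval M (v \<circ> \<rho>)) ts"
    by (auto simp: o_def)
  then show ?case by (simp add: o_def del: map_map map_eq_conv)
qed simp

lemma fv_subst_tm: "fv_tm (subst_tm \<rho> t) = \<rho> ` fv_tm t"
  by (induction t) auto

lemma wf_subst_tm:
  "wf_tm M t \<Longrightarrow> (\<And>x. x \<in> fv_tm t \<Longrightarrow> fst (\<rho> x) = fst x) \<Longrightarrow>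
     wf_tm M (subst_tm \<rho> t) \<and> tm_sort M (subst_tm \<rho> t) = tm_sort M t"
proof (induction t)
  case (Fn f ts)
  have *: "wf_tm M (subst_tm \<rho> t) \<and> tm_sort M (subst_tm \<rho> t) = tm_sort M t"
    if "t \<in> set ts" for t
    by (rule Fn.IH[OF that]) (use Fn.prems that in auto)
  then have "map (tm_sort M) (map (subst_tm \<rho>) ts) = map (tm_sort M) ts" by auto
  with * Fn.prems show ?case by (auto simp del: map_map map_eq_conv)
qed simp

lemma fresh_var:
  assumes "finite (X :: 's var set)"
  obtains n where "(s, n) \<notin> X"
proof -
  have "finite (snd ` X)" using assms by simp
  then obtain n where "n \<notin> snd ` X" using ex_new_if_finite infinite_UNIV_nat by blast
  then show thesis using that[of n] by force
qed

text \<open>The substitution need not be injective, so bound variables have to be renamed on the way.\<close>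

lemma substitution:
  fixes \<rho> :: "'s var \<Rightarrow> 's var"
  assumes "wf_fm M \<phi>" "\<And>x. x \<in> fv \<phi> \<Longrightarrow> fst (\<rho> x) = fst x"
  obtains \<psi> where "wf_fm M \<psi>" "fv \<psi> \<subseteq> \<rho> ` fv \<phi>" "\<And>U v. sat M U v \<psi> = sat M U (v \<circ> \<rho>) \<phi>"
proof -
  have "\<exists>\<psi>. wf_fm M \<psi> \<and> fv \<psi> \<subseteq> \<rho> ` fv \<phi> \<and> (\<forall>U v. sat M U v \<psi> = sat M U (\<lambda>u. v (\<rho> u)) \<phi>)"
    if "wf_fm M \<phi>" "\<forall>x\<in>fv \<phi>. fst (\<rho> x) = fst x"
    using that
  proof (induction \<phi> arbitrary: \<rho>)
    case (Eq t u)
    then show ?case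
      by (intro exI[of _ "Eq (subst_tm \<rho> t) (subst_tm \<rho> u)"])
        (auto simp: eval_subst_tm fv_subst_tm wf_subst_tm o_def)
  next
    case (Rel r ts)
    have 1: "map (eval M v) (map (subst_tm \<rho>) ts) = map (eval M (\<lambda>u. v (\<rho> u))) ts" for v
      by (auto simp: eval_subst_tm o_def)
    have 2: "wf_tm M (subst_tm \<rho> t) \<and> tm_sort M (subst_tm \<rho> t) = tm_sort M t" if "t \<in> set ts" for t
      using Rel that by (intro wf_subst_tm) auto
    then have "map (tm_sort M) (map (subst_tm \<rho>) ts) = map (tm_sort M) ts" by auto
    with 1 2 Rel show ?case
      by (intro exI[of _ "Rel r (map (subst_tm \<rho>) ts)"])
        (auto simp: fv_subst_tm simp del: map_map map_eq_conv)
  next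
    case (Neg \<phi>)
    obtain \<psi> where "wf_fm M \<psi>" "fv \<psi> \<subseteq> \<rho> ` fv \<phi>"
      "\<forall>U v. sat M U v \<psi> = sat M U (\<lambda>u. v (\<rho> u)) \<phi>"
      using Neg.IH[of \<rho>] Neg.prems by auto
    then show ?case by (intro exI[of _ "Neg \<psi>"]) simp
  next
    case (Conj \<phi>1 \<phi>2)
    obtain \<psi>1 where 1: "wf_fm M \<psi>1" "fv \<psi>1 \<subseteq> \<rho> ` fv \<phi>1"
      "\<forall>U v. sat M U v \<psi>1 = sat M U (\<lambda>u. v (\<rho> u)) \<phi>1"
      using Conj.IH(1)[of \<rho>] Conj.prems by auto
    obtain \<psi>2 where 2: "wf_fm M \<psi>2" "fv \<psi>2 \<subseteq> \<rho> ` fv \<phi>2"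
      "\<forall>U v. sat M U v \<psi>2 = sat M U (\<lambda>u. v (\<rho> u)) \<phi>2"
      using Conj.IH(2)[of \<rho>] Conj.prems by auto
    have "fv (Conj \<psi>1 \<psi>2) \<subseteq> \<rho> ` fv (Conj \<phi>1 \<phi>2)" using 1(2) 2(2) by auto
    with 1 2 show ?case by (intro exI[of _ "Conj \<psi>1 \<psi>2"]) simp
  next
    case (Ex x \<phi>)
    have "finite (\<rho> ` fv \<phi>)" by simp
    then obtain n where n: "(fst x, n) \<notin> \<rho> ` fv \<phi>" by (rule fresh_var)
    let ?z = "(fst x, n)"
    have "\<forall>u\<in>fv \<phi>. fst ((\<rho>(x := ?z)) u) = fst u"
      using Ex.prems by auto
    then obtain \<psi> where \<psi>: "wf_fm M \<psi>" "fv \<psi> \<subseteq> \<rho>(x := ?z) ` fv \<phi>"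
      "\<forall>U v. sat M U v \<psi> = sat M U (\<lambda>u. v ((\<rho>(x := ?z)) u)) \<phi>"
      using Ex.IH[of "\<rho>(x := ?z)"] Ex.prems by (auto simp del: fun_upd_apply)
    have "sat M U (\<lambda>u. (v(?z := y)) ((\<rho>(x := ?z)) u)) \<phi> = sat M U ((\<lambda>u. v (\<rho> u))(x := y)) \<phi>" for U v y
    proof (rule sat_cong)
      fix u assume "u \<in> fv \<phi>"
      then have "\<rho> u \<noteq> ?z" using n by (metis image_eqI)
      then show "(v(?z := y)) ((\<rho>(x := ?z)) u) = ((\<lambda>u. v (\<rho> u))(x := y)) u" by simp
    qed
    moreover have "fv \<psi> - {?z} \<subseteq> \<rho> ` (fv \<phi> - {x})"
      using \<psi>(2) by (auto split: if_splits)
    ultimately show ?case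
      using \<psi>(1) Ex.prems
      by (intro exI[of _ "Ex ?z \<psi>"]) (simp add: \<psi>(3) del: fun_upd_apply)
  qed
  then show thesis using that assms unfolding o_def by blast
qed

section \<open>Definable predicates on tuples\<close>

definition well_sorted :: "('s, 'f, 'r, 'm) mstruct \<Rightarrow> ('k \<Rightarrow> 's) \<Rightarrow> ('k \<Rightarrow> 'm) \<Rightarrow> bool" where
  "well_sorted M ss w \<longleftrightarrow> (\<forall>k. sort_of M (w k) = ss k)"

text \<open>Variables of formulas are pairs of a sort and a number, whereas tuples are indexed by an
  arbitrary type. A predicate is therefore presented by a formula and a placement
  \<open>\<tau>\<close> of its variables at coordinates; \<open>\<tau>\<close> need not be
  injective. Agreement is asked for well-sorted tuples only, since formulas say nothing sensible
  about the others.\<close>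

definition definable ::
    "('s, 'f, 'r, 'm) mstruct \<Rightarrow> ('k \<Rightarrow> 's) \<Rightarrow> 'k set \<Rightarrow> (('k \<Rightarrow> 'm) \<Rightarrow> bool) \<Rightarrow> bool" where
  "definable M ss K P \<longleftrightarrow>
     (\<exists>\<phi> \<tau>. wf_fm M \<phi> \<and> (\<forall>x\<in>fv \<phi>. \<tau> x \<in> K \<and> ss (\<tau> x) = fst x) \<and>
        (\<forall>w. well_sorted M ss w \<longrightarrow> P w = sat M UNIV (w \<circ> \<tau>) \<phi>))"

lemma definableI:
  assumes "wf_fm M \<phi>" "\<And>x. x \<in> fv \<phi> \<Longrightarrow> \<tau> x \<in> K" "\<And>x. x \<in> fv \<phi> \<Longrightarrow> ss (\<tau> x) = fst x"
    "\<And>w. well_sorted M ss w \<Longrightarrow> P w = sat M UNIV (w \<circ> \<tau>) \<phi>"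
  shows "definable M ss K P"
  using assms unfolding definable_def by blast

lemma well_sorted_upd [intro]: "well_sorted M ss w \<Longrightarrow> sort_of M y = ss k \<Longrightarrow> well_sorted M ss (w(k := y))"
  by (simp add: well_sorted_def)

lemma definable_mono: "definable M ss K P \<Longrightarrow> K \<subseteq> K' \<Longrightarrow> definable M ss K' P"
  unfolding definable_def by (meson subsetD)

lemma definable_finite_support:
  assumes "definable M ss K P"
  obtains F where "finite F" "F \<subseteq> K" "definable M ss F P"
proof -
  obtain \<phi> \<tau> where *: "wf_fm M \<phi>" "\<forall>x\<in>fv \<phi>. \<tau> x \<in> K \<and> ss (\<tau> x) = fst x"
    "\<forall>w. well_sorted M ss w \<longrightarrow> P w = sat M UNIV (w \<circ> \<tau>) \<phi>"
    using assms unfolding definable_def by blast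
  show thesis
  proof
    show "definable M ss (\<tau> ` fv \<phi>) P"
      using * unfolding definable_def by blast
  qed (use * in auto)
qed

lemma definable_cong:
  assumes "definable M ss K P" "well_sorted M ss w" "well_sorted M ss w'" "\<And>k. k \<in> K \<Longrightarrow> w k = w' k"
  shows "P w = P w'"
proof -
  obtain \<phi> \<tau> where *: "\<forall>x\<in>fv \<phi>. \<tau> x \<in> K"
    "\<forall>w. well_sorted M ss w \<longrightarrow> P w = sat M UNIV (w \<circ> \<tau>) \<phi>"
    using assms(1) unfolding definable_def by blast
  have "sat M UNIV (w \<circ> \<tau>) \<phi> = sat M UNIV (w' \<circ> \<tau>) \<phi>"
    by (rule sat_cong) (use * assms(4) in auto)
  then show ?thesis using * assms by auto
qed

lemma definable_not:
  assumes "definable M ss K P"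
  shows "definable M ss K (\<lambda>w. \<not> P w)"
proof -
  obtain \<phi> \<tau> where *: "wf_fm M \<phi>" "\<forall>x\<in>fv \<phi>. \<tau> x \<in> K \<and> ss (\<tau> x) = fst x"
    "\<forall>w. well_sorted M ss w \<longrightarrow> P w = sat M UNIV (w \<circ> \<tau>) \<phi>"
    using assms unfolding definable_def by blast
  show ?thesis by (rule definableI[of _ "Neg \<phi>" \<tau>]) (use * in auto)
qed

text \<open>The variables of the two conjuncts are separated by the parity of their indices.\<close>

lemma definable_conj:
  assumes "definable M ss K P" "definable M ss K Q"
  shows "definable M ss K (\<lambda>w. P w \<and> Q w)"
proof -
  obtain \<phi> \<tau> where 1: "wf_fm M \<phi>" "\<forall>x\<in>fv \<phi>. \<tau> x \<in> K \<and> ss (\<tau> x) = fst x"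
    "\<forall>w. well_sorted M ss w \<longrightarrow> P w = sat M UNIV (w \<circ> \<tau>) \<phi>"
    using assms(1) unfolding definable_def by blast
  obtain \<phi>' \<tau>' where 2: "wf_fm M \<phi>'" "\<forall>x\<in>fv \<phi>'. \<tau>' x \<in> K \<and> ss (\<tau>' x) = fst x"
    "\<forall>w. well_sorted M ss w \<longrightarrow> Q w = sat M UNIV (w \<circ> \<tau>') \<phi>'"
    using assms(2) unfolding definable_def by blast
  define \<rho> \<rho>' :: "'a var \<Rightarrow> 'a var"
    where "\<rho> = (\<lambda>(s, n). (s, 2 * n))" and "\<rho>' = (\<lambda>(s, n). (s, 2 * n + 1))"
  define \<tau>'' where "\<tau>'' = (\<lambda>(s, n). if even n then \<tau> (s, n div 2) else \<tau>' (s, n div 2))"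
  have \<tau>: "\<tau>'' \<circ> \<rho> = \<tau>" "\<tau>'' \<circ> \<rho>' = \<tau>'"
    by (auto simp: fun_eq_iff \<tau>''_def \<rho>_def \<rho>'_def)
  have \<tau>_app: "\<tau>'' (\<rho> x) = \<tau> x" "\<tau>'' (\<rho>' x) = \<tau>' x" "fst (\<rho> x) = fst x" "fst (\<rho>' x) = fst x" for x
    using \<tau> by (auto simp: fun_eq_iff \<rho>_def \<rho>'_def split: prod.splits)
  obtain \<psi> where \<psi>: "wf_fm M \<psi>" "fv \<psi> \<subseteq> \<rho> ` fv \<phi>" "\<And>U v. sat M U v \<psi> = sat M U (v \<circ> \<rho>) \<phi>"
    by (rule substitution[OF 1(1), of \<rho>]) (auto simp: \<tau>_app)
  obtain \<psi>' where \<psi>': "wf_fm M \<psi>'" "fv \<psi>' \<subseteq> \<rho>' ` fv \<phi>'"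
    "\<And>U v. sat M U v \<psi>' = sat M U (v \<circ> \<rho>') \<phi>'"
    by (rule substitution[OF 2(1), of \<rho>']) (auto simp: \<tau>_app)
  have "\<tau>'' x \<in> K \<and> ss (\<tau>'' x) = fst x" if "x \<in> fv (Conj \<psi> \<psi>')" for x
    using that \<psi>(2) \<psi>'(2) 1(2) 2(2) by (auto simp: \<tau>_app)
  then show ?thesis
    using \<psi> \<psi>' 1 2 \<tau>
    by (intro definableI[of _ "Conj \<psi> \<psi>'" \<tau>'']) (auto simp: comp_assoc)
qed

text \<open>The syntax has no truth constant; the sentence "some x equals itself", over the sort of
  an arbitrary element, takes its place and serves as the empty conjunction.\<close>

lemma wf_fm_exists: "\<exists>\<phi> :: ('s, 'f, 'r) fm. wf_fm (M :: ('s, 'f, 'r, 'm) mstruct) \<phi> \<and> fv \<phi> = {} \<and> (\<forall>v. sat M UNIV v \<phi>)"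
proof -
  let ?x = "(sort_of M undefined, 0)"
  show ?thesis
    by (rule exI[of _ "Ex ?x (Eq (Var ?x) (Var ?x))"]) (auto simp: sorts_def)
qed

lemma definable_True: "definable M ss K (\<lambda>_. True)"
  using wf_fm_exists[of M] unfolding definable_def by (metis empty_iff)

lemma definable_conj_finite:
  assumes "finite F" "\<And>P. P \<in> F \<Longrightarrow> definable M ss K P"
  shows "definable M ss K (\<lambda>w. \<forall>P\<in>F. P w)"
  using assms
proof (induction F rule: finite_induct)
  case (insert P F)
  have "definable M ss K (\<lambda>w. P w \<and> (\<forall>P\<in>F. P w))"
    by (rule definable_conj) (use insert in auto)
  then show ?case by simp
qed (simp add: definable_True)

lemma definable_ex:
  assumes "definable M ss K P" "ss k \<in> sorts M"
  shows "definable M ss (K - {k}) (\<lambda>w. \<exists>y. sort_of M y = ss k \<and> P (w(k := y)))"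
proof -
  obtain \<phi> \<tau> where 1: "wf_fm M \<phi>" "\<forall>x\<in>fv \<phi>. \<tau> x \<in> K \<and> ss (\<tau> x) = fst x"
    "\<forall>w. well_sorted M ss w \<longrightarrow> P w = sat M UNIV (w \<circ> \<tau>) \<phi>"
    using assms(1) unfolding definable_def by blast
  \<comment> \<open>All variables placed at \<open>k\<close> are merged into the one variable of
    index 0 that will be bound; the other indices are shifted up by one to make room, and
    \<open>\<tau>'\<close> undoes the shift. The value of \<open>\<tau>'\<close> at the bound
    variable does not matter.\<close>
  define \<rho> where "\<rho> x = (if \<tau> x = k then (ss k, 0) else (fst x, Suc (snd x)))" for x
  define \<tau>' where "\<tau>' x = \<tau> (fst x, snd x - 1)" for x
  have \<rho>: "fst (\<rho> x) = fst x" if "x \<in> fv \<phi>" for x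
    using 1(2) that by (auto simp: \<rho>_def)
  obtain \<psi> where \<psi>: "wf_fm M \<psi>" "fv \<psi> \<subseteq> \<rho> ` fv \<phi>" "\<And>U v. sat M U v \<psi> = sat M U (v \<circ> \<rho>) \<phi>"
    by (rule substitution[OF 1(1), of \<rho>]) (use \<rho> in auto)
  show ?thesis
  proof (rule definableI[of _ "Ex (ss k, 0) \<psi>" \<tau>'])
    show "wf_fm M (Ex (ss k, 0) \<psi>)" using \<psi> assms by simp
  next
    fix x assume "x \<in> fv (Ex (ss k, 0) \<psi>)"
    then obtain u where u: "u \<in> fv \<phi>" "x = \<rho> u" "x \<noteq> (ss k, 0)" using \<psi>(2) by auto
    then have "\<tau> u \<noteq> k" "\<tau>' x = \<tau> u" "fst x = fst u" by (auto simp: \<rho>_def \<tau>'_def split: if_splits)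
    with u 1(2) show "\<tau>' x \<in> K - {k}" "ss (\<tau>' x) = fst x" by auto
  next
    fix w assume w: "well_sorted M ss w"
    have "sat M UNIV ((w \<circ> \<tau>')((ss k, 0) := y)) \<psi> = P (w(k := y))" if "sort_of M y = ss k" for y
    proof -
      have "sat M UNIV (((w \<circ> \<tau>')((ss k, 0) := y)) \<circ> \<rho>) \<phi> = sat M UNIV (w(k := y) \<circ> \<tau>) \<phi>"
        by (rule sat_cong) (auto simp: \<rho>_def \<tau>'_def)
      then show ?thesis using 1(3) w that \<psi>(3) by auto
    qed
    then show "(\<exists>y. sort_of M y = ss k \<and> P (w(k := y))) = sat M UNIV (w \<circ> \<tau>') (Ex (ss k, 0) \<psi>)"
      by auto
  qed
qed

lemma definable_ex_finite:
  assumes "finite F" "definable M ss K P" "\<And>k. k \<in> F \<Longrightarrow> ss k \<in> sorts M"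
  shows "definable M ss (K - F) (\<lambda>w. \<exists>w'. well_sorted M ss w' \<and> (\<forall>k. k \<notin> F \<longrightarrow> w' k = w k) \<and> P w')"
  using assms
proof (induction F rule: finite_induct)
  case empty
  then obtain \<phi> \<tau> where 1: "wf_fm M \<phi>" "\<forall>x\<in>fv \<phi>. \<tau> x \<in> K \<and> ss (\<tau> x) = fst x"
    "\<forall>w. well_sorted M ss w \<longrightarrow> P w = sat M UNIV (w \<circ> \<tau>) \<phi>"
    unfolding definable_def by blast
  show ?case
  proof (rule definableI[of _ \<phi> \<tau>])
    fix w assume w: "well_sorted M ss w"
    have "w' = w" if "\<forall>k. k \<notin> {} \<longrightarrow> w' k = w k" for w' using that by auto
    then show "(\<exists>w'. well_sorted M ss w' \<and> (\<forall>k. k \<notin> {} \<longrightarrow> w' k = w k) \<and> P w') =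
      sat M UNIV (w \<circ> \<tau>) \<phi>"
      using 1(3) w by blast
  qed (use 1 in auto)
next
  case (insert k F)
  let ?P = "\<lambda>w. \<exists>w'. well_sorted M ss w' \<and> (\<forall>k. k \<notin> F \<longrightarrow> w' k = w k) \<and> P w'"
  have "definable M ss (K - F - {k}) (\<lambda>w. \<exists>y. sort_of M y = ss k \<and> ?P (w(k := y)))"
    by (rule definable_ex) (use insert in auto)
  moreover have "(\<exists>y. sort_of M y = ss k \<and> ?P (w(k := y))) =
    (\<exists>w'. well_sorted M ss w' \<and> (\<forall>j. j \<notin> insert k F \<longrightarrow> w' j = w j) \<and> P w')" for w
  proof
    assume "\<exists>y. sort_of M y = ss k \<and> ?P (w(k := y))"
    then obtain y w' where "well_sorted M ss w'" "\<forall>j. j \<notin> F \<longrightarrow> w' j = (w(k := y)) j" "P w'" by blast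
    then show "\<exists>w'. well_sorted M ss w' \<and> (\<forall>j. j \<notin> insert k F \<longrightarrow> w' j = w j) \<and> P w'" by auto
  next
    assume "\<exists>w'. well_sorted M ss w' \<and> (\<forall>j. j \<notin> insert k F \<longrightarrow> w' j = w j) \<and> P w'"
    then obtain w' where w': "well_sorted M ss w'" "\<forall>j. j \<notin> insert k F \<longrightarrow> w' j = w j" "P w'" by blast
    then have "sort_of M (w' k) = ss k" "\<forall>j. j \<notin> F \<longrightarrow> w' j = (w(k := w' k)) j"
      by (auto simp: well_sorted_def)
    with w' show "\<exists>y. sort_of M y = ss k \<and> ?P (w(k := y))" by blast
  qed
  moreover have "K - insert k F = K - F - {k}" by blast
  ultimately show ?case by (simp only:)
qed

section \<open>Cardinalities below the monster, saturation and compactness\<close>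

section \<open>Small sets\<close>

lemma lepoll_iff_ordLeq: "A \<lesssim> B \<longleftrightarrow> (card_of A, card_of B) \<in> ordLeq"
  unfolding lepoll_def card_of_ordLeq ..

lemma lesspoll_iff_ordLess: "A \<prec> B \<longleftrightarrow> (card_of A, card_of B) \<in> ordLess"
  unfolding lesspoll_def lepoll_iff_ordLeq eqpoll_iff_card_of_ordIso ordLeq_iff_ordLess_or_ordIso
  using not_ordLess_ordIso by blast

lemma infinite_UN_lepoll:
  assumes "infinite S" "I \<lesssim> S" "\<And>i. i \<in> I \<Longrightarrow> A i \<lesssim> S"
  shows "(\<Union>i\<in>I. A i) \<lesssim> S"
  using assms unfolding lepoll_iff_ordLeq by (intro card_of_UNION_ordLeq_infinite) auto

lemma infinite_Times_lepoll:
  assumes "infinite S" "A \<lesssim> S" "B \<lesssim> S"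
  shows "A \<times> B \<lesssim> S"
  using assms unfolding lepoll_iff_ordLeq by (intro card_of_Times_ordLeq_infinite) auto

lemma infinite_lists_lepoll:
  assumes "infinite S" "A \<lesssim> S"
  shows "lists A \<lesssim> S"
proof -
  have "lists S \<approx> S" using assms(1) by (simp add: eqpoll_iff_card_of_ordIso)
  then show ?thesis using lists_lepoll_mono[OF assms(2)] lepoll_trans2 by blast
qed

lemma small_subset: "small M B \<Longrightarrow> A \<subseteq> B \<Longrightarrow> small M A"
  unfolding small_def using lesspoll_trans1 subset_imp_lepoll by blast

lemma small_lepoll: "small M B \<Longrightarrow> A \<lesssim> B \<Longrightarrow> small M A"
  unfolding small_def using lesspoll_trans1 by blast

lemma small_image: "small M A \<Longrightarrow> small M (f ` A)"
  using small_lepoll image_lepoll by blast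

locale monster_model =
  fixes M :: "('s, 'f, 'r, 'm) mstruct"
  assumes monster: "monster M"
begin

lemma structure_axiom: "is_structure M" and saturation_axiom: "saturated M" and large_axiom: "large M"
  using monster by (auto simp: monster_def)

lemma small_nat: "small M (UNIV :: nat set)"
  using large_axiom by (simp add: large_def)

lemma infinite_universe: "infinite (UNIV :: 'm set)"
  using small_nat unfolding small_def infinite_le_lepoll using lesspoll_imp_lepoll by blast

lemma small_finite: "finite A \<Longrightarrow> small M A"
  unfolding small_def using finite_lesspoll_infinite infinite_universe by blast

lemma small_Un: "small M A \<Longrightarrow> small M B \<Longrightarrow> small M (A \<union> B)"
  unfolding small_def lesspoll_iff_ordLess
  by (rule card_of_Un_ordLess_infinite[OF infinite_universe])

lemma small_insert: "small M A \<Longrightarrow> small M (insert x A)"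
  using small_Un[of "{x}" A] small_finite[of "{x}"] by simp

lemma small_UN_finite: "finite I \<Longrightarrow> (\<And>i. i \<in> I \<Longrightarrow> small M (A i)) \<Longrightarrow> small M (\<Union>i\<in>I. A i)"
  by (induction I rule: finite_induct) (auto simp: small_finite small_Un)

section \<open>Saturation and compactness\<close>

text \<open>Saturation speaks of formulas in the variable \<open>(ss k, 0)\<close> with parameters
  from a small set. This lemma brings a definable predicate, with coordinate \<open>k\<close> left
  free and the others frozen at \<open>w\<close>, into that shape, by the same merging and shifting
  of variables as in \<open>definable_ex\<close>.\<close>

lemma definable_solutions:
  assumes "well_sorted M ss w" "definable M ss (insert k K) Q"
  obtains \<phi> v where "wf_fm M \<phi>" "params_in M (w ` K) (fv \<phi> - {(ss k, 0)}) v"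
    "\<And>y. sort_of M y = ss k \<Longrightarrow> y \<in> solutions M (ss k, 0) \<phi> v \<longleftrightarrow> Q (w(k := y))"
proof -
  obtain \<phi> \<tau> where 1: "wf_fm M \<phi>" "\<forall>x\<in>fv \<phi>. \<tau> x \<in> insert k K \<and> ss (\<tau> x) = fst x"
    "\<forall>w. well_sorted M ss w \<longrightarrow> Q w = sat M UNIV (w \<circ> \<tau>) \<phi>"
    using assms(2) unfolding definable_def by blast
  define \<rho> where "\<rho> x = (if \<tau> x = k then (ss k, 0) else (fst x, Suc (snd x)))" for x
  define v where "v x = w (\<tau> (fst x, snd x - 1))" for x
  have \<rho>: "fst (\<rho> x) = fst x" if "x \<in> fv \<phi>" for x
    using 1(2) that by (auto simp: \<rho>_def)
  obtain \<psi> where \<psi>: "wf_fm M \<psi>" "fv \<psi> \<subseteq> \<rho> ` fv \<phi>" "\<And>U v. sat M U v \<psi> = sat M U (v \<circ> \<rho>) \<phi>"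
    by (rule substitution[OF 1(1), of \<rho>]) (use \<rho> in auto)
  show thesis
  proof
    show "wf_fm M \<psi>" by fact
    show "params_in M (w ` K) (fv \<psi> - {(ss k, 0)}) v"
      unfolding params_in_def
    proof
      fix x assume "x \<in> fv \<psi> - {(ss k, 0)}"
      then obtain u where u: "u \<in> fv \<phi>" "x = \<rho> u" "x \<noteq> (ss k, 0)" using \<psi>(2) by auto
      then have "\<tau> u \<noteq> k" "v x = w (\<tau> u)" "fst x = fst u"
        by (auto simp: \<rho>_def v_def split: if_splits)
      with u 1(2) assms(1) show "v x \<in> w ` K \<and> sort_of M (v x) = fst x"
        by (auto simp: well_sorted_def)
    qed
    fix y assume y: "sort_of M y = ss k"
    have "sat M UNIV ((v((ss k, 0) := y)) \<circ> \<rho>) \<phi> = sat M UNIV (w(k := y) \<circ> \<tau>) \<phi>"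
      by (rule sat_cong) (auto simp: \<rho>_def v_def)
    moreover have "well_sorted M ss (w(k := y))" using assms(1) y by blast
    ultimately show "y \<in> solutions M (ss k, 0) \<psi> v \<longleftrightarrow> Q (w(k := y))"
      using 1(3) y by (simp add: solutions_def \<psi>(3))
  qed
qed

lemma well_sorted_sorts: "well_sorted M ss w \<Longrightarrow> ss k \<in> sorts M"
  unfolding well_sorted_def sorts_def by (metis rangeI)

lemma saturation:
  assumes w: "well_sorted M ss w" and K: "small M K"
    and def: "\<And>Q. Q \<in> \<Q> \<Longrightarrow> definable M ss (insert k K) Q"
    and fin: "\<And>F. finite F \<Longrightarrow> F \<subseteq> \<Q> \<Longrightarrow> \<exists>y. sort_of M y = ss k \<and> (\<forall>Q\<in>F. Q (w(k := y)))"
  shows "\<exists>y. sort_of M y = ss k \<and> (\<forall>Q\<in>\<Q>. Q (w(k := y)))"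
proof -
  have "\<exists>\<phi> v. wf_fm M \<phi> \<and> params_in M (w ` K) (fv \<phi> - {(ss k, 0)}) v \<and>
    (\<forall>y. sort_of M y = ss k \<longrightarrow> (y \<in> solutions M (ss k, 0) \<phi> v \<longleftrightarrow> Q (w(k := y))))"
    if "Q \<in> \<Q>" for Q
    using definable_solutions[OF w def[OF that]] by metis
  then obtain \<phi> v where \<phi>v: "\<And>Q. Q \<in> \<Q> \<Longrightarrow> wf_fm M (\<phi> Q)"
    "\<And>Q. Q \<in> \<Q> \<Longrightarrow> params_in M (w ` K) (fv (\<phi> Q) - {(ss k, 0)}) (v Q)"
    "\<And>Q y. Q \<in> \<Q> \<Longrightarrow> sort_of M y = ss k \<Longrightarrow> y \<in> solutions M (ss k, 0) (\<phi> Q) (v Q) \<longleftrightarrow> Q (w(k := y))"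
    by metis
  define \<Gamma> where "\<Gamma> = (\<lambda>Q. (\<phi> Q, v Q)) ` \<Q>"
  have "\<exists>y. sort_of M y = ss k \<and> (\<forall>(\<phi>, v)\<in>\<Gamma>. y \<in> solutions M (ss k, 0) \<phi> v)"
  proof (rule saturation_axiom[unfolded saturated_def, THEN spec, THEN spec, THEN spec, THEN mp,
        of "w ` K" "ss k" \<Gamma>], intro conjI allI impI)
    show "small M (w ` K)" using K by (rule small_image)
    show "ss k \<in> sorts M" using w by (rule well_sorted_sorts)
    show "\<forall>(\<phi>, v)\<in>\<Gamma>. wf_fm M \<phi> \<and> params_in M (w ` K) (fv \<phi> - {(ss k, 0)}) v"
      unfolding \<Gamma>_def using \<phi>v(1,2) by blast
    fix \<Gamma>0 assume "\<Gamma>0 \<subseteq> \<Gamma>" "finite \<Gamma>0"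
    then obtain F where F: "F \<subseteq> \<Q>" "finite F" "\<Gamma>0 = (\<lambda>Q. (\<phi> Q, v Q)) ` F"
      unfolding \<Gamma>_def using finite_subset_image[of \<Gamma>0] by blast
    obtain y where y: "sort_of M y = ss k" "\<forall>Q\<in>F. Q (w(k := y))" using fin F by blast
    have "y \<in> solutions M (ss k, 0) (\<phi> Q) (v Q)" if "Q \<in> F" for Q
      using \<phi>v(3)[of Q y] y F(1) that by blast
    then show "\<exists>y. sort_of M y = ss k \<and> (\<forall>(\<phi>, v)\<in>\<Gamma>0. y \<in> solutions M (ss k, 0) \<phi> v)"
      unfolding F(3) using y(1) by blast
  qed
  then obtain y where y: "sort_of M y = ss k" "\<forall>(\<phi>, v)\<in>\<Gamma>. y \<in> solutions M (ss k, 0) \<phi> v"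
    by blast
  have "Q (w(k := y))" if "Q \<in> \<Q>" for Q
    using \<phi>v(3)[OF that y(1)] y(2) that unfolding \<Gamma>_def by blast
  then show ?thesis using y(1) by blast
qed

text \<open>Zorn's lemma is applied to the partial assignments, seen as sets of pairs, all of whose
  finite parts are consistent with every finite part of \<open>\<Q>\<close>; this family has finite character,
  and its members are automatically single-valued.\<close>

lemma compactness:
  assumes w: "well_sorted M ss w" and K: "small M K"
    and def: "\<And>Q. Q \<in> \<Q> \<Longrightarrow> definable M ss K Q"
    and fin: "\<And>F. finite F \<Longrightarrow> F \<subseteq> \<Q> \<Longrightarrow>
      \<exists>w'. well_sorted M ss w' \<and> (\<forall>k\<in>K0. w' k = w k) \<and> (\<forall>Q\<in>F. Q w')"
  shows "\<exists>w'. well_sorted M ss w' \<and> (\<forall>k\<in>K0. w' k = w k) \<and> (\<forall>Q\<in>\<Q>. Q w')"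
proof -
  define consistent where "consistent R \<longleftrightarrow> (\<forall>F R'. finite F \<and> F \<subseteq> \<Q> \<and> finite R' \<and> R' \<subseteq> R \<longrightarrow>
    (\<exists>w'. well_sorted M ss w' \<and> (\<forall>(k, y)\<in>R'. w' k = y) \<and> (\<forall>Q\<in>F. Q w')))" for R
  \<comment> \<open>The prescribed part may be as large as the monster: saturation is applied only
    over parameters indexed by the small set \<open>K\<close>.\<close>
  define R0 where "R0 = (\<lambda>k. (k, w k)) ` K0"
  have "consistent R0"
    unfolding consistent_def
  proof (intro allI impI)
    fix F R' assume *: "finite F \<and> F \<subseteq> \<Q> \<and> finite R' \<and> R' \<subseteq> R0"
    obtain w' where w': "well_sorted M ss w'" "\<forall>k\<in>K0. w' k = w k" "\<forall>Q\<in>F. Q w'"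
      using fin[of F] * by blast
    have "w' k = y" if "(k, y) \<in> R'" for k y
    proof -
      have "(k, y) \<in> R0" using * that by blast
      then show ?thesis using w'(2) unfolding R0_def by blast
    qed
    then show "\<exists>w'. well_sorted M ss w' \<and> (\<forall>(k, y)\<in>R'. w' k = y) \<and> (\<forall>Q\<in>F. Q w')"
      using w' by blast
  qed
  define \<A> where "\<A> = {R. R0 \<subseteq> R \<and> consistent R}"
  have "\<exists>R\<in>\<A>. \<forall>X\<in>\<A>. R \<subseteq> X \<longrightarrow> X = R"
  proof (rule subset_Zorn_nonempty)
    show "\<A> \<noteq> {}" using \<open>consistent R0\<close> by (auto simp: \<A>_def)
    fix \<C> assume C: "\<C> \<noteq> {}" "subset.chain \<A> \<C>"
    have "\<C> \<subseteq> \<A>" using C(2) by (simp add: subset_chain_def)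
    then have \<C>: "R0 \<subseteq> X" "consistent X" if "X \<in> \<C>" for X
      using that by (auto simp only: \<A>_def)
    have "consistent (\<Union>\<C>)"
      unfolding consistent_def
    proof (intro allI impI)
      fix F R' assume *: "finite F \<and> F \<subseteq> \<Q> \<and> finite R' \<and> R' \<subseteq> \<Union>\<C>"
      then obtain R where R: "R \<in> \<C>" "R' \<subseteq> R"
        using finite_subset_Union_chain[of R' \<C> \<A>] C by metis
      show "\<exists>w'. well_sorted M ss w' \<and> (\<forall>(k, y)\<in>R'. w' k = y) \<and> (\<forall>Q\<in>F. Q w')"
        using \<C>(2)[OF R(1), unfolded consistent_def, THEN spec, THEN spec, THEN mp, of F R'] * R(2) by simp
    qed
    moreover have "R0 \<subseteq> \<Union>\<C>" using \<C>(1) C(1) by (metis Sup_upper2 ex_in_conv)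
    ultimately show "\<Union>\<C> \<in> \<A>" by (simp only: \<A>_def mem_Collect_eq)
  qed
  then obtain R where "R \<in> \<A>" and R_max: "\<forall>X\<in>\<A>. R \<subseteq> X \<longrightarrow> X = R" by blast
  then have R: "R0 \<subseteq> R" "consistent R" by (simp_all only: \<A>_def mem_Collect_eq)
  have max: "X = R" if "R \<subseteq> X" "consistent X" for X
  proof -
    have "R0 \<subseteq> X" using R(1) that(1) by (rule order_trans)
    with that(2) have "X \<in> \<A>" by (simp only: \<A>_def mem_Collect_eq)
    then show ?thesis using R_max that(1) by blast
  qed

  have R_fin: "\<exists>w'. well_sorted M ss w' \<and> (\<forall>(k, y)\<in>R'. w' k = y) \<and> (\<forall>Q\<in>F. Q w')"
    if "finite F" "F \<subseteq> \<Q>" "finite R'" "R' \<subseteq> R" for F R'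
    using R(2)[unfolded consistent_def, THEN spec, THEN spec, THEN mp, of F R'] that by simp
  have single: "y = y'" if "(k, y) \<in> R" "(k, y') \<in> R" for k y y'
  proof -
    have "\<exists>w'. well_sorted M ss w' \<and> w' k = y \<and> w' k = y'"
      using R_fin[of "{}" "{(k, y), (k, y')}"] that by simp
    then show ?thesis by metis
  qed
  have R_sort: "sort_of M y = ss k" if "(k, y) \<in> R" for k y
  proof -
    have "\<exists>w'. well_sorted M ss w' \<and> w' k = y"
      using R_fin[of "{}" "{(k, y)}"] that by simp
    then show ?thesis by (metis well_sorted_def)
  qed
  \<comment> \<open>Outside the domain of \<open>R\<close> the assignment falls back on
    \<open>w\<close>, which keeps it well sorted. The predicates look only at \<open>K\<close>, and
    \<open>K\<close> is shown below to lie in the domain.\<close>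
  define u where "u k = (if k \<in> Domain R then THE y. (k, y) \<in> R else w k)" for k
  have u_R: "u k = y" if "(k, y) \<in> R" for k y
  proof -
    have "(THE y. (k, y) \<in> R) = y" using that single by (intro the_equality)
    moreover have "k \<in> Domain R" using that by blast
    ultimately show ?thesis by (simp add: u_def)
  qed
  have u: "well_sorted M ss u"
    unfolding well_sorted_def
  proof
    fix k show "sort_of M (u k) = ss k"
    proof (cases "k \<in> Domain R")
      case True
      then obtain y where "(k, y) \<in> R" by blast
      then show ?thesis using u_R R_sort by blast
    next
      case False
      then show ?thesis using w by (simp add: u_def well_sorted_def)
    qed
  qed
  have u_in: "(k, u k) \<in> R" if "k \<in> Domain R" for k
    using that u_R by (metis DomainE)
  have u_fin: "\<exists>w'. well_sorted M ss w' \<and> (\<forall>j\<in>J. w' j = u j) \<and> (\<forall>Q\<in>F. Q w')"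
    if "finite F" "F \<subseteq> \<Q>" "finite J" "J \<subseteq> Domain R" for F J
  proof -
    have "(\<lambda>j. (j, u j)) ` J \<subseteq> R" using that(4) u_in by auto
    then show ?thesis using R_fin[of F "(\<lambda>j. (j, u j)) ` J"] that by simp
  qed
  have "\<forall>Q\<in>\<Q>. \<exists>S. finite S \<and> S \<subseteq> K \<and> definable M ss S Q"
    using def definable_finite_support by metis
  then obtain S where S: "\<And>Q. Q \<in> \<Q> \<Longrightarrow> finite (S Q)" "\<And>Q. Q \<in> \<Q> \<Longrightarrow> S Q \<subseteq> K"
    "\<And>Q. Q \<in> \<Q> \<Longrightarrow> definable M ss (S Q) Q"
    by metis
  \<comment> \<open>Maximality forces \<open>R\<close> to be defined on all of \<open>K\<close>: at
    a missing \<open>k\<close>, saturation finds a value \<open>y\<close> such that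
    \<open>(k, y)\<close> can be added without losing consistency.\<close>
  have dom: "k \<in> Domain R" if "k \<in> K" for k
  proof (rule ccontr)
    assume k: "k \<notin> Domain R"
    \<comment> \<open>\<open>L F\<close> collects the finitely many coordinates other than
      \<open>k\<close> that occur in the supports of \<open>F\<close> and have no value yet.
      Quantifying them existentially leaves a condition \<open>T F\<close> on the value at
      \<open>k\<close>, given the values already assigned.\<close>
    define L where "L F = (\<Union>Q\<in>F. S Q) - Domain R - {k}" for F
    define T where "T F = (\<lambda>v. \<exists>w'. well_sorted M ss w' \<and> (\<forall>j. j \<notin> L F \<longrightarrow> w' j = v j) \<and> (\<forall>Q\<in>F. Q w'))"
      for F
    define \<F> where "\<F> = {F. finite F \<and> F \<subseteq> \<Q>}"
    have "\<exists>y. sort_of M y = ss k \<and> (\<forall>Q\<in>T ` \<F>. Q (u(k := y)))"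
    proof (rule saturation[OF u K])
      fix Q assume "Q \<in> T ` \<F>"
      then obtain F where F: "finite F" "F \<subseteq> \<Q>" "Q = T F" by (auto simp: \<F>_def)
      have "definable M ss K (\<lambda>w. \<forall>Q\<in>F. Q w)"
        using F def by (intro definable_conj_finite) auto
      then have "definable M ss (K - L F) (T F)"
        unfolding T_def using F S(1) well_sorted_sorts[OF w]
        by (intro definable_ex_finite) (auto simp: L_def)
      then show "definable M ss (insert k K) Q"
        unfolding F(3) by (rule definable_mono) auto
    next
      fix G assume "finite G" "G \<subseteq> T ` \<F>"
      then obtain \<F>' where \<F>': "\<F>' \<subseteq> \<F>" "finite \<F>'" "G = T ` \<F>'"
        using finite_subset_image[of G] by blast
      \<comment> \<open>A single solution \<open>w'\<close> for the union of finitely many finite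
        parts satisfies all the conditions \<open>T F'\<close> at once, with the value
        \<open>w' k\<close> at \<open>k\<close>.\<close>
      define F where "F = \<Union>\<F>'"
      have F: "finite F" "F \<subseteq> \<Q>" using \<F>' by (auto simp: F_def \<F>_def)
      have "finite ((\<Union>Q\<in>F. S Q) \<inter> Domain R)" using F S(1) by blast
      then obtain w' where w': "well_sorted M ss w'" "\<forall>j\<in>(\<Union>Q\<in>F. S Q) \<inter> Domain R. w' j = u j"
          "\<forall>Q\<in>F. Q w'"
        using u_fin[OF F, of "(\<Union>Q\<in>F. S Q) \<inter> Domain R"] by auto
      have "T F' (u(k := w' k))" if "F' \<in> \<F>'" for F'
      proof -
        define w'' where "w'' j = (if j \<in> L F' then w' j else (u(k := w' k)) j)" for j
        have ws: "well_sorted M ss w''" using w' u by (auto simp: w''_def well_sorted_def)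
        have "Q w''" if Q: "Q \<in> F'" for Q
        proof -
          have "Q \<in> F" using Q \<open>F' \<in> \<F>'\<close> by (auto simp: F_def)
          then have "Q \<in> \<Q>" using F by auto
          have "w'' j = w' j" if j: "j \<in> S Q" for j
          proof -
            consider "j \<in> L F'" | "j = k" | "j \<in> Domain R" "j \<noteq> k"
              using j Q unfolding L_def by blast
            then show ?thesis
            proof cases
              case 3
              then have "w' j = u j" using j \<open>Q \<in> F\<close> w'(2) by blast
              then show ?thesis using 3 by (simp add: w''_def)
            qed (auto simp: w''_def)
          qed
          then have "Q w'' = Q w'"
            by (intro definable_cong[OF S(3)[OF \<open>Q \<in> \<Q>\<close>]] ws w')
          then show ?thesis using w' \<open>Q \<in> F\<close> by blast
        qed
        then show ?thesis unfolding T_def using ws by (intro exI[of _ w'']) (auto simp: w''_def)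
      qed
      moreover have "sort_of M (w' k) = ss k" using w' by (simp add: well_sorted_def)
      ultimately show "\<exists>y. sort_of M y = ss k \<and> (\<forall>Q\<in>G. Q (u(k := y)))"
        using \<F>' by auto
    qed
    then obtain y where "\<forall>Q\<in>T ` \<F>. Q (u(k := y))" by blast
    then have y: "T F (u(k := y))" if "finite F" "F \<subseteq> \<Q>" for F
      using that by (simp add: \<F>_def)
    have "consistent (insert (k, y) R)"
      unfolding consistent_def
    proof (intro allI impI)
      fix F R' assume *: "finite F \<and> F \<subseteq> \<Q> \<and> finite R' \<and> R' \<subseteq> insert (k, y) R"
      then have "T F (u(k := y))" using y by simp
      then obtain w' where w': "well_sorted M ss w'" "\<forall>j. j \<notin> L F \<longrightarrow> w' j = (u(k := y)) j" "\<forall>Q\<in>F. Q w'"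
        unfolding T_def by (elim exE conjE)
      have "w' j = z" if "(j, z) \<in> R'" for j z
      proof -
        have j: "(j, z) = (k, y) \<or> (j, z) \<in> R" using * that by blast
        then have "j = k \<or> j \<in> Domain R" by blast
        then have "j \<notin> L F" unfolding L_def by blast
        then have "w' j = (u(k := y)) j" using w'(2) by simp
        also have "\<dots> = z"
        proof (cases "j = k")
          case True
          then have "(j, z) \<notin> R" using k by blast
          then show ?thesis using j by simp
        next
          case False
          then show ?thesis using j u_R by simp
        qed
        finally show ?thesis .
      qed
      then have "\<forall>(k, y)\<in>R'. w' k = y" by clarify
      then show "\<exists>w'. well_sorted M ss w' \<and> (\<forall>(k, y)\<in>R'. w' k = y) \<and> (\<forall>Q\<in>F. Q w')"
        using w'(1,3) by (intro exI[of _ w'] conjI)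
    qed
    then have "insert (k, y) R = R" using max[of "insert (k, y) R"] by blast
    then show False using k by blast
  qed
  have "Q u" if "Q \<in> \<Q>" for Q
  proof -
    have "S Q \<subseteq> Domain R" using S(2)[OF that] dom by blast
    then have "\<exists>w'. well_sorted M ss w' \<and> (\<forall>j\<in>S Q. w' j = u j) \<and> Q w'"
      using u_fin[of "{Q}" "S Q"] S(1)[OF that] that by simp
    then obtain w' where w': "well_sorted M ss w'" "\<forall>j\<in>S Q. w' j = u j" "Q w'" by metis
    have "Q u = Q w'"
      by (rule definable_cong[OF S(3)[OF that] u w'(1)]) (use w' in simp)
    then show ?thesis using w' by blast
  qed
  moreover have "u k = w k" if "k \<in> K0" for k
    using u_R R(1) that by (auto simp: R0_def)
  ultimately show ?thesis using u by blast
qed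

end

section \<open>Types, automorphisms and strong homogeneity of the monster\<close>

section \<open>Equality of types and homogeneity\<close>

text \<open>One notion covers three: with parameters listed among the coordinates it is equality of
  types over a set (\<open>tp_eq_iff_same_type\<close>), without them equality over the empty set
  (\<open>tp_empty_eq_iff\<close>), and against the identity it says that a map is elementary
  (\<open>elementary_map_iff_same_type\<close>).\<close>

definition same_type ::
    "('s, 'f, 'r, 'm) mstruct \<Rightarrow> 'k set \<Rightarrow> ('k \<Rightarrow> 'm) \<Rightarrow> ('k \<Rightarrow> 'm) \<Rightarrow> bool" where
  "same_type M K a b \<longleftrightarrow> (\<forall>k\<in>K. sort_of M (a k) = sort_of M (b k)) \<and>
     (\<forall>\<phi> \<tau>. wf_fm M \<phi> \<and> (\<forall>x\<in>fv \<phi>. \<tau> x \<in> K \<and> sort_of M (a (\<tau> x)) = fst x) \<longrightarrow>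
        sat M UNIV (a \<circ> \<tau>) \<phi> = sat M UNIV (b \<circ> \<tau>) \<phi>)"

lemma same_typeI:
  assumes "\<And>k. k \<in> K \<Longrightarrow> sort_of M (a k) = sort_of M (b k)"
    "\<And>\<phi> \<tau>. wf_fm M \<phi> \<Longrightarrow> (\<And>x. x \<in> fv \<phi> \<Longrightarrow> \<tau> x \<in> K) \<Longrightarrow>
       (\<And>x. x \<in> fv \<phi> \<Longrightarrow> sort_of M (a (\<tau> x)) = fst x) \<Longrightarrow>
       sat M UNIV (a \<circ> \<tau>) \<phi> = sat M UNIV (b \<circ> \<tau>) \<phi>"
  shows "same_type M K a b"
  unfolding same_type_def
proof (intro conjI ballI allI impI)
  fix \<phi> \<tau> assume *: "wf_fm M \<phi> \<and> (\<forall>x\<in>fv \<phi>. \<tau> x \<in> K \<and> sort_of M (a (\<tau> x)) = fst x)"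
  show "sat M UNIV (a \<circ> \<tau>) \<phi> = sat M UNIV (b \<circ> \<tau>) \<phi>"
    by (rule assms(2)) (use * in blast)+
qed (rule assms(1))

lemma same_type_sort: "same_type M K a b \<Longrightarrow> k \<in> K \<Longrightarrow> sort_of M (a k) = sort_of M (b k)"
  by (simp add: same_type_def)

lemma same_type_sat:
  "same_type M K a b \<Longrightarrow> wf_fm M \<phi> \<Longrightarrow> (\<And>x. x \<in> fv \<phi> \<Longrightarrow> \<tau> x \<in> K) \<Longrightarrow>
     (\<And>x. x \<in> fv \<phi> \<Longrightarrow> sort_of M (a (\<tau> x)) = fst x) \<Longrightarrow>
     sat M UNIV (a \<circ> \<tau>) \<phi> = sat M UNIV (b \<circ> \<tau>) \<phi>"
  by (simp add: same_type_def)

lemma same_type_mono: "same_type M K a b \<Longrightarrow> K' \<subseteq> K \<Longrightarrow> same_type M K' a b"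
  unfolding same_type_def by (meson subsetD)

lemma same_type_sym: "same_type M K a b \<Longrightarrow> same_type M K b a"
  unfolding same_type_def by (auto simp: all_conj_distrib)

lemma same_type_trans: "same_type M K a b \<Longrightarrow> same_type M K b c \<Longrightarrow> same_type M K a c"
  unfolding same_type_def by simp metis

lemma same_type_cong:
  assumes "\<And>k. k \<in> K \<Longrightarrow> a k = a' k" "\<And>k. k \<in> K \<Longrightarrow> b k = b' k"
  shows "same_type M K a b \<longleftrightarrow> same_type M K a' b'"
proof -
  have *: "same_type M K a' b'" if "same_type M K a b"
    "\<And>k. k \<in> K \<Longrightarrow> a k = a' k" "\<And>k. k \<in> K \<Longrightarrow> b k = b' k" for a b a' b'
  proof (rule same_typeI)
    fix k assume "k \<in> K"
    then show "sort_of M (a' k) = sort_of M (b' k)" using that same_type_sort by metis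
  next
    fix \<phi> \<tau> assume 1: "wf_fm M \<phi>" "\<And>x. x \<in> fv \<phi> \<Longrightarrow> \<tau> x \<in> K"
      "\<And>x. x \<in> fv \<phi> \<Longrightarrow> sort_of M (a' (\<tau> x)) = fst x"
    have "sat M UNIV (a \<circ> \<tau>) \<phi> = sat M UNIV (b \<circ> \<tau>) \<phi>"
      by (rule same_type_sat[OF that(1)]) (simp_all add: 1 that)
    moreover have "sat M UNIV (a \<circ> \<tau>) \<phi> = sat M UNIV (a' \<circ> \<tau>) \<phi>"
      by (rule sat_cong) (simp add: 1 that)
    moreover have "sat M UNIV (b \<circ> \<tau>) \<phi> = sat M UNIV (b' \<circ> \<tau>) \<phi>"
      by (rule sat_cong) (simp add: 1 that)
    ultimately show "sat M UNIV (a' \<circ> \<tau>) \<phi> = sat M UNIV (b' \<circ> \<tau>) \<phi>" by simp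
  qed
  show ?thesis using *[of a b a' b'] *[of a' b' a b] assms by metis
qed

lemma same_type_reindex:
  assumes "same_type M K a b" "h ` K' \<subseteq> K"
  shows "same_type M K' (a \<circ> h) (b \<circ> h)"
proof (rule same_typeI)
  fix k assume "k \<in> K'"
  then show "sort_of M ((a \<circ> h) k) = sort_of M ((b \<circ> h) k)"
    using assms same_type_sort[OF assms(1), of "h k"] by auto
next
  fix \<phi> \<tau> assume 1: "wf_fm M \<phi>" "\<And>x. x \<in> fv \<phi> \<Longrightarrow> \<tau> x \<in> K'"
    "\<And>x. x \<in> fv \<phi> \<Longrightarrow> sort_of M ((a \<circ> h) (\<tau> x)) = fst x"
  have "sat M UNIV (a \<circ> (h \<circ> \<tau>)) \<phi> = sat M UNIV (b \<circ> (h \<circ> \<tau>)) \<phi>"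
    by (rule same_type_sat[OF assms(1)]) (use 1 assms(2) in \<open>auto simp: image_subset_iff\<close>)
  then show "sat M UNIV (a \<circ> h \<circ> \<tau>) \<phi> = sat M UNIV (b \<circ> h \<circ> \<tau>) \<phi>"
    by (simp add: comp_assoc)
qed

lemma same_type_finite_character:
  assumes "\<And>F. finite F \<Longrightarrow> F \<subseteq> K \<Longrightarrow> same_type M F a b"
  shows "same_type M K a b"
proof (rule same_typeI)
  fix k assume "k \<in> K"
  then show "sort_of M (a k) = sort_of M (b k)" using assms[of "{k}"] by (simp add: same_type_sort)
next
  fix \<phi> \<tau> assume 1: "wf_fm M \<phi>" "\<And>x. x \<in> fv \<phi> \<Longrightarrow> \<tau> x \<in> K"
    "\<And>x. x \<in> fv \<phi> \<Longrightarrow> sort_of M (a (\<tau> x)) = fst x"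
  have "same_type M (\<tau> ` fv \<phi>) a b" by (rule assms) (use 1 in auto)
  then show "sat M UNIV (a \<circ> \<tau>) \<phi> = sat M UNIV (b \<circ> \<tau>) \<phi>"
    by (rule same_type_sat) (use 1 in auto)
qed

lemma same_type_definable:
  assumes "same_type M K a b" "well_sorted M ss a" "well_sorted M ss b" "definable M ss K P"
  shows "P a = P b"
proof -
  obtain \<phi> \<tau> where 1: "wf_fm M \<phi>" "\<forall>x\<in>fv \<phi>. \<tau> x \<in> K \<and> ss (\<tau> x) = fst x"
    "\<forall>w. well_sorted M ss w \<longrightarrow> P w = sat M UNIV (w \<circ> \<tau>) \<phi>"
    using assms(4) unfolding definable_def by blast
  have "sat M UNIV (a \<circ> \<tau>) \<phi> = sat M UNIV (b \<circ> \<tau>) \<phi>"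
    by (rule same_type_sat[OF assms(1)]) (use 1 assms(2) in \<open>auto simp: well_sorted_def\<close>)
  then show ?thesis using 1 assms by simp
qed

lemma definable_sat:
  assumes "wf_fm M \<phi>" "\<And>x. x \<in> fv \<phi> \<Longrightarrow> \<tau> x \<in> K" "\<And>x. x \<in> fv \<phi> \<Longrightarrow> ss (\<tau> x) = fst x"
  shows "definable M ss K (\<lambda>w. sat M UNIV (w \<circ> \<tau>) \<phi>)"
  by (rule definableI[of _ \<phi> \<tau>]) (use assms in auto)

text \<open>An implication is enough because definable predicates are closed under negation.\<close>

lemma same_typeI_definable:
  assumes "well_sorted M ss a" "well_sorted M ss b" "\<And>P. definable M ss K P \<Longrightarrow> P a \<Longrightarrow> P b"
  shows "same_type M K a b"
proof (rule same_typeI)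
  show "sort_of M (a k) = sort_of M (b k)" for k
    using assms(1,2) by (simp add: well_sorted_def)
next
  fix \<phi> \<tau> assume 1: "wf_fm M \<phi>" "\<And>x. x \<in> fv \<phi> \<Longrightarrow> \<tau> x \<in> K"
    "\<And>x. x \<in> fv \<phi> \<Longrightarrow> sort_of M (a (\<tau> x)) = fst x"
  have d: "definable M ss K (\<lambda>w. sat M UNIV (w \<circ> \<tau>) \<phi>)"
    by (rule definable_sat) (use 1 assms(1) in \<open>auto simp: well_sorted_def\<close>)
  show "sat M UNIV (a \<circ> \<tau>) \<phi> = sat M UNIV (b \<circ> \<tau>) \<phi>"
    using assms(3)[OF d] assms(3)[OF definable_not[OF d]] by metis
qed

lemma elementary_map_iff_same_type: "elementary_map M A g \<longleftrightarrow> same_type M A id g"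
proof -
  have "(\<forall>x\<in>A. sort_of M (g x) = sort_of M x) \<longleftrightarrow> (\<forall>x\<in>A. sort_of M x = sort_of M (g x))"
    by metis
  moreover have "sat M UNIV (g \<circ> v) \<phi> = sat M UNIV v \<phi> \<longleftrightarrow> sat M UNIV v \<phi> = sat M UNIV (g \<circ> v) \<phi>"
    for v \<phi> by metis
  ultimately show ?thesis
    unfolding elementary_map_def same_type_def params_in_def id_comp id_apply by (simp only:)
qed

lemma tp_eq_iff_same_type:
  fixes M :: "('s, 'f, 'r, 'm) mstruct" and a b :: "'i \<Rightarrow> 'm"
  shows
  "tp M C a = tp M C b \<longleftrightarrow> same_type M (range Inl \<union> Inr ` C) (case_sum a id) (case_sum b id)"
proof
  assume tp: "tp M C a = tp M C b"
  have in_tp: "sat M UNIV (case_sum b id \<circ> \<tau>) \<phi> \<and>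
      (\<forall>x\<in>fv \<phi>. sort_of M (case_sum b id (\<tau> x)) = fst x)"
    if "wf_fm M \<phi>" "\<And>x. x \<in> fv \<phi> \<Longrightarrow> \<tau> x \<in> range Inl \<union> Inr ` C"
      "\<And>x. x \<in> fv \<phi> \<Longrightarrow> sort_of M (case_sum a id (\<tau> x)) = fst x"
      "sat M UNIV (case_sum a id \<circ> \<tau>) \<phi>" for \<phi> \<tau>
  proof -
    have "(\<phi>, \<tau>) \<in> tp M C a" unfolding tp_def using that by simp
    then have "(\<phi>, \<tau>) \<in> tp M C b" using tp by simp
    then show ?thesis unfolding tp_def by simp
  qed
  have sort: "sort_of M (case_sum a id k) = sort_of M (case_sum b id k)"
    if "k \<in> range Inl \<union> Inr ` C" for k
  proof -
    \<comment> \<open>The sort of a coordinate can be read off from the type: the formula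
      \<open>x = x\<close> belongs to it only for a variable \<open>x\<close> of the right
      sort.\<close>
    let ?x = "(sort_of M (case_sum a id k), 0)"
    show ?thesis
      using in_tp[of "Eq (Var ?x) (Var ?x)" "\<lambda>_. k"] that by (simp add: sorts_def)
  qed
  show "same_type M (range Inl \<union> Inr ` C) (case_sum a id) (case_sum b id)"
  proof (rule same_typeI)
    fix \<phi> \<tau> assume 1: "wf_fm M \<phi>" "\<And>x. x \<in> fv \<phi> \<Longrightarrow> \<tau> x \<in> range Inl \<union> Inr ` C"
      "\<And>x. x \<in> fv \<phi> \<Longrightarrow> sort_of M (case_sum a id (\<tau> x)) = fst x"
    show "sat M UNIV (case_sum a id \<circ> \<tau>) \<phi> = sat M UNIV (case_sum b id \<circ> \<tau>) \<phi>"
    proof (cases "sat M UNIV (case_sum a id \<circ> \<tau>) \<phi>")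
      case True
      then show ?thesis using in_tp[OF 1] by simp
    next
      case False
      have "sat M UNIV (case_sum b id \<circ> \<tau>) (Neg \<phi>)"
        by (rule in_tp[THEN conjunct1]) (use 1 False in auto)
      then show ?thesis using False by simp
    qed
  qed (rule sort)
next
  assume st: "same_type M (range Inl \<union> Inr ` C) (case_sum a id) (case_sum b id)"
  have *: "tp M C a \<subseteq> tp M C b"
    if st: "same_type M (range Inl \<union> Inr ` C) (case_sum a id) (case_sum b id)" for a b :: "'i \<Rightarrow> 'm"
  proof
    fix z assume "z \<in> tp M C a"
    then obtain \<phi> \<tau> where 1: "z = (\<phi>, \<tau>)" "wf_fm M \<phi>"
      "\<And>x. x \<in> fv \<phi> \<Longrightarrow> \<tau> x \<in> range Inl \<union> Inr ` C"
      "\<And>x. x \<in> fv \<phi> \<Longrightarrow> sort_of M (case_sum a id (\<tau> x)) = fst x"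
      "sat M UNIV (case_sum a id \<circ> \<tau>) \<phi>"
      unfolding tp_def by auto
    have "sat M UNIV (case_sum b id \<circ> \<tau>) \<phi>"
      using same_type_sat[OF st 1(2-4)] 1(5) by simp
    moreover have "sort_of M (case_sum b id (\<tau> x)) = fst x" if "x \<in> fv \<phi>" for x
      using same_type_sort[OF st 1(3)[OF that]] 1(4)[OF that] by simp
    ultimately show "z \<in> tp M C b" unfolding tp_def using 1(1-3) by simp
  qed
  show "tp M C a = tp M C b" using *[OF st] *[OF same_type_sym[OF st]] by blast
qed

lemma tp_empty_eq_iff: "tp M {} a = tp M {} b \<longleftrightarrow> same_type M UNIV a b"
proof
  assume "tp M {} a = tp M {} b"
  then have "same_type M (range Inl) (case_sum a id) (case_sum b id)"
    by (simp add: tp_eq_iff_same_type)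
  then have "same_type M UNIV (case_sum a id \<circ> Inl) (case_sum b id \<circ> Inl)"
    by (rule same_type_reindex) simp
  then show "same_type M UNIV a b" by (simp add: case_sum_o_inj)
next
  assume st: "same_type M UNIV a b"
  have "same_type M (range Inl) (a \<circ> projl) (b \<circ> projl)"
    by (rule same_type_reindex[OF st]) simp
  then have "same_type M (range Inl) (case_sum a id) (case_sum b id)"
    by (rule same_type_cong[THEN iffD1, rotated -1]) auto
  then show "tp M {} a = tp M {} b" by (simp add: tp_eq_iff_same_type)
qed

lemma same_type_eq_iff:
  assumes "same_type M K a b" "j \<in> K" "k \<in> K"
  shows "a j = a k \<longleftrightarrow> b j = b k"
proof (cases "sort_of M (a j) = sort_of M (a k)")
  case True
  let ?s = "sort_of M (a j)"
  let ?\<tau> = "\<lambda>x :: _ \<times> nat. if snd x = 0 then j else k"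
  let ?\<phi> = "Eq (Var (?s, 0)) (Var (?s, 1))"
  have "sat M UNIV (a \<circ> ?\<tau>) ?\<phi> = sat M UNIV (b \<circ> ?\<tau>) ?\<phi>"
    by (rule same_type_sat[OF assms(1)]) (use assms True in \<open>auto simp: sorts_def\<close>)
  then show ?thesis by simp
next
  case False
  then show ?thesis using same_type_sort[OF assms(1)] assms(2,3) by metis
qed

section \<open>Automorphisms\<close>

lemma eval_automorphism:
  assumes "is_structure M" "automorphism M \<sigma>" "wf_tm M t" "\<And>x. x \<in> fv_tm t \<Longrightarrow> sort_of M (v x) = fst x"
  shows "eval M (\<sigma> \<circ> v) t = \<sigma> (eval M v t)"
  using assms(3,4)
proof (induction t)
  case (Fn f ts)
  have IH: "eval M (\<sigma> \<circ> v) t = \<sigma> (eval M v t)" if "t \<in> set ts" for t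
    by (rule Fn.IH[OF that]) (use Fn.prems that in auto)
  then have eq: "map (eval M (\<sigma> \<circ> v)) ts = map \<sigma> (map (eval M v) ts)"
    by (simp add: o_def)
  have "map (sort_of M) (map (eval M v) ts) = map (tm_sort M) ts"
    by (rule map_eval_sort[OF assms(1)]) (use Fn.prems in auto)
  then have "\<sigma> (fun_int M f (map (eval M v) ts)) = fun_int M f (map \<sigma> (map (eval M v) ts))"
    using assms(2) Fn.prems unfolding automorphism_def by (simp del: map_map map_eq_conv)
  then show ?case by (simp only: eval.simps eq)
qed simp

text \<open>Stated for an arbitrary subuniverse \<open>U\<close>, since it is applied both to the
  whole monster and to elementary submodels that are moved by \<open>\<sigma>\<close>.\<close>

lemma sat_image_automorphism:
  assumes "is_structure M" "automorphism M \<sigma>" "wf_fm M \<phi>" "\<And>x. x \<in> fv \<phi> \<Longrightarrow> sort_of M (v x) = fst x"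
  shows "sat M (\<sigma> ` U) (\<sigma> \<circ> v) \<phi> = sat M U v \<phi>"
proof -
  have inj: "\<sigma> x = \<sigma> y \<longleftrightarrow> x = y" for x y
    using assms(2) unfolding automorphism_def bij_def by (meson injD)
  have sort: "sort_of M (\<sigma> x) = sort_of M x" for x
    using assms(2) unfolding automorphism_def by blast
  have "\<forall>x\<in>fv \<phi>. sort_of M (v x) = fst x" using assms(4) by blast
  with assms(3) show ?thesis
  proof (induction \<phi> arbitrary: v)
    case (Eq t u)
    have "eval M (\<sigma> \<circ> v) t = \<sigma> (eval M v t)" "eval M (\<sigma> \<circ> v) u = \<sigma> (eval M v u)"
      using Eq eval_automorphism[OF assms(1,2)] by auto
    then show ?case by (simp only: sat.simps inj)
  next
    case (Rel r ts)
    have "eval M (\<sigma> \<circ> v) t = \<sigma> (eval M v t)" if "t \<in> set ts" for t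
      by (rule eval_automorphism[OF assms(1,2)]) (use Rel that in auto)
    then have eq: "map (eval M (\<sigma> \<circ> v)) ts = map \<sigma> (map (eval M v) ts)"
      by (simp add: o_def)
    have "map (sort_of M) (map (eval M v) ts) = map (tm_sort M) ts"
      by (rule map_eval_sort[OF assms(1)]) (use Rel in auto)
    then have "rel_int M r (map \<sigma> (map (eval M v) ts)) = rel_int M r (map (eval M v) ts)"
      using assms(2) Rel.prems unfolding automorphism_def by (simp del: map_map map_eq_conv)
    then show ?case by (simp only: sat.simps eq)
  next
    case (Neg \<phi>)
    then show ?case using Neg.IH[of v] by simp
  next
    case (Conj \<phi> \<psi>)
    then show ?case using Conj.IH(1)[of v] Conj.IH(2)[of v] by simp
  next
    case (Ex x \<phi>)
    have *: "sat M (\<sigma> ` U) ((\<sigma> \<circ> v)(x := \<sigma> y)) \<phi> = sat M U (v(x := y)) \<phi>" if "sort_of M y = fst x" for y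
    proof -
      have "(\<sigma> \<circ> v)(x := \<sigma> y) = \<sigma> \<circ> v(x := y)" by (simp add: fun_upd_comp)
      moreover have "\<forall>u\<in>fv \<phi>. sort_of M ((v(x := y)) u) = fst u"
        using Ex.prems(2) that by auto
      moreover from this have "sat M (\<sigma> ` U) (\<sigma> \<circ> v(x := y)) \<phi> = sat M U (v(x := y)) \<phi>"
        using Ex.prems(1) by (intro Ex.IH) (simp_all del: fun_upd_apply)
      ultimately show ?thesis by (simp only:)
    qed
    show ?case
    proof
      assume "sat M (\<sigma> ` U) (\<sigma> \<circ> v) (Ex x \<phi>)"
      then obtain z where z: "z \<in> U" "sort_of M (\<sigma> z) = fst x" "sat M (\<sigma> ` U) ((\<sigma> \<circ> v)(x := \<sigma> z)) \<phi>"
        by auto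
      then show "sat M U v (Ex x \<phi>)" using *[of z] sort[of z] by auto
    next
      assume "sat M U v (Ex x \<phi>)"
      then obtain y where y: "y \<in> U" "sort_of M y = fst x" "sat M U (v(x := y)) \<phi>" by auto
      then show "sat M (\<sigma> ` U) (\<sigma> \<circ> v) (Ex x \<phi>)" using *[of y] sort[of y] by auto
    qed
  qed
qed

lemma sat_automorphism:
  assumes "is_structure M" "automorphism M \<sigma>" "wf_fm M \<phi>" "\<And>x. x \<in> fv \<phi> \<Longrightarrow> sort_of M (v x) = fst x"
  shows "sat M UNIV (\<sigma> \<circ> v) \<phi> = sat M UNIV v \<phi>"
proof -
  have "range \<sigma> = UNIV" using assms(2) by (simp add: automorphism_def bij_is_surj)
  then show ?thesis using sat_image_automorphism[OF assms, of UNIV] by simp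
qed

text \<open>Injectivity comes from the formula x = y. Compatibility with the symbols comes from the
  formulas f(x_0, ..., x_{n-1}) = x_n and r(x_0, ..., x_{n-1}), whose variables carry distinct
  indices and hence stay apart even when sorts or entries repeat.\<close>

lemma automorphismI_same_type:
  fixes M :: "('s, 'f, 'r, 'm) mstruct"
  assumes "is_structure M" "same_type M UNIV id \<sigma>" "surj \<sigma>"
  shows "automorphism M \<sigma>"
  unfolding automorphism_def
proof (intro conjI ballI allI impI)
  have "\<sigma> x = \<sigma> y \<longleftrightarrow> x = y" for x y
    using same_type_eq_iff[OF assms(2), of x y] by auto
  then show "bij \<sigma>" using assms(3) by (simp add: bij_def inj_on_def)
next
  show sort: "sort_of M (\<sigma> x) = sort_of M x" for x
    using same_type_sort[OF assms(2), of x] by simp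
next
  fix f xs assume f: "f \<in> funs M" and xs: "map (sort_of M) xs = fun_dom M f"
  define n where "n = length xs"
  define vs :: "('s, 'f) tm list" where "vs = map (\<lambda>i. Var (sort_of M (xs ! i), i)) [0..<n]"
  define \<tau> :: "'s \<times> nat \<Rightarrow> 'm" where "\<tau> x = (if snd x < n then xs ! snd x else fun_int M f xs)" for x
  let ?\<phi> = "Eq (Fn f vs) (Var (fun_cod M f, n))"
  have cod: "sort_of M (fun_int M f xs) = fun_cod M f"
    using assms(1) f xs by (simp add: is_structure_def)
  have "sat M UNIV (id \<circ> \<tau>) ?\<phi> = sat M UNIV (\<sigma> \<circ> \<tau>) ?\<phi>"
  proof (rule same_type_sat[OF assms(2)])
    have "map (tm_sort M) vs = map (sort_of M) xs"
      by (rule nth_equalityI) (auto simp: vs_def n_def)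
    then have "map (tm_sort M) vs = fun_dom M f" using xs by simp
    moreover have "fun_cod M f \<in> sorts M" using cod unfolding sorts_def by (metis rangeI)
    ultimately show "wf_fm M ?\<phi>" using f by (auto simp: vs_def sorts_def)
    show "sort_of M (id (\<tau> x)) = fst x" if "x \<in> fv ?\<phi>" for x
      using that cod by (auto simp: vs_def \<tau>_def)
  qed simp
  moreover have vs: "map (eval M (g \<circ> \<tau>)) vs = map g xs" for g
    by (rule nth_equalityI) (auto simp: vs_def n_def \<tau>_def)
  moreover have "map (eval M \<tau>) vs = xs" using vs[of id] by simp
  ultimately show "\<sigma> (fun_int M f xs) = fun_int M f (map \<sigma> xs)"
    by (simp add: \<tau>_def)
next
  fix r xs assume r: "r \<in> rels M" and xs: "map (sort_of M) xs = rel_dom M r"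
  define n where "n = length xs"
  define vs :: "('s, 'f) tm list" where "vs = map (\<lambda>i. Var (sort_of M (xs ! i), i)) [0..<n]"
  define \<tau> :: "'s \<times> nat \<Rightarrow> 'm" where "\<tau> x = xs ! snd x" for x
  have "sat M UNIV (id \<circ> \<tau>) (Rel r vs) = sat M UNIV (\<sigma> \<circ> \<tau>) (Rel r vs)"
  proof (rule same_type_sat[OF assms(2)])
    have "map (tm_sort M) vs = map (sort_of M) xs"
      by (rule nth_equalityI) (auto simp: vs_def n_def)
    then show "wf_fm M (Rel r vs)" using r xs by (auto simp: vs_def sorts_def)
    show "sort_of M (id (\<tau> x)) = fst x" if "x \<in> fv (Rel r vs)" for x
      using that by (auto simp: vs_def \<tau>_def)
  qed simp
  moreover have vs: "map (eval M (g \<circ> \<tau>)) vs = map g xs" for g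
    by (rule nth_equalityI) (auto simp: vs_def n_def \<tau>_def)
  moreover have "map (eval M \<tau>) vs = xs" using vs[of id] by simp
  ultimately show "rel_int M r (map \<sigma> xs) = rel_int M r xs" by simp
qed

lemma (in monster_model) same_type_automorphism:
  assumes "automorphism M \<sigma>"
  shows "same_type M K a (\<sigma> \<circ> a)"
proof (rule same_typeI)
  show "sort_of M (a k) = sort_of M ((\<sigma> \<circ> a) k)" for k
    using assms by (simp add: automorphism_def)
next
  fix \<phi> \<tau> assume 1: "wf_fm M \<phi>" "\<And>x. x \<in> fv \<phi> \<Longrightarrow> sort_of M (a (\<tau> x)) = fst x"
  have "sat M UNIV (\<sigma> \<circ> (a \<circ> \<tau>)) \<phi> = sat M UNIV (a \<circ> \<tau>) \<phi>"
    by (rule sat_automorphism[OF structure_axiom assms]) (use 1 in auto)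
  then show "sat M UNIV (a \<circ> \<tau>) \<phi> = sat M UNIV (\<sigma> \<circ> a \<circ> \<tau>) \<phi>" by (simp add: comp_assoc)
qed

section \<open>Back and forth\<close>

context monster_model
begin

text \<open>The elementary step of back and forth. A finite part of the type of \<open>a k\<close>
  over the earlier coordinates is expressed by an existential formula true of \<open>a\<close>,
  hence true of \<open>b\<close>; saturation then realizes all finite parts by one
  \<open>y\<close>.\<close>

lemma same_type_extend:
  assumes st: "same_type M K a b" and K: "small M K" and k: "k \<notin> K"
  shows "\<exists>y. same_type M (insert k K) a (b(k := y))"
proof -
  define ss where "ss = (\<lambda>j. sort_of M (a j))"
  \<comment> \<open>Nothing is known about the sorts of \<open>b\<close> outside \<open>K\<close>;
    values of \<open>a\<close> are put there to obtain a well-sorted tuple, and they are never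
    looked at.\<close>
  define b' where "b' j = (if j \<in> K then b j else a j)" for j
  have ws: "well_sorted M ss a" "well_sorted M ss b'"
    using same_type_sort[OF st] by (auto simp: well_sorted_def ss_def b'_def)
  have st': "same_type M K a b'"
    using st by (rule same_type_cong[THEN iffD1, rotated -1]) (auto simp: b'_def)
  define \<Q> where "\<Q> = {P. definable M ss (insert k K) P \<and> P a}"
  have "\<exists>y. sort_of M y = ss k \<and> (\<forall>Q\<in>\<Q>. Q (b'(k := y)))"
  proof (rule saturation[OF ws(2) K])
    fix F assume F: "finite F" "F \<subseteq> \<Q>"
    define E where "E = (\<lambda>w. \<exists>y. sort_of M y = ss k \<and> (\<forall>P\<in>F. P (w(k := y))))"
    have "definable M ss (insert k K) (\<lambda>w. \<forall>P\<in>F. P w)"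
      by (rule definable_conj_finite) (use F in \<open>auto simp: \<Q>_def\<close>)
    then have "definable M ss (insert k K - {k}) E"
      unfolding E_def by (rule definable_ex) (rule well_sorted_sorts[OF ws(1)])
    then have E: "definable M ss K E" by (rule definable_mono) auto
    have "E a"
      unfolding E_def by (rule exI[of _ "a k"]) (use F in \<open>auto simp: ss_def \<Q>_def\<close>)
    then have "E b'" using same_type_definable[OF st' ws E] by simp
    then show "\<exists>y. sort_of M y = ss k \<and> (\<forall>Q\<in>F. Q (b'(k := y)))"
      unfolding E_def .
  qed (simp add: \<Q>_def)
  then obtain y where y: "sort_of M y = ss k" "\<forall>Q\<in>\<Q>. Q (b'(k := y))" by blast
  have "same_type M (insert k K) a (b'(k := y))"
  proof (rule same_typeI_definable[OF ws(1)])
    show "well_sorted M ss (b'(k := y))" using ws(2) y(1) by blast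
    show "P (b'(k := y))" if "definable M ss (insert k K) P" "P a" for P
      using y(2) that unfolding \<Q>_def by blast
  qed
  then have "same_type M (insert k K) a (b(k := y))"
    by (rule same_type_cong[THEN iffD1, rotated -1]) (auto simp: b'_def)
  then show ?thesis ..
qed

text \<open>A partial map is kept as its graph, indexed by itself through the two projections.
  Taking the converse then exchanges the forth and the back step.\<close>

abbreviation partial_elementary :: "('m \<times> 'm) set \<Rightarrow> bool" where
  "partial_elementary R \<equiv> same_type M R fst snd"

lemma partial_elementary_converse:
  assumes "partial_elementary R"
  shows "partial_elementary (R\<inverse>)"
proof -
  have "same_type M (R\<inverse>) (snd \<circ> prod.swap) (fst \<circ> prod.swap)"
    by (rule same_type_reindex[OF same_type_sym[OF assms]]) auto
  then show ?thesis by (simp add: comp_def)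
qed

lemma partial_elementary_forth:
  assumes R: "partial_elementary R" "small M R"
  shows "\<exists>y. partial_elementary (insert (d, y) R)"
proof (cases "d \<in> Domain R")
  case True
  then obtain y where "(d, y) \<in> R" by blast
  then show ?thesis using R by (metis insert_absorb)
next
  case False
  \<comment> \<open>The pair \<open>(d, d)\<close> is merely an index outside \<open>R\<close> for
    the new coordinate; afterwards \<open>h\<close> identifies it with the intended pair
    \<open>(d, y)\<close>.\<close>
  then have "(d, d) \<notin> R" by blast
  then obtain y where y: "same_type M (insert (d, d) R) fst (snd((d, d) := y))"
    using same_type_extend[OF R] by blast
  define h where "h p = (if p = (d, y) then (d, d) else p)" for p
  have "same_type M (insert (d, y) R) (fst \<circ> h) (snd((d, d) := y) \<circ> h)"
    by (rule same_type_reindex[OF y]) (auto simp: h_def)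
  then have "partial_elementary (insert (d, y) R)"
    by (rule same_type_cong[THEN iffD1, rotated -1]) (use False in \<open>auto simp: h_def\<close>)
  then show ?thesis ..
qed

lemma partial_elementary_back:
  assumes R: "partial_elementary R" "small M R"
  shows "\<exists>y. partial_elementary (insert (y, d) R)"
proof -
  have "R\<inverse> = prod.swap ` R" by force
  then have "small M (R\<inverse>)" using R(2) small_image by metis
  then obtain y where "partial_elementary (insert (d, y) (R\<inverse>))"
    using partial_elementary_forth[OF partial_elementary_converse[OF R(1)]] by blast
  show ?thesis
  proof -
    have "(insert (d, y) (R\<inverse>))\<inverse> = insert (y, d) R" by auto
    then show ?thesis
      using partial_elementary_converse[OF \<open>partial_elementary (insert (d, y) (R\<inverse>))\<close>] by auto
  qed
qed

text \<open>The universe is enumerated along the least well-order of its cardinality, so that fewer than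
  \<open>|M|\<close> pairs have been chosen at every stage of the construction.\<close>

theorem homogeneity:
  assumes st: "same_type M K a b" and K: "small M K"
  obtains \<sigma> where "automorphism M \<sigma>" "\<And>k. k \<in> K \<Longrightarrow> \<sigma> (a k) = b k"
proof -
  define r where "r = card_of (UNIV :: 'm set)"
  have card: "Card_order r" by (simp add: r_def)
  have wo: "Well_order r" "Field r = UNIV" by (simp_all add: r_def)
  have wf: "wf (r - Id)" using wo by (simp add: order_on_defs)
  have lin: "(x, y) \<in> r - Id \<or> x = y \<or> (y, x) \<in> r - Id" for x y
    using wo unfolding order_on_defs total_on_def by auto
  have trans: "(x, z) \<in> r - Id" if "(x, y) \<in> r - Id" "(y, z) \<in> r - Id" for x y z
  proof -
    have "trans r" "antisym r" using wo by (simp_all add: order_on_defs)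
    then show ?thesis using that unfolding trans_def antisym_def by blast
  qed
  have small_below: "small M {y. (y, x) \<in> r - Id}" for x
  proof -
    have "{y. (y, x) \<in> r - Id} = underS r x" by (auto simp: underS_def)
    moreover have "(card_of (underS r x), r) \<in> ordLess"
      by (rule card_of_underS[OF card]) (simp add: wo)
    ultimately show ?thesis by (simp add: small_def lesspoll_iff_ordLess r_def)
  qed
  define R0 where "R0 = (\<lambda>k. (a k, b k)) ` K"
  have "same_type M R0 (a \<circ> inv_into K (\<lambda>k. (a k, b k))) (b \<circ> inv_into K (\<lambda>k. (a k, b k)))"
    by (rule same_type_reindex[OF st]) (auto simp: R0_def inv_into_into)
  then have R0: "partial_elementary R0"
  proof (rule same_type_cong[THEN iffD1, rotated -1])
    fix p assume "p \<in> R0"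
    then have "(a (inv_into K (\<lambda>k. (a k, b k)) p), b (inv_into K (\<lambda>k. (a k, b k)) p)) = p"
      unfolding R0_def by (rule f_inv_into_f)
    then show "(a \<circ> inv_into K (\<lambda>k. (a k, b k))) p = fst p" "(b \<circ> inv_into K (\<lambda>k. (a k, b k))) p = snd p"
      by (simp_all add: prod_eq_iff)
  qed
  \<comment> \<open>The first component of \<open>f x\<close> is the image chosen for
    \<open>x\<close> and the second a preimage, so that one pass through the universe yields both
    totality and surjectivity.\<close>
  define stage where "stage f x = {(x, fst (f x)), (snd (f x), x)}" for f :: "'m \<Rightarrow> 'm \<times> 'm" and x
  define below where "below f x = R0 \<union> (\<Union>y\<in>{y. (y, x) \<in> r - Id}. stage f y)" for f x
  \<comment> \<open>The implication guarantees that a choice exists at every stage, as the recursion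
    principle demands; that its premise holds at all stages is shown afterwards by well-founded
    induction.\<close>
  define P where "P f x p \<longleftrightarrow> partial_elementary (below f x) \<longrightarrow>
    partial_elementary (below f x \<union> {(x, fst p), (snd p, x)})" for f x p
  have small_R: "small M (below f x)" for f x
  proof -
    have "(\<Union>y\<in>{y. (y, x) \<in> r - Id}. stage f y) =
      (\<lambda>y. (y, fst (f y))) ` {y. (y, x) \<in> r - Id} \<union> (\<lambda>y. (snd (f y), y)) ` {y. (y, x) \<in> r - Id}"
      by (auto simp: stage_def)
    moreover have "small M R0" unfolding R0_def using K by (rule small_image)
    ultimately show ?thesis
      unfolding below_def by (simp only: small_Un small_image small_below)
  qed
  have "\<exists>f. \<forall>x. P f x (f x)"
  proof (rule dependent_wf_choice[OF wf])
    fix f g :: "'m \<Rightarrow> 'm \<times> 'm" and x p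
    assume "\<And>z. (z, x) \<in> r - Id \<Longrightarrow> f z = g z"
    then have "below f x = below g x" by (auto simp: below_def stage_def)
    then show "P f x p = P g x p" by (simp add: P_def)
  next
    fix f x
    show "\<exists>p. P f x p"
    proof (cases "partial_elementary (below f x)")
      case True
      obtain y where y: "partial_elementary (insert (x, y) (below f x))"
        using partial_elementary_forth[OF True small_R] by blast
      obtain z where "partial_elementary (insert (z, x) (insert (x, y) (below f x)))"
        using partial_elementary_back[OF y small_insert[OF small_R]] by blast
      moreover have "insert (z, x) (insert (x, y) (below f x)) = below f x \<union> {(x, y), (z, x)}" by auto
      ultimately have "P f x (y, z)" by (simp add: P_def)
      then show ?thesis ..
    qed (simp add: P_def)
  qed
  then obtain f where f: "\<And>x. P f x (f x)" by blast
  define upto where "upto x = below f x \<union> stage f x" for x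
  have upto_mono: "upto x \<subseteq> upto y" if "(x, y) \<in> r - Id" for x y
  proof
    fix p assume "p \<in> upto x"
    then consider "p \<in> R0" | z where "(z, x) \<in> r - Id" "p \<in> stage f z" | "p \<in> stage f x"
      unfolding upto_def below_def by blast
    then show "p \<in> upto y"
      using trans[OF _ that] that unfolding upto_def below_def by cases blast+
  qed
  \<comment> \<open>The sets \<open>upto y\<close> form a chain, so a finite set of pairs that is
    not contained in \<open>R0\<close> already lies in one of them. The finite character of types
    then carries partial elementarity to unions, which handles limit stages and the final map
    alike.\<close>
  have bounded: "F \<subseteq> R0 \<or> (\<exists>y\<in>Y. F \<subseteq> upto y)" if "finite F" "F \<subseteq> R0 \<union> (\<Union>y\<in>Y. stage f y)" for F Y
    using that
  proof (induction F rule: finite_induct)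
    case (insert p F)
    have R0_upto: "R0 \<subseteq> upto y" for y by (auto simp: upto_def below_def)
    have stage_upto: "stage f y \<subseteq> upto y" for y by (auto simp: upto_def)
    have "F \<subseteq> R0 \<or> (\<exists>y\<in>Y. F \<subseteq> upto y)" using insert.IH insert.prems by simp
    moreover have "p \<in> R0 \<or> (\<exists>z\<in>Y. p \<in> stage f z)" using insert.prems by simp
    ultimately consider "F \<subseteq> R0" "p \<in> R0" | y where "y \<in> Y" "F \<subseteq> R0" "p \<in> stage f y"
      | y where "y \<in> Y" "F \<subseteq> upto y" "p \<in> R0"
      | y z where "y \<in> Y" "F \<subseteq> upto y" "z \<in> Y" "p \<in> stage f z" by metis
    then show ?case
    proof cases
      case 4
      then have F: "F \<subseteq> upto y" and p: "p \<in> upto z" using stage_upto by blast+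
      consider "upto y \<subseteq> upto z" | "upto z \<subseteq> upto y"
        using lin[of y z] upto_mono by blast
      then show ?thesis
      proof cases
        case 1
        with F p have "insert p F \<subseteq> upto z" by simp
        then show ?thesis using \<open>z \<in> Y\<close> by blast
      next
        case 2
        with F p have "insert p F \<subseteq> upto y" by auto
        then show ?thesis using \<open>y \<in> Y\<close> by blast
      qed
    next
      case 2
      then have "insert p F \<subseteq> upto y" using R0_upto[of y] stage_upto[of y] by auto
      then show ?thesis using \<open>y \<in> Y\<close> by blast
    next
      case 3
      then have "insert p F \<subseteq> upto y" using R0_upto[of y] by auto
      then show ?thesis using \<open>y \<in> Y\<close> by blast
    next
      case 1
      then show ?thesis by simp
    qed
  qed simp
  have union: "partial_elementary (R0 \<union> (\<Union>y\<in>Y. stage f y))"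
    if "\<And>y. y \<in> Y \<Longrightarrow> partial_elementary (upto y)" for Y
  proof (rule same_type_finite_character)
    fix F assume "finite F" "F \<subseteq> R0 \<union> (\<Union>y\<in>Y. stage f y)"
    then consider "F \<subseteq> R0" | y where "y \<in> Y" "F \<subseteq> upto y" using bounded by blast
    then show "partial_elementary F" using R0 that same_type_mono by cases blast+
  qed
  have upto: "partial_elementary (upto x)" for x
  proof (induction x rule: wf_induct_rule[OF wf])
    case (1 x)
    have "partial_elementary (below f x)" unfolding below_def by (rule union) (use 1 in simp)
    then show ?case using f[of x] by (simp add: P_def upto_def stage_def)
  qed
  define R where "R = R0 \<union> (\<Union>y\<in>UNIV. stage f y)"
  have R: "partial_elementary R" unfolding R_def by (rule union) (rule upto)
  have dom: "(x, fst (f x)) \<in> R" for x by (auto simp: R_def stage_def)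
  have ran: "(snd (f x), x) \<in> R" for x by (auto simp: R_def stage_def)
  define \<sigma> where "\<sigma> x = fst (f x)" for x
  have \<sigma>: "\<sigma> x = y" if "(x, y) \<in> R" for x y
    using same_type_eq_iff[OF R dom[of x] that] by (simp add: \<sigma>_def)
  have "same_type M UNIV (fst \<circ> (\<lambda>x. (x, \<sigma> x))) (snd \<circ> (\<lambda>x. (x, \<sigma> x)))"
    by (rule same_type_reindex[OF R]) (use dom in \<open>auto simp: \<sigma>_def\<close>)
  then have "same_type M UNIV id \<sigma>" by (simp add: comp_def id_def)
  moreover have "surj \<sigma>" using \<sigma>[OF ran] by (rule surjI)
  ultimately have "automorphism M \<sigma>" by (rule automorphismI_same_type[OF structure_axiom])
  moreover have "\<sigma> (a k) = b k" if "k \<in> K" for k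
    by (rule \<sigma>) (use that in \<open>auto simp: R_def R0_def\<close>)
  ultimately show thesis by (rule that)
qed

abbreviation G :: "('m \<Rightarrow> 'm) set" where
  "G \<equiv> carrier (Aut M)"

abbreviation inv_map :: "('m \<Rightarrow> 'm) \<Rightarrow> 'm \<Rightarrow> 'm" where
  "inv_map \<equiv> inv_into UNIV"

lemma carrier_Aut: "\<sigma> \<in> G \<longleftrightarrow> automorphism M \<sigma>"
  by (simp add: Aut_def)

lemma G_bij: "\<sigma> \<in> G \<Longrightarrow> bij \<sigma>"
  by (simp add: carrier_Aut automorphism_def)

lemma G_id: "id \<in> G"
  by (simp add: carrier_Aut automorphism_def)

lemma G_comp: "\<sigma> \<in> G \<Longrightarrow> \<tau> \<in> G \<Longrightarrow> \<sigma> \<circ> \<tau> \<in> G"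
proof -
  assume "\<sigma> \<in> G" "\<tau> \<in> G"
  then have "same_type M UNIV id (\<sigma> \<circ> \<tau>)"
    using same_type_automorphism[of \<sigma> UNIV \<tau>] same_type_automorphism[of \<tau> UNIV id]
    by (auto simp: carrier_Aut intro: same_type_trans)
  moreover have "surj (\<sigma> \<circ> \<tau>)"
    using \<open>\<sigma> \<in> G\<close> \<open>\<tau> \<in> G\<close> by (intro comp_surj bij_is_surj G_bij)
  ultimately show "\<sigma> \<circ> \<tau> \<in> G"
    unfolding carrier_Aut by (rule automorphismI_same_type[OF structure_axiom])
qed

lemma G_inv: "\<sigma> \<in> G \<Longrightarrow> inv_map \<sigma> \<in> G"
proof -
  assume \<sigma>: "\<sigma> \<in> G"
  then have bij: "bij \<sigma>" by (rule G_bij)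
  have "same_type M UNIV (inv_map \<sigma>) (\<sigma> \<circ> inv_map \<sigma>)"
    using \<sigma> by (intro same_type_automorphism) (simp add: carrier_Aut)
  moreover have "\<sigma> \<circ> inv_map \<sigma> = id"
    using bij by (simp add: bij_def surj_iff)
  ultimately have "same_type M UNIV id (inv_map \<sigma>)" using same_type_sym by metis
  then show ?thesis
    unfolding carrier_Aut using bij
    by (intro automorphismI_same_type[OF structure_axiom]) (auto simp: bij_imp_bij_inv bij_is_surj)
qed

lemma group_Aut: "Group.group (Aut M)"
proof (rule groupI)
  fix \<sigma> assume \<sigma>: "\<sigma> \<in> carrier (Aut M)"
  then have "inv_map \<sigma> \<circ> \<sigma> = id" using G_bij bij_is_inj inv_o_cancel by blast
  then show "\<exists>\<tau>\<in>carrier (Aut M). \<tau> \<otimes>\<^bsub>Aut M\<^esub> \<sigma> = \<one>\<^bsub>Aut M\<^esub>"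
    using G_inv[OF \<sigma>] by (auto simp: Aut_def)
next
  show "\<sigma> \<otimes>\<^bsub>Aut M\<^esub> \<tau> \<in> carrier (Aut M)" if "\<sigma> \<in> carrier (Aut M)" "\<tau> \<in> carrier (Aut M)" for \<sigma> \<tau>
    using G_comp[OF that] by (simp add: Aut_def)
  show "\<one>\<^bsub>Aut M\<^esub> \<in> carrier (Aut M)" using G_id by (simp add: Aut_def)
qed (auto simp: Aut_def comp_assoc)

lemma G_inv_apply [simp]: "\<sigma> \<in> G \<Longrightarrow> inv_map \<sigma> (\<sigma> x) = x" "\<sigma> \<in> G \<Longrightarrow> \<sigma> (inv_map \<sigma> x) = x"
  using G_bij by (auto simp: bij_is_inj bij_is_surj surj_f_inv_f)

lemma tp_empty_eq_iff_conjugate: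
  fixes a b :: "'k \<Rightarrow> 'm"
  assumes "small M (UNIV :: 'k set)"
  shows "tp M {} a = tp M {} b \<longleftrightarrow> (\<exists>\<sigma>\<in>G. \<sigma> \<circ> a = b)"
proof
  assume "tp M {} a = tp M {} b"
  then have "same_type M UNIV a b" by (simp add: tp_empty_eq_iff)
  then obtain \<sigma> where \<sigma>: "automorphism M \<sigma>" "\<And>k. k \<in> UNIV \<Longrightarrow> \<sigma> (a k) = b k"
    using homogeneity assms by blast
  then have "\<sigma> \<circ> a = b" by auto
  then show "\<exists>\<sigma>\<in>G. \<sigma> \<circ> a = b" using \<sigma> carrier_Aut by blast
next
  assume "\<exists>\<sigma>\<in>G. \<sigma> \<circ> a = b"
  then show "tp M {} a = tp M {} b"
    using same_type_automorphism[of _ UNIV a] by (auto simp: carrier_Aut tp_empty_eq_iff)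
qed

lemma elementary_map_extends:
  assumes "elementary_map M A g" "small M A"
  obtains \<sigma> where "\<sigma> \<in> G" "\<And>x. x \<in> A \<Longrightarrow> \<sigma> x = g x"
proof -
  have "same_type M A id g" using assms(1) by (simp add: elementary_map_iff_same_type)
  then obtain \<sigma> where "automorphism M \<sigma>" "\<And>x. x \<in> A \<Longrightarrow> \<sigma> (id x) = g x"
    using homogeneity assms(2) by blast
  then show thesis using that[of \<sigma>] by (simp add: carrier_Aut)
qed

lemma elementary_map_automorphism:
  assumes "\<sigma> \<in> G" "\<And>x. x \<in> A \<Longrightarrow> g x = \<sigma> x"
  shows "elementary_map M A g"
proof -
  have "same_type M A id (\<sigma> \<circ> id)"
    using assms(1) by (intro same_type_automorphism) (simp only: carrier_Aut)
  then have "same_type M A id g"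
    by (rule same_type_cong[THEN iffD1, rotated -1]) (use assms(2) in auto)
  then show ?thesis by (simp add: elementary_map_iff_same_type)
qed

end

section \<open>Algebraic closure: orbits, idempotence and size\<close>

section \<open>Algebraic closure\<close>

lemma solutions_automorphism:
  assumes "is_structure M" "automorphism M \<sigma>" "wf_fm M \<phi>"
    "\<And>u. u \<in> fv \<phi> - {x} \<Longrightarrow> sort_of M (v u) = fst u"
  shows "\<sigma> y \<in> solutions M x \<phi> (\<sigma> \<circ> v) \<longleftrightarrow> y \<in> solutions M x \<phi> v"
proof (cases "sort_of M y = fst x")
  case True
  have "sat M UNIV (\<sigma> \<circ> v(x := y)) \<phi> = sat M UNIV (v(x := y)) \<phi>"
    by (rule sat_automorphism[OF assms(1-3)]) (use True assms(4) in auto)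
  moreover have "(\<sigma> \<circ> v)(x := \<sigma> y) = \<sigma> \<circ> v(x := y)" by (simp add: fun_upd_comp)
  ultimately show ?thesis
    using assms(2) by (simp add: solutions_def automorphism_def del: fun_upd_apply)
next
  case False
  then show ?thesis using assms(2) by (simp add: solutions_def automorphism_def)
qed

lemma solutions_cong:
  "(\<And>u. u \<in> fv \<phi> - {x} \<Longrightarrow> v u = w u) \<Longrightarrow> solutions M x \<phi> v = solutions M x \<phi> w"
  unfolding solutions_def by (intro Collect_cong conj_cong refl sat_cong) auto

lemma acl_mono: "A \<subseteq> A' \<Longrightarrow> acl M A \<subseteq> acl M A'"
  unfolding acl_def params_in_def by blast

lemma aclI:
  "wf_fm M \<phi> \<Longrightarrow> params_in M A (fv \<phi> - {x}) v \<Longrightarrow> c \<in> solutions M x \<phi> v \<Longrightarrow>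
     finite (solutions M x \<phi> v) \<Longrightarrow> c \<in> acl M A"
  unfolding acl_def by blast

lemma aclE:
  assumes "c \<in> acl M A"
  obtains \<phi> x v where "wf_fm M \<phi>" "params_in M A (fv \<phi> - {x}) v" "c \<in> solutions M x \<phi> v"
    "finite (solutions M x \<phi> v)"
  using assms unfolding acl_def by blast

lemma subset_acl: "A \<subseteq> acl M A"
proof
  fix a assume "a \<in> A"
  let ?x = "(sort_of M a, 0)" and ?y = "(sort_of M a, 1)"
  let ?\<phi> = "Eq (Var ?x) (Var ?y)"
  have 1: "wf_fm M ?\<phi>" by (auto simp: sorts_def)
  have 2: "params_in M A (fv ?\<phi> - {?x}) (\<lambda>_. a)"
    using \<open>a \<in> A\<close> by (auto simp: params_in_def)
  have "solutions M ?x ?\<phi> (\<lambda>_. a) = {a}" by (auto simp: solutions_def)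
  then show "a \<in> acl M A" by (intro aclI[OF 1 2]) simp_all
qed

lemma definable_eq:
  assumes "j \<in> K" "k \<in> K" "ss j = ss k" "ss k \<in> sorts M"
  shows "definable M ss K (\<lambda>w. w j = w k)"
  by (rule definableI[of _ "Eq (Var (ss j, 0)) (Var (ss j, 1))" "\<lambda>x. if snd x = 0 then j else k"])
    (use assms in auto)

context monster_model
begin

definition orbit :: "'m set \<Rightarrow> 'm \<Rightarrow> 'm set" where
  "orbit A c = {\<sigma> c |\<sigma>. \<sigma> \<in> G \<and> (\<forall>a\<in>A. \<sigma> a = a)}"

lemma orbitI: "\<sigma> \<in> G \<Longrightarrow> (\<And>a. a \<in> A \<Longrightarrow> \<sigma> a = a) \<Longrightarrow> \<sigma> c \<in> orbit A c"
  unfolding orbit_def by blast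

lemma solutions_fixed:
  assumes "\<sigma> \<in> G" "\<And>a. a \<in> A \<Longrightarrow> \<sigma> a = a" "wf_fm M \<phi>" "params_in M A (fv \<phi> - {x}) v"
  shows "\<sigma> y \<in> solutions M x \<phi> v \<longleftrightarrow> y \<in> solutions M x \<phi> v"
proof -
  have "solutions M x \<phi> (\<sigma> \<circ> v) = solutions M x \<phi> v"
    by (rule solutions_cong) (use assms(2,4) in \<open>simp add: params_in_def\<close>)
  then show ?thesis
    using solutions_automorphism[OF structure_axiom _ assms(3), of \<sigma> x v y] assms(1,4)
    by (simp add: carrier_Aut params_in_def)
qed

lemma orbit_subset_solutions:
  assumes "wf_fm M \<phi>" "params_in M A (fv \<phi> - {x}) v" "c \<in> solutions M x \<phi> v"
  shows "orbit A c \<subseteq> solutions M x \<phi> v"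
  using solutions_fixed[OF _ _ assms(1,2)] assms(3) unfolding orbit_def by blast

lemma acl_orbit: "c \<in> acl M A \<Longrightarrow> finite (orbit A c)"
  by (erule aclE) (rule finite_subset[OF orbit_subset_solutions])

text \<open>Every formula in the type of a non-algebraic \<open>c\<close> over \<open>A\<close> has
  infinitely many solutions, hence one outside \<open>E\<close>. Saturation realizes the whole type
  outside \<open>E\<close>, and homogeneity moves \<open>c\<close> to that realization while fixing
  \<open>A\<close>.\<close>

lemma orbit_escapes_finite:
  assumes A: "small M A" and c: "c \<notin> acl M A" and E: "finite E"
  shows "\<not> orbit A c \<subseteq> E"
proof -
  \<comment> \<open>Coordinate \<open>None\<close> is the element to be moved, and
    \<open>Some m\<close> stands for the parameter \<open>m\<close> itself.\<close>
  define w where "w = case_option c id"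
  define ss where "ss k = sort_of M (w k)" for k
  have w: "well_sorted M ss w" by (simp add: well_sorted_def ss_def)
  define \<Q>1 where "\<Q>1 = {P. definable M ss (insert None (Some ` A)) P \<and> P w}"
  define \<Q>2 where "\<Q>2 = (\<lambda>e (u :: 'm option \<Rightarrow> 'm). u None \<noteq> u (Some e)) ` {e \<in> E. sort_of M e = sort_of M c}"
  have "\<exists>y. sort_of M y = ss None \<and> (\<forall>Q\<in>\<Q>1 \<union> \<Q>2. Q (w(None := y)))"
  proof (rule saturation[OF w])
    show "small M (Some ` (A \<union> E))" using A E small_image small_Un small_finite by metis
    fix Q assume "Q \<in> \<Q>1 \<union> \<Q>2"
    then show "definable M ss (insert None (Some ` (A \<union> E))) Q"
    proof
      assume "Q \<in> \<Q>1"
      then have "definable M ss (insert None (Some ` A)) Q" by (simp add: \<Q>1_def)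
      then show ?thesis by (rule definable_mono) auto
    next
      assume "Q \<in> \<Q>2"
      then obtain e where e: "e \<in> E" "sort_of M e = sort_of M c" "Q = (\<lambda>u. u None \<noteq> u (Some e))"
        by (auto simp: \<Q>2_def)
      show ?thesis
        unfolding e(3) using e(1,2)
        by (intro definable_not definable_eq) (auto simp: ss_def w_def sorts_def)
    qed
  next
    fix F assume F: "finite F" "F \<subseteq> \<Q>1 \<union> \<Q>2"
    define P where "P u \<longleftrightarrow> (\<forall>Q\<in>F \<inter> \<Q>1. Q u)" for u
    have "definable M ss (insert None (Some ` A)) P"
      unfolding P_def by (rule definable_conj_finite) (use F in \<open>auto simp: \<Q>1_def\<close>)
    then obtain \<phi> v where \<phi>: "wf_fm M \<phi>" "params_in M (w ` Some ` A) (fv \<phi> - {(ss None, 0)}) v"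
      "\<And>y. sort_of M y = ss None \<Longrightarrow> y \<in> solutions M (ss None, 0) \<phi> v \<longleftrightarrow> P (w(None := y))"
      using definable_solutions[OF w] by metis
    have A_eq: "w ` Some ` A = A" by (auto simp: w_def image_image)
    have "w(None := c) = w" by (auto simp: w_def fun_eq_iff)
    then have "P (w(None := c))" by (simp add: P_def \<Q>1_def)
    moreover have "sort_of M c = ss None" by (simp add: ss_def w_def)
    ultimately have "c \<in> solutions M (ss None, 0) \<phi> v" using \<phi>(3)[of c] by simp
    then have "infinite (solutions M (ss None, 0) \<phi> v)"
      using c aclI[OF \<phi>(1) \<phi>(2)[unfolded A_eq]] by metis
    then have "\<not> solutions M (ss None, 0) \<phi> v \<subseteq> E" using E finite_subset by metis
    then obtain y where y: "y \<in> solutions M (ss None, 0) \<phi> v" "y \<notin> E" by blast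
    then have sort: "sort_of M y = ss None" by (simp add: solutions_def)
    moreover have "Q (w(None := y))" if "Q \<in> F" for Q
    proof (cases "Q \<in> \<Q>1")
      case True
      then show ?thesis using \<phi>(3)[OF sort] y(1) that unfolding P_def by blast
    next
      case False
      then have "Q \<in> \<Q>2" using F that by blast
      then show ?thesis using y(2) by (auto simp: \<Q>2_def w_def)
    qed
    ultimately show "\<exists>y. sort_of M y = ss None \<and> (\<forall>Q\<in>F. Q (w(None := y)))" by blast
  qed
  then obtain y where y: "sort_of M y = ss None" "\<forall>Q\<in>\<Q>1 \<union> \<Q>2. Q (w(None := y))" by blast
  have "same_type M (insert None (Some ` A)) w (w(None := y))"
  proof (rule same_typeI_definable[OF w])
    show "well_sorted M ss (w(None := y))" using w y(1) by blast
    show "P (w(None := y))" if "definable M ss (insert None (Some ` A)) P" "P w" for P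
    proof -
      have "P \<in> \<Q>1 \<union> \<Q>2" using that by (simp add: \<Q>1_def)
      then show ?thesis using y(2) by (rule bspec[rotated])
    qed
  qed
  moreover have "small M (insert None (Some ` A))" using A small_image small_insert by metis
  ultimately obtain \<sigma> where \<sigma>: "automorphism M \<sigma>"
    "\<And>k. k \<in> insert None (Some ` A) \<Longrightarrow> \<sigma> (w k) = (w(None := y)) k"
    using homogeneity by metis
  have "\<sigma> c = y" using \<sigma>(2)[of None] by (simp add: w_def)
  moreover have "\<sigma> a = a" if "a \<in> A" for a using \<sigma>(2)[of "Some a"] that by (simp add: w_def)
  moreover have "\<sigma> \<in> G" using \<sigma>(1) by (simp only: carrier_Aut)
  ultimately have "y \<in> orbit A c" using orbitI[of \<sigma> A c] by simp
  moreover have "y \<notin> E"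
  proof
    assume "y \<in> E"
    then have "(\<lambda>u. u None \<noteq> u (Some y)) \<in> \<Q>2"
      using y(1) by (auto simp: \<Q>2_def ss_def w_def)
    from bspec[OF y(2) UnI2[OF this]]
    have "(w(None := y)) None \<noteq> (w(None := y)) (Some y)" .
    then show False by (simp add: w_def)
  qed
  ultimately show ?thesis by blast
qed

lemma acl_iff_orbit: "small M A \<Longrightarrow> c \<in> acl M A \<longleftrightarrow> finite (orbit A c)"
  using acl_orbit orbit_escapes_finite by blast

text \<open>Orbits are counted. A formula witnessing \<open>c\<close> uses finitely many parameters
  \<open>D\<close> in the closure, and these have only finitely many joint images under
  automorphisms fixing \<open>A\<close>. Automorphisms that agree on \<open>D\<close> move
  \<open>c\<close> within one translate of its finite orbit over \<open>D\<close>, so the orbit of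
  \<open>c\<close> over \<open>A\<close> is finite as well.\<close>

lemma acl_acl:
  assumes "small M A"
  shows "acl M (acl M A) = acl M A"
proof
  show "acl M (acl M A) \<subseteq> acl M A"
  proof
    fix c assume "c \<in> acl M (acl M A)"
    then obtain \<phi> x v where \<phi>: "wf_fm M \<phi>" "params_in M (acl M A) (fv \<phi> - {x}) v"
      "c \<in> solutions M x \<phi> v" "finite (solutions M x \<phi> v)"
      by (rule aclE)
    define D where "D = v ` (fv \<phi> - {x})"
    have D: "finite D" "D \<subseteq> acl M A" using \<phi>(2) by (auto simp: D_def params_in_def)
    have "params_in M D (fv \<phi> - {x}) v" using \<phi>(2) by (simp add: params_in_def D_def)
    then have fin: "finite (orbit D c)"
      by (rule finite_subset[OF orbit_subset_solutions[OF \<phi>(1) _ \<phi>(3)] \<phi>(4)])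
    define \<Sigma> where "\<Sigma> = {\<sigma> \<in> G. \<forall>a\<in>A. \<sigma> a = a}"
    define res where "res \<sigma> = restrict \<sigma> D" for \<sigma> :: "'m \<Rightarrow> 'm"
    have "res ` \<Sigma> \<subseteq> Pi\<^sub>E D (orbit A)"
      by (auto simp: res_def \<Sigma>_def orbit_def)
    moreover have "finite (Pi\<^sub>E D (orbit A))"
      using D acl_orbit by (intro finite_PiE) auto
    ultimately have "finite (res ` \<Sigma>)" by (rule finite_subset)
    then obtain \<Sigma>0 where \<Sigma>0: "\<Sigma>0 \<subseteq> \<Sigma>" "finite \<Sigma>0" "res ` \<Sigma> = res ` \<Sigma>0"
      using finite_subset_image[of "res ` \<Sigma>" res \<Sigma>] by auto
    have "orbit A c \<subseteq> (\<Union>\<tau>\<in>\<Sigma>0. \<tau> ` orbit D c)"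
    proof
      fix d assume "d \<in> orbit A c"
      then obtain \<sigma> where \<sigma>: "\<sigma> \<in> \<Sigma>" "d = \<sigma> c" unfolding orbit_def \<Sigma>_def by blast
      then have "res \<sigma> \<in> res ` \<Sigma>0" using \<Sigma>0(3) by blast
      then obtain \<tau> where \<tau>: "\<tau> \<in> \<Sigma>0" "res \<sigma> = res \<tau>" by blast
      then have G: "\<sigma> \<in> G" "\<tau> \<in> G" using \<Sigma>0 \<sigma> by (auto simp: \<Sigma>_def)
      have eq: "\<sigma> y = \<tau> y" if "y \<in> D" for y
        using \<tau>(2) that unfolding res_def by (metis restrict_apply')
      have "(inv_map \<tau> \<circ> \<sigma>) c \<in> orbit D c"
      proof (rule orbitI)
        show "inv_map \<tau> \<circ> \<sigma> \<in> G" using G by (intro G_comp G_inv)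
        show "(inv_map \<tau> \<circ> \<sigma>) y = y" if "y \<in> D" for y using eq[OF that] G by simp
      qed
      then have "\<tau> ((inv_map \<tau> \<circ> \<sigma>) c) \<in> \<tau> ` orbit D c" by blast
      moreover have "\<tau> ((inv_map \<tau> \<circ> \<sigma>) c) = d" using G \<sigma> by simp
      ultimately show "d \<in> (\<Union>\<tau>\<in>\<Sigma>0. \<tau> ` orbit D c)" using \<tau>(1) by auto
    qed
    moreover have "finite (\<Union>\<tau>\<in>\<Sigma>0. \<tau> ` orbit D c)" using fin \<Sigma>0(2) by simp
    ultimately have "finite (orbit A c)" by (rule finite_subset)
    then show "c \<in> acl M A" using acl_iff_orbit[OF assms] by blast
  qed
qed (rule subset_acl)

lemma acl_image:
  assumes "\<sigma> \<in> G"
  shows "\<sigma> ` acl M A = acl M (\<sigma> ` A)"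
proof
  have sub: "\<sigma> ` acl M A \<subseteq> acl M (\<sigma> ` A)" if "\<sigma> \<in> G" for \<sigma> A
  proof
    fix d assume "d \<in> \<sigma> ` acl M A"
    then obtain c x \<phi> v where c: "d = \<sigma> c" "wf_fm M \<phi>" "params_in M A (fv \<phi> - {x}) v"
      "c \<in> solutions M x \<phi> v" "finite (solutions M x \<phi> v)"
      unfolding acl_def by blast
    have sol: "\<sigma> y \<in> solutions M x \<phi> (\<sigma> \<circ> v) \<longleftrightarrow> y \<in> solutions M x \<phi> v" for y
      by (rule solutions_automorphism[OF structure_axiom _ c(2)])
        (use that c(3) in \<open>auto simp: carrier_Aut params_in_def\<close>)
    have "solutions M x \<phi> (\<sigma> \<circ> v) \<subseteq> \<sigma> ` solutions M x \<phi> v"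
    proof
      fix y assume "y \<in> solutions M x \<phi> (\<sigma> \<circ> v)"
      then have "\<sigma> (inv_map \<sigma> y) \<in> solutions M x \<phi> (\<sigma> \<circ> v)" using that by simp
      then have "inv_map \<sigma> y \<in> solutions M x \<phi> v" by (simp only: sol)
      then have "\<sigma> (inv_map \<sigma> y) \<in> \<sigma> ` solutions M x \<phi> v" by blast
      then show "y \<in> \<sigma> ` solutions M x \<phi> v" using that by simp
    qed
    then have "finite (solutions M x \<phi> (\<sigma> \<circ> v))" using c(5) finite_subset by blast
    moreover have "params_in M (\<sigma> ` A) (fv \<phi> - {x}) (\<sigma> \<circ> v)"
      using c(3) that by (simp add: params_in_def carrier_Aut automorphism_def)
    ultimately show "d \<in> acl M (\<sigma> ` A)"
      unfolding acl_def using c(1,2,4) sol by blast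
  qed
  show "\<sigma> ` acl M A \<subseteq> acl M (\<sigma> ` A)" by (rule sub[OF assms])
  have "inv_map \<sigma> ` acl M (\<sigma> ` A) \<subseteq> acl M (inv_map \<sigma> ` \<sigma> ` A)"
    by (rule sub) (use assms in \<open>simp add: G_inv\<close>)
  also have "inv_map \<sigma> ` \<sigma> ` A = A" using assms by (simp add: image_image)
  finally have "\<sigma> ` inv_map \<sigma> ` acl M (\<sigma> ` A) \<subseteq> \<sigma> ` acl M A" by blast
  then show "acl M (\<sigma> ` A) \<subseteq> \<sigma> ` acl M A" using assms by (simp add: image_image)
qed

lemma dcl_fixed:
  assumes "\<sigma> \<in> G" "\<And>a. a \<in> A \<Longrightarrow> \<sigma> a = a" "d \<in> dcl M A"
  shows "\<sigma> d = d"
proof -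
  obtain x \<phi> v where "wf_fm M \<phi>" "params_in M A (fv \<phi> - {x}) v" "solutions M x \<phi> v = {d}"
    using assms(3) unfolding dcl_def by blast
  then show ?thesis
    using solutions_fixed[OF assms(1,2), where \<phi> = \<phi> and x = x and v = v and y = d] by simp
qed

end

subsection \<open>The size of the algebraic closure\<close>

lemma infinite_Un_lepoll:
  assumes "infinite S" "A \<lesssim> S" "B \<lesssim> S"
  shows "A \<union> B \<lesssim> S"
proof -
  have "(\<Union>b\<in>UNIV. if b then A else B) \<lesssim> S"
    by (rule infinite_UN_lepoll) (use assms in \<open>auto intro: finite_lepoll_infinite\<close>)
  moreover have "(\<Union>b\<in>UNIV. if b then A else B) = A \<union> B" by (auto split: if_splits)
  ultimately show ?thesis by simp
qed

lemma image_lepoll_trans: "A \<lesssim> S \<Longrightarrow> f ` A \<lesssim> S"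
  using image_lepoll lepoll_trans by blast

lemma nat_union_lepoll:
  assumes "infinite S" "\<And>n :: nat. X n \<lesssim> S"
  shows "(\<Union>n. X n) \<lesssim> S"
  using assms infinite_le_lepoll by (intro infinite_UN_lepoll) auto

lemma wf_tm_lepoll:
  fixes M :: "('s, 'f, 'r, 'm) mstruct"
  assumes S: "infinite S" "sorts M \<lesssim> S" "funs M \<lesssim> S"
  shows "{t. wf_tm M t} \<lesssim> S"
proof -
  have vars: "(sorts M \<times> (UNIV :: nat set)) \<lesssim> S"
    using S infinite_le_lepoll by (intro infinite_Times_lepoll) auto
  \<comment> \<open>\<open>T n\<close> consists of the terms of height below \<open>n\<close>.
    Ill-sorted terms are included, which is harmless for an upper bound and makes each stage a plain
    product with a set of lists.\<close>
  define T :: "nat \<Rightarrow> ('s, 'f) tm set" where "T = rec_nat {}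
    (\<lambda>_ X. Var ` (sorts M \<times> UNIV) \<union> (\<lambda>(f, ts). Fn f ts) ` (funs M \<times> lists X))"
  have T: "T 0 = {}" "T (Suc n) = Var ` (sorts M \<times> UNIV) \<union> (\<lambda>(f, ts). Fn f ts) ` (funs M \<times> lists (T n))" for n
    by (simp_all add: T_def)
  have "T n \<lesssim> S" for n
  proof (induction n)
    case (Suc n)
    moreover have "(UNIV :: nat set) \<lesssim> S" using S(1) infinite_le_lepoll by blast
    ultimately show ?case unfolding T using S vars
      by (intro infinite_Un_lepoll image_lepoll_trans infinite_Times_lepoll infinite_lists_lepoll)
  qed (simp add: T)
  then have "(\<Union>n. T n) \<lesssim> S" by (rule nat_union_lepoll[OF S(1)])
  moreover have "{t. wf_tm M t} \<subseteq> (\<Union>n. T n)"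
  proof
    have step: "T n \<subseteq> T (Suc n)" for n
    proof (induction n)
      case (Suc n)
      then have "lists (T n) \<subseteq> lists (T (Suc n))" by (rule lists_mono)
      then show ?case unfolding T(2)[of n] T(2)[of "Suc n"] by blast
    qed (simp add: T)
    have mono: "T m \<subseteq> T n" if "m \<le> n" for m n
      using lift_Suc_mono_le[of T, OF step that] .
    fix t assume "t \<in> {t. wf_tm M t}"
    then have "wf_tm M t" by simp
    then show "t \<in> (\<Union>n. T n)"
    proof (induction t)
      case (Var x)
      then have "Var x \<in> T (Suc 0)" unfolding T by (cases x) auto
      then show ?case by blast
    next
      case (Fn f ts)
      have "\<forall>t\<in>set ts. \<exists>n. t \<in> T n" using Fn by simp
      then obtain n where n: "\<And>t. t \<in> set ts \<Longrightarrow> t \<in> T (n t)" by metis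
      have "t \<in> T (Max (n ` set ts))" if "t \<in> set ts" for t
      proof -
        have "n t \<le> Max (n ` set ts)" using that by (intro Max_ge) auto
        then show ?thesis using n[OF that] mono by blast
      qed
      then have "ts \<in> lists (T (Max (n ` set ts)))" by (auto simp: lists_eq_set)
      moreover have "f \<in> funs M" using Fn.prems by simp
      ultimately have "Fn f ts \<in> T (Suc (Max (n ` set ts)))" unfolding T by auto
      then show ?case by blast
    qed
  qed
  ultimately show ?thesis using subset_imp_lepoll lepoll_trans by blast
qed

lemma wf_fm_lepoll:
  fixes M :: "('s, 'f, 'r, 'm) mstruct"
  assumes S: "infinite S" "sorts M \<lesssim> S" "funs M \<lesssim> S" "rels M \<lesssim> S"
  shows "{\<phi>. wf_fm M \<phi>} \<lesssim> S"
proof -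
  let ?V = "sorts M \<times> (UNIV :: nat set)" and ?W = "{t. wf_tm M t}"
  have vars: "?V \<lesssim> S"
    using S infinite_le_lepoll by (intro infinite_Times_lepoll) auto
  have terms: "?W \<lesssim> S" by (rule wf_tm_lepoll[OF S(1-3)])
  define T :: "nat \<Rightarrow> ('s, 'f, 'r) fm set" where "T = rec_nat {}
    (\<lambda>_ X. (\<lambda>(t, u). Eq t u) ` (?W \<times> ?W) \<union> (\<lambda>(r, ts). Rel r ts) ` (rels M \<times> lists ?W) \<union>
      Neg ` X \<union> (\<lambda>(\<phi>, \<psi>). Conj \<phi> \<psi>) ` (X \<times> X) \<union> (\<lambda>(x, \<phi>). Ex x \<phi>) ` (?V \<times> X))"
  have T: "T 0 = {}" "T (Suc n) = (\<lambda>(t, u). Eq t u) ` (?W \<times> ?W) \<union> (\<lambda>(r, ts). Rel r ts) ` (rels M \<times> lists ?W) \<union>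
      Neg ` T n \<union> (\<lambda>(\<phi>, \<psi>). Conj \<phi> \<psi>) ` (T n \<times> T n) \<union> (\<lambda>(x, \<phi>). Ex x \<phi>) ` (?V \<times> T n)" for n
    by (simp_all add: T_def)
  have "T n \<lesssim> S" for n
  proof (induction n)
    case (Suc n)
    moreover have "(UNIV :: nat set) \<lesssim> S" using S(1) infinite_le_lepoll by blast
    ultimately show ?case unfolding T using S vars terms
      by (intro infinite_Un_lepoll image_lepoll_trans infinite_Times_lepoll infinite_lists_lepoll)
  qed (simp add: T)
  then have "(\<Union>n. T n) \<lesssim> S" by (rule nat_union_lepoll[OF S(1)])
  moreover have "{\<phi>. wf_fm M \<phi>} \<subseteq> (\<Union>n. T n)"
  proof
    have step: "T n \<subseteq> T (Suc n)" for n
    proof (induction n)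
      case (Suc n)
      then show ?case unfolding T(2)[of n] T(2)[of "Suc n"] by (intro Un_mono image_mono Sigma_mono) auto
    qed (simp add: T)
    have mono: "T m \<subseteq> T n" if "m \<le> n" for m n
      using lift_Suc_mono_le[of T, OF step that] .
    fix \<phi> assume "\<phi> \<in> {\<phi>. wf_fm M \<phi>}"
    then have "wf_fm M \<phi>" by simp
    then have "\<exists>n. \<phi> \<in> T n"
    proof (induction \<phi>)
      case (Eq t u)
      then have "(t, u) \<in> ?W \<times> ?W" by simp
      then have "Eq t u \<in> T (Suc 0)" unfolding T by force
      then show ?case ..
    next
      case (Rel r ts)
      then have "(r, ts) \<in> rels M \<times> lists ?W" by (auto simp: lists_eq_set)
      then have "Rel r ts \<in> T (Suc 0)" unfolding T by force
      then show ?case ..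
    next
      case (Neg \<phi>)
      then obtain n where "\<phi> \<in> T n" by auto
      then have "Neg \<phi> \<in> T (Suc n)" unfolding T by blast
      then show ?case ..
    next
      case (Conj \<phi> \<psi>)
      then obtain m n where "\<phi> \<in> T m" "\<psi> \<in> T n" by auto
      then have "(\<phi>, \<psi>) \<in> T (max m n) \<times> T (max m n)"
        using mono[of m "max m n"] mono[of n "max m n"] by auto
      then have "Conj \<phi> \<psi> \<in> T (Suc (max m n))" unfolding T by force
      then show ?case ..
    next
      case (Ex x \<phi>)
      then obtain n where "\<phi> \<in> T n" by auto
      moreover have "x \<in> ?V" using Ex.prems by (cases x) auto
      ultimately have "(x, \<phi>) \<in> ?V \<times> T n" by simp
      then have "Ex x \<phi> \<in> T (Suc n)" unfolding T by force
      then show ?case ..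
    qed
    then show "\<phi> \<in> (\<Union>n. T n)" by blast
  qed
  ultimately show ?thesis using subset_imp_lepoll lepoll_trans by blast
qed

text \<open>The closure is a union of finite solution sets indexed by formulas, variables and finite
  lists of parameters, and over an infinite \<open>S\<close> that dominates the language and
  \<open>A\<close> there are at most as many indices as elements of \<open>S\<close>.\<close>

lemma acl_lepoll:
  fixes M :: "('s, 'f, 'r, 'm) mstruct"
  assumes S: "infinite S" "sorts M \<lesssim> S" "funs M \<lesssim> S" "rels M \<lesssim> S" "A \<lesssim> S"
  shows "acl M A \<lesssim> S"
proof -
  define vars where "vars \<phi> = (SOME xs. set xs = fv \<phi>)" for \<phi> :: "('s, 'f, 'r) fm"
  have vars: "set (vars \<phi>) = fv \<phi>" for \<phi>
    unfolding vars_def by (rule someI_ex) (simp add: finite_list)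
  define sol where "sol = (\<lambda>(\<phi>, x, as). solutions M x \<phi> (the \<circ> map_of (zip (vars \<phi>) as)))"
  define I where "I = {i \<in> {\<phi>. wf_fm M \<phi>} \<times> (sorts M \<times> UNIV) \<times> lists (insert undefined A). finite (sol i)}"
  have "insert undefined A \<lesssim> S"
    using infinite_Un_lepoll[OF S(1) _ S(5), of "{undefined}"] S(1)
    by (simp add: finite_lepoll_infinite)
  then have "{\<phi>. wf_fm M \<phi>} \<times> (sorts M \<times> (UNIV :: nat set)) \<times> lists (insert undefined A) \<lesssim> S"
    using S wf_fm_lepoll[OF S(1-4)] infinite_le_lepoll
    by (intro infinite_Times_lepoll infinite_lists_lepoll) auto
  moreover have "I \<subseteq> {\<phi>. wf_fm M \<phi>} \<times> (sorts M \<times> UNIV) \<times> lists (insert undefined A)"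
    by (auto simp: I_def)
  ultimately have "I \<lesssim> S" using subset_imp_lepoll lepoll_trans by metis
  then have "(\<Union>i\<in>I. sol i) \<lesssim> S"
    by (rule infinite_UN_lepoll[OF S(1)]) (simp add: I_def finite_lepoll_infinite S(1))
  moreover have "acl M A \<subseteq> (\<Union>i\<in>I. sol i)"
  proof
    fix c assume "c \<in> acl M A"
    then obtain x \<phi> v where \<phi>: "wf_fm M \<phi>" "params_in M A (fv \<phi> - {x}) v"
      "c \<in> solutions M x \<phi> v" "finite (solutions M x \<phi> v)"
      unfolding acl_def by blast
    \<comment> \<open>\<open>solutions\<close> overwrites the entry at the solved variable
      \<open>x\<close>, so any filler will do there; the filler \<open>undefined\<close> was added
      to the admissible list entries for this purpose.\<close>
    define as where "as = map (v(x := undefined)) (vars \<phi>)"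
    have "the (map_of (zip (vars \<phi>) as) u) = (v(x := undefined)) u" if "u \<in> fv \<phi>" for u
      using that unfolding as_def map_of_zip_map vars by simp
    then have "sol (\<phi>, x, as) = solutions M x \<phi> v"
      unfolding sol_def prod.case by (intro solutions_cong) simp
    moreover have "as \<in> lists (insert undefined A)"
      using \<phi>(2) vars[of \<phi>] by (auto simp: as_def params_in_def)
    moreover have "x \<in> sorts M \<times> UNIV"
      using \<phi>(3) by (cases x) (auto simp: solutions_def sorts_def)
    ultimately show "c \<in> (\<Union>i\<in>I. sol i)"
      using \<phi> by (intro UN_I[of "(\<phi>, x, as)"]) (simp_all add: I_def)
  qed
  ultimately show ?thesis using subset_imp_lepoll lepoll_trans by blast
qed

text \<open>The disjoint sum of the natural numbers, the symbols, the sorts and \<open>A\<close> is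
  infinite and dominates everything that \<open>acl_lepoll\<close> asks for, yet remains smaller
  than the monster because the monster is infinite.\<close>

lemma (in monster_model) small_acl:
  assumes "small M A"
  shows "small M (acl M A)"
proof -
  have small_Plus: "small M (X <+> Y)" if "small M X" "small M Y" for X :: "'x set" and Y :: "'y set"
    using that unfolding small_def lesspoll_iff_ordLess
    by (rule card_of_Plus_ordLess_infinite[OF infinite_universe])
  let ?S = "(UNIV :: nat set) <+> sorts M <+> funs M <+> rels M <+> A"
  have L: "small M (sorts M)" "small M (funs M)" "small M (rels M)"
    using large_axiom by (simp_all add: large_def)
  have Inl: "X \<lesssim> X <+> Y" for X :: "'x set" and Y :: "'y set"
    unfolding lepoll_def by (rule exI[of _ Inl]) auto
  have Inr: "Y \<lesssim> X <+> Y" for X :: "'x set" and Y :: "'y set"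
    unfolding lepoll_def by (rule exI[of _ Inr]) auto
  have "acl M A \<lesssim> ?S"
  proof (rule acl_lepoll)
    show "infinite ?S" using Inl infinite_le_lepoll by blast
    show "sorts M \<lesssim> ?S" "funs M \<lesssim> ?S" "rels M \<lesssim> ?S" "A \<lesssim> ?S"
      by (meson Inl Inr lepoll_trans)+
  qed
  moreover have "small M ?S" by (intro small_Plus small_nat L assms)
  ultimately show ?thesis using small_lepoll by blast
qed

section \<open>Realizations of \<open>p\<close> and the calculus of independence\<close>

section \<open>Realizations of the strong type and independence\<close>

locale homology_setting = monster_model M
  for M :: "('s, 'f, 'r, 'm) mstruct" +
  fixes ind :: "'m set \<Rightarrow> 'm set \<Rightarrow> 'm set \<Rightarrow> bool"
    and B :: "'m set"
    and p :: "('s, 'f, 'r, 'm, 'i) ctype"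
  assumes independence: "independence_relation M ind"
    and base: "named_base M B"
    and strong: "strong_type M B p"
begin

lemma small_B: "small M B" and acl_B: "acl M B = B"
  using base by (simp_all add: named_base_def)

lemma small_index: "small M (UNIV :: 'i set)"
  using strong by (simp add: strong_type_def)

lemma G_fixes_B:
  assumes "\<sigma> \<in> G" "b \<in> B"
  shows "\<sigma> b = b"
proof -
  obtain c where "c \<in> funs M" "fun_dom M c = []" "fun_int M c [] = b"
    using base assms(2) unfolding named_base_def by blast
  then show ?thesis using assms(1) unfolding carrier_Aut automorphism_def by auto
qed

lemma G_image_B: "\<sigma> \<in> G \<Longrightarrow> \<sigma> ` B = B"
proof -
  assume "\<sigma> \<in> G"
  then have "\<sigma> ` B = id ` B" using G_fixes_B by (intro image_cong) auto
  then show ?thesis by simp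
qed

lemma B_subset_acl:
  assumes "small M A"
  shows "B \<subseteq> acl M A"
proof
  fix b assume "b \<in> B"
  then have "orbit A b \<subseteq> {b}" using G_fixes_B unfolding orbit_def by blast
  then show "b \<in> acl M A" using acl_iff_orbit[OF assms] finite_subset by blast
qed

lemma acl_empty: "acl M {} = B"
proof
  show "acl M {} \<subseteq> B" using acl_mono[of "{}" B M] by (simp add: acl_B)
  show "B \<subseteq> acl M {}" by (intro B_subset_acl small_finite) simp
qed

definition X :: "('i \<Rightarrow> 'm) set" where
  "X = {a. realizes M B p a}"

lemma X_conjugate:
  assumes "a \<in> X" "b \<in> X"
  obtains \<sigma> where "\<sigma> \<in> G" "\<sigma> \<circ> a = b"
proof -
  let ?K = "range Inl \<union> Inr ` B :: ('i + 'm) set"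
  have "same_type M ?K (case_sum a id) (case_sum b id)"
    using assms by (simp add: X_def realizes_def tp_eq_iff_same_type[symmetric])
  moreover have "small M ?K"
    using small_image[OF small_index, of Inl] small_image[OF small_B, of Inr] by (rule small_Un)
  ultimately obtain \<sigma> where \<sigma>: "automorphism M \<sigma>"
    "\<And>k. k \<in> ?K \<Longrightarrow> \<sigma> (case_sum a id k) = case_sum b id k"
    using homogeneity by metis
  have "\<sigma> (a i) = b i" for i using \<sigma>(2)[of "Inl i"] by simp
  then have "\<sigma> \<circ> a = b" by auto
  then show thesis using that \<sigma>(1) carrier_Aut by blast
qed

lemma G_X [simp]:
  assumes "\<sigma> \<in> G" "a \<in> X"
  shows "\<sigma> \<circ> a \<in> X"
proof -
  let ?K = "range Inl \<union> Inr ` B :: ('i + 'm) set"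
  have "same_type M ?K (case_sum a id) (\<sigma> \<circ> case_sum a id)"
    using assms(1) by (intro same_type_automorphism) (simp only: carrier_Aut)
  then have "same_type M ?K (case_sum a id) (case_sum (\<sigma> \<circ> a) id)"
    by (rule same_type_cong[THEN iffD1, rotated -1]) (use assms(1) G_fixes_B in auto)
  then show ?thesis
    using assms(2) by (simp add: X_def realizes_def tp_eq_iff_same_type[symmetric])
qed

definition cl :: "('i \<Rightarrow> 'm) \<Rightarrow> 'm set" where
  "cl a = acl M (range a)"

lemma small_range: "small M (range (a :: 'i \<Rightarrow> 'm))"
  using small_index by (rule small_image)

lemma small_cl: "small M (cl a)"
  unfolding cl_def using small_range by (rule small_acl)

lemma acl_cl: "acl M (cl a) = cl a"
  unfolding cl_def using small_range by (rule acl_acl)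

lemma range_subset_cl: "range a \<subseteq> cl a"
  unfolding cl_def by (rule subset_acl)

lemma cl_image: "\<sigma> \<in> G \<Longrightarrow> \<sigma> ` cl a = cl (\<sigma> \<circ> a)"
  unfolding cl_def by (simp add: acl_image image_comp)

lemma strong_type_witness:
  obtains a where "a \<in> X" "range a = acl M (range a) \<or> acl M (range a) = dcl M (range a)"
  using strong unfolding strong_type_def X_def realizes_def by blast

text \<open>Here the hypothesis on \<open>p\<close> enters. For the witnessing realization
  \<open>b\<close>, either \<open>b\<close> enumerates its own closure or the closure is definable
  over \<open>b\<close>; in both cases fixing \<open>b\<close> fixes \<open>cl b\<close> pointwise.
  Conjugation by an automorphism taking \<open>b\<close> to \<open>a\<close> transfers this to every
  realization.\<close>

lemma cl_fixed:
  assumes "\<sigma> \<in> G" "a \<in> X" "\<sigma> \<circ> a = a" "d \<in> cl a"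
  shows "\<sigma> d = d"
proof -
  obtain b where b: "b \<in> X" "range b = acl M (range b) \<or> acl M (range b) = dcl M (range b)"
    by (rule strong_type_witness)
  have fixed: "\<tau> e = e" if "\<tau> \<in> G" "\<tau> \<circ> b = b" "e \<in> cl b" for \<tau> e
  proof -
    have "\<tau> (b i) = b i" for i using that(2) by (metis comp_apply)
    then have range: "\<tau> x = x" if "x \<in> range b" for x using that by blast
    show ?thesis
    proof (cases "range b = acl M (range b)")
      case True
      then show ?thesis using range that(3) by (simp add: cl_def)
    next
      case False
      then have "e \<in> dcl M (range b)" using b(2) that(3) by (simp add: cl_def)
      then show ?thesis using dcl_fixed[OF that(1) range] by blast
    qed
  qed
  obtain \<tau> where \<tau>: "\<tau> \<in> G" "\<tau> \<circ> b = a" using X_conjugate[OF b(1) assms(2)] .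
  have "\<sigma> (\<tau> (b i)) = \<tau> (b i)" for i
    using assms(3) \<tau>(2) by (metis comp_apply)
  then have "inv_map \<tau> \<circ> \<sigma> \<circ> \<tau> \<circ> b = b"
    using \<tau>(1) by (auto simp: fun_eq_iff)
  moreover have "inv_map \<tau> \<circ> \<sigma> \<circ> \<tau> \<in> G" using \<tau>(1) assms(1) by (intro G_comp G_inv)
  moreover have "inv_map \<tau> d \<in> cl b"
  proof -
    have "d \<in> \<tau> ` cl b" using assms(4) \<tau> by (simp add: cl_image)
    then show ?thesis using \<tau>(1) by auto
  qed
  ultimately have "(inv_map \<tau> \<circ> \<sigma> \<circ> \<tau>) (inv_map \<tau> d) = inv_map \<tau> d" by (intro fixed)
  then have "inv_map \<tau> (\<sigma> d) = inv_map \<tau> d" using \<tau>(1) by simp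
  then have "\<tau> (inv_map \<tau> (\<sigma> d)) = \<tau> (inv_map \<tau> d)" by (simp only:)
  then show ?thesis using \<tau>(1) by simp
qed

lemma agree_on_cl:
  assumes "\<sigma> \<in> G" "\<tau> \<in> G" "a \<in> X" "\<sigma> \<circ> a = \<tau> \<circ> a" "d \<in> cl a"
  shows "\<sigma> d = \<tau> d"
proof -
  have "inv_map \<tau> \<circ> \<sigma> \<circ> a = inv_map \<tau> \<circ> (\<tau> \<circ> a)" using assms(4) by (metis comp_assoc)
  also have "\<dots> = a" using assms(2) by (simp add: fun_eq_iff)
  finally have "(inv_map \<tau> \<circ> \<sigma>) d = d"
    using assms by (intro cl_fixed[of _ a] G_comp G_inv)
  then have "\<tau> ((inv_map \<tau> \<circ> \<sigma>) d) = \<tau> d" by (simp only:)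
  then show ?thesis using assms(2) by simp
qed

subsection \<open>Independence over the base\<close>

lemmas ind_axioms = independence[unfolded independence_relation_def]
lemmas invariance = ind_axioms[THEN conjunct1, rule_format]
lemmas finite_character = ind_axioms[THEN conjunct2, THEN conjunct1, rule_format]
lemmas normality = ind_axioms[THEN conjunct2, THEN conjunct2, THEN conjunct1, rule_format]
lemmas symmetry = ind_axioms[THEN conjunct2, THEN conjunct2, THEN conjunct2, THEN conjunct1, rule_format]
lemmas transitivity = ind_axioms[THEN conjunct2, THEN conjunct2, THEN conjunct2, THEN conjunct2,
  THEN conjunct1, rule_format]
lemmas extension = ind_axioms[THEN conjunct2, THEN conjunct2, THEN conjunct2, THEN conjunct2,
  THEN conjunct2, rule_format]

lemma ind_invariant:
  assumes "\<sigma> \<in> G" "small M A" "small M D"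
  shows "ind (\<sigma> ` A) B (\<sigma> ` D) \<longleftrightarrow> ind A B D"
proof -
  have "ind (\<sigma> ` A) (\<sigma> ` B) (\<sigma> ` D) \<longleftrightarrow> ind A B D"
    by (rule invariance) (use assms small_B in simp)
  then show ?thesis using assms(1) by (simp only: G_image_B)
qed

lemma ind_sym:
  assumes "ind A C D" "small M A" "small M C" "small M D"
  shows "ind D C A"
  using symmetry[of A C D] assms by simp

lemma ind_mono:
  assumes "ind A C D" "small M A" "small M C" "small M D" "A' \<subseteq> A" "D' \<subseteq> D"
  shows "ind A' C D'"
proof -
  have "ind A0 C D0" if "finite A0" "A0 \<subseteq> A'" "finite D0" "D0 \<subseteq> D'" for A0 D0
  proof -
    have "A0 \<subseteq> A" "D0 \<subseteq> D" using that assms(5,6) by auto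
    then show ?thesis using finite_character[of A C D] assms(1-4) that(1,3) by simp
  qed
  moreover have "small M A'" "small M D'"
    using small_subset[OF assms(2,5)] small_subset[OF assms(4,6)] .
  ultimately show ?thesis using finite_character[of A' C D'] assms(3) by simp
qed

lemma ind_normal:
  assumes "ind A C D" "small M A" "small M C" "small M D"
  shows "ind A C (acl M (D \<union> C))"
  by (rule normality) (use assms in simp)

lemma ind_trans:
  assumes "small M A" "small M D" "E \<subseteq> C" "C \<subseteq> D"
  shows "ind A E D \<longleftrightarrow> ind A E C \<and> ind A C D"
  by (rule transitivity) (use assms in simp)

text \<open>Homogeneity turns the elementary map of the extension axiom into an automorphism, so
  that later constructions can move everything at once.\<close>

lemma ind_extension:
  assumes "small M A" "small M C" "E \<subseteq> C"
  obtains \<sigma> where "\<sigma> \<in> G" "\<And>e. e \<in> E \<Longrightarrow> \<sigma> e = e" "ind (\<sigma> ` A) E C"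
proof -
  have "\<exists>g. elementary_map M (A \<union> E) g \<and> (\<forall>e\<in>E. g e = e) \<and> ind (g ` A) E C"
    by (rule extension) (use assms in simp)
  then obtain g where g: "elementary_map M (A \<union> E) g" "\<forall>e\<in>E. g e = e" "ind (g ` A) E C" by blast
  have "small M (A \<union> E)" using small_Un[OF assms(1) small_subset[OF assms(2,3)]] .
  then obtain \<sigma> where \<sigma>: "\<sigma> \<in> G" "\<And>x. x \<in> A \<union> E \<Longrightarrow> \<sigma> x = g x"
    using elementary_map_extends[OF g(1)] by blast
  have "\<sigma> ` A = g ` A" using \<sigma>(2) by auto
  then show thesis using that[of \<sigma>] \<sigma> g by auto
qed

text \<open>The axiom wants its base inside the right-hand set, so extension is used for
  \<open>B \<union> D\<close>. It yields independence of the tuple only; symmetry brings the tuple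
  to the right, where normality replaces it by a closure.\<close>

lemma ind_exists:
  assumes "a \<in> X" "small M D"
  obtains z where "z \<in> X" "ind (cl z) B D"
proof -
  obtain \<sigma> where \<sigma>: "\<sigma> \<in> G" "ind (\<sigma> ` range a) B (B \<union> D)"
    using ind_extension[OF small_range small_Un[OF small_B assms(2)], of B a] by blast
  let ?z = "\<sigma> \<circ> a"
  have "ind (range ?z) B (B \<union> D)" using \<sigma>(2) by (simp add: image_comp)
  then have "ind (B \<union> D) B (range ?z)"
    by (rule ind_sym) (use small_range small_B assms small_Un in auto)
  then have "ind (B \<union> D) B (acl M (range ?z \<union> B))"
    by (rule ind_normal) (use small_range small_B assms small_Un in auto)
  then have "ind (acl M (range ?z \<union> B)) B (B \<union> D)"
    by (rule ind_sym) (use small_range small_B assms small_Un small_acl in auto)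
  then have "ind (cl ?z) B D"
    by (rule ind_mono)
      (use small_range small_B assms small_Un small_acl acl_mono[of "range ?z" "range ?z \<union> B" M] in
        \<open>auto simp: cl_def\<close>)
  then show thesis using that[of ?z] \<sigma>(1) assms(1) by simp
qed

text \<open>Transitivity is used twice along closed sets. With \<open>C\<close> the closure of
  \<open>y\<close> over \<open>B\<close> and \<open>D\<close> that of \<open>x\<close> and
  \<open>y\<close>, normality gives independence of \<open>z\<close> from \<open>D\<close> over
  \<open>B\<close>, and transitivity makes \<open>z\<close> independent from \<open>x\<close> over
  \<open>C\<close>. After symmetry and normality this combines with the independence of
  \<open>x\<close> from \<open>C\<close> over \<open>B\<close>.\<close>

lemma ind_rotate:
  assumes xy: "ind x B y" and z: "ind z B (x \<union> y)" and small: "small M x" "small M y" "small M z"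
  shows "ind x B (y \<union> z)"
proof -
  define C where "C = acl M (y \<union> B)"
  have "small M (y \<union> B)" using small small_B by (intro small_Un)
  then have C: "small M C" "B \<subseteq> C" "y \<subseteq> C"
    using small_acl subset_acl[of "y \<union> B" M] by (auto simp: C_def)
  have xC: "ind x B C" unfolding C_def by (rule ind_normal) (use xy small small_B in auto)
  define D where "D = acl M (x \<union> y \<union> B)"
  have "small M (x \<union> y \<union> B)" using small small_B by (intro small_Un)
  then have D: "small M D" "C \<subseteq> D" "x \<subseteq> D"
    using small_acl subset_acl[of "x \<union> y \<union> B" M]
      acl_mono[of "y \<union> B" "x \<union> y \<union> B" M] by (auto simp: C_def D_def)
  have "ind z B D" unfolding D_def by (rule ind_normal) (use z small small_B small_Un in auto)
  then have "ind z C D" using ind_trans[OF small(3) D(1) C(2) D(2)] by blast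
  then have "ind z C x" by (rule ind_mono) (use small C D in auto)
  then have "ind x C z" by (rule ind_sym) (use small C in auto)
  then have "ind x C (acl M (z \<union> C))" by (rule ind_normal) (use small C in auto)
  moreover have zC: "small M (acl M (z \<union> C))" "z \<union> C \<subseteq> acl M (z \<union> C)"
    using small_acl[OF small_Un[OF small(3) C(1)]] subset_acl .
  ultimately have "ind x B (acl M (z \<union> C))"
    using ind_trans[OF small(1) zC(1) C(2)] xC zC(2) by blast
  then show ?thesis by (rule ind_mono) (use small zC small_B C in auto)
qed

definition ind2 :: "('i \<Rightarrow> 'm) \<Rightarrow> ('i \<Rightarrow> 'm) \<Rightarrow> bool" where
  "ind2 x y \<longleftrightarrow> ind (cl x) B (cl y)"

definition ind3 :: "('i \<Rightarrow> 'm) \<Rightarrow> ('i \<Rightarrow> 'm) \<Rightarrow> ('i \<Rightarrow> 'm) \<Rightarrow> bool" where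
  "ind3 x y z \<longleftrightarrow> ind (cl x) B (cl y \<union> cl z) \<and> ind (cl y) B (cl x \<union> cl z) \<and> ind (cl z) B (cl x \<union> cl y)"

lemma ind2_sym: "ind2 x y \<Longrightarrow> ind2 y x"
  unfolding ind2_def by (rule ind_sym) (auto simp: small_cl small_B)

lemma ind2_invariant: "\<sigma> \<in> G \<Longrightarrow> ind2 (\<sigma> \<circ> x) (\<sigma> \<circ> y) \<longleftrightarrow> ind2 x y"
  unfolding ind2_def by (simp add: cl_image[symmetric] ind_invariant small_cl)

text \<open>Only the new point \<open>z\<close> has to be checked against the pair;
  \<open>ind_rotate\<close> supplies the two conditions with \<open>z\<close> on the right.\<close>

lemma ind3I:
  assumes "ind2 x y" "ind (cl z) B (cl x \<union> cl y)"
  shows "ind3 x y z"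
proof -
  have "ind (cl x) B (cl y \<union> cl z)"
    by (rule ind_rotate) (use assms in \<open>auto simp: ind2_def small_cl\<close>)
  moreover have "ind (cl y) B (cl x \<union> cl z)"
    by (rule ind_rotate) (use assms ind2_sym in \<open>auto simp: ind2_def small_cl Un_commute\<close>)
  ultimately show ?thesis using assms(2) by (simp add: ind3_def)
qed

lemma ind3_ind2: "ind3 x y z \<Longrightarrow> ind2 x y"
  unfolding ind3_def ind2_def by (elim conjE, erule ind_mono) (auto simp: small_cl small_B small_Un)

lemma ind3_perm: "ind3 x y z \<Longrightarrow> ind3 y x z" "ind3 x y z \<Longrightarrow> ind3 x z y"
  by (auto simp: ind3_def Un_commute)

lemma ind_exists_finite:
  assumes "finite Y" "Y \<subseteq> X"
  obtains z where "z \<in> X" "ind (cl z) B (\<Union>(cl ` Y))"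
proof -
  obtain a where "a \<in> X" by (rule strong_type_witness)
  moreover have "small M (\<Union>(cl ` Y))" using assms(1) small_cl by (intro small_UN_finite)
  ultimately show thesis using ind_exists that by blast
qed

lemma ind_cl_mono:
  assumes "ind (cl z) B (\<Union>(cl ` Y))" "finite Y" "D \<subseteq> \<Union>(cl ` Y)"
  shows "ind (cl z) B D"
  using assms small_cl small_B by (intro ind_mono[OF assms(1)] small_UN_finite) auto

end

section \<open>Simplices as functors, and edges presented by points of the monster\<close>

section \<open>Faces\<close>

text \<open>Names a face by the vertices it keeps instead of the position of the vertex it drops,
  which makes iterated faces and faces of different simplices easy to compare.\<close>

definition restr :: "nat set \<Rightarrow> 'm psimplex \<Rightarrow> 'm psimplex" where
  "restr t f = \<lparr>supp = t,
     obj = (\<lambda>u. if u \<subseteq> t then obj f u else undefined),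
     mor = (\<lambda>u v. if u \<subseteq> v \<and> v \<subseteq> t then mor f u v else undefined)\<rparr>"

lemma face_restr: "face i f = restr (supp f - {sorted_list_of_set (supp f) ! i}) f"
  by (simp add: face_def restr_def Let_def)

lemma supp_restr [simp]: "supp (restr t f) = t"
  by (simp add: restr_def)

lemma restr_restr: "t \<subseteq> t' \<Longrightarrow> restr t (restr t' f) = restr t f"
  unfolding restr_def by (auto simp: fun_eq_iff)

lemma sorted_list_pair: "i < j \<Longrightarrow> sorted_list_of_set {i, j :: nat} = [i, j]"
  using sorted_list_of_set.idem_if_sorted_distinct[of "[i, j]"] by simp

lemma sorted_list_triple: "i < j \<Longrightarrow> j < k \<Longrightarrow> sorted_list_of_set {i, j, k :: nat} = [i, j, k]"
  using sorted_list_of_set.idem_if_sorted_distinct[of "[i, j, k]"] by simp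

lemma face_edge:
  assumes "supp f = {i, j}" "i < j"
  shows "face 0 f = restr {j} f" "face 1 f = restr {i} f"
proof -
  have "face n f = restr ({i, j} - {[i, j] ! n}) f" for n
    unfolding face_restr assms(1) sorted_list_pair[OF assms(2)] by (rule refl)
  moreover have "{i, j} - {i} = {j}" "{i, j} - {j} = {i}" using assms by auto
  ultimately show "face 0 f = restr {j} f" "face 1 f = restr {i} f" by simp_all
qed

lemma face_triangle:
  assumes "supp f = {i, j, k}" "i < j" "j < k"
  shows "face 0 f = restr {j, k} f" "face 1 f = restr {i, k} f" "face 2 f = restr {i, j} f"
proof -
  have face: "face n f = restr ({i, j, k} - {[i, j, k] ! n}) f" for n
    unfolding face_restr assms(1) sorted_list_triple[OF assms(2,3)] by (rule refl)
  have eq: "{i, j, k} - {i} = {j, k}" "{i, j, k} - {j} = {i, k}" "{i, j, k} - {k} = {i, j}"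
    using assms by auto
  show "face 0 f = restr {j, k} f" unfolding face by (simp only: nth_Cons_0 eq)
  show "face 1 f = restr {i, k} f" unfolding face by (simp only: One_nat_def nth_Cons_Suc nth_Cons_0 eq)
  show "face 2 f = restr {i, j} f" unfolding face by (simp only: numeral_2_eq_2 nth_Cons_Suc nth_Cons_0 eq)
qed

lemma edge_supp:
  assumes "card s = 2"
  obtains i j :: nat where "s = {i, j}" "i < j"
proof -
  obtain i j where "s = {i, j}" "i \<noteq> j" using assms by (auto simp: card_2_iff)
  then consider "i < j" | "j < i" by linarith
  then show thesis
    using that[of i j] that[of j i] \<open>s = {i, j}\<close> by cases (auto simp: insert_commute)
qed

lemma triangle_supp:
  assumes "card s = 3" "finite s"
  obtains i j k :: nat where "s = {i, j, k}" "i < j" "j < k"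
proof -
  have "length xs = 3 \<Longrightarrow> \<exists>i j k. xs = [i, j, k]" for xs :: "nat list"
    by (auto simp: numeral_3_eq_3 length_Suc_conv)
  moreover have "length (sorted_list_of_set s) = 3" using assms by simp
  ultimately obtain i j k where l: "sorted_list_of_set s = [i, j, k]" by blast
  then have "s = {i, j, k}" using assms(2) by (metis set_sorted_list_of_set list.set(1,2))
  moreover have "i < j" "j < k"
    using strict_sorted_list_of_set[of s] l by auto
  ultimately show thesis using that by blast
qed

lemma is_functorD:
  assumes "is_functor M B f"
  shows functor_small: "u \<subseteq> supp f \<Longrightarrow> small M (obj f u)"
    and functor_base: "u \<subseteq> supp f \<Longrightarrow> B \<subseteq> obj f u"
    and functor_maps: "u \<subseteq> v \<Longrightarrow> v \<subseteq> supp f \<Longrightarrow> mor f u v ` obj f u \<subseteq> obj f v"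
    and functor_elementary: "u \<subseteq> v \<Longrightarrow> v \<subseteq> supp f \<Longrightarrow> elementary_map M (obj f u) (mor f u v)"
    and functor_fixes: "u \<subseteq> v \<Longrightarrow> v \<subseteq> supp f \<Longrightarrow> b \<in> B \<Longrightarrow> mor f u v b = b"
    and functor_extensional: "u \<subseteq> v \<Longrightarrow> v \<subseteq> supp f \<Longrightarrow> mor f u v \<in> extensional (obj f u)"
    and functor_id: "u \<subseteq> supp f \<Longrightarrow> x \<in> obj f u \<Longrightarrow> mor f u u x = x"
    and functor_comp: "u \<subseteq> v \<Longrightarrow> v \<subseteq> w \<Longrightarrow> w \<subseteq> supp f \<Longrightarrow> x \<in> obj f u \<Longrightarrow>
      mor f v w (mor f u v x) = mor f u w x"
    and functor_undefined: "\<not> u \<subseteq> supp f \<Longrightarrow> obj f u = undefined"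
      "\<not> (u \<subseteq> v \<and> v \<subseteq> supp f) \<Longrightarrow> mor f u v = undefined"
  using assms by (simp_all add: is_functor_def)

lemma is_simplexD:
  assumes "is_simplex M ind B p n f"
  shows simplex_finite: "finite (supp f)" and simplex_card: "card (supp f) = n + 1"
    and simplex_functor: "is_functor M B f" and simplex_empty: "obj f {} = B"
    and simplex_vertex: "i \<in> supp f \<Longrightarrow> \<exists>b. realizes M B p b \<and> obj f {i} = acl M (range b)"
    and simplex_closure: "u \<subseteq> supp f \<Longrightarrow> u \<noteq> {} \<Longrightarrow> obj f u = acl M (\<Union>i\<in>u. img f {i} u)"
    and simplex_independent: "u \<subseteq> supp f \<Longrightarrow> u \<noteq> {} \<Longrightarrow> independent_family ind B u (\<lambda>i. img f {i} u)"
  using assms unfolding is_simplex_def by blast+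

lemma restr_is_functor:
  assumes "is_functor M B f" "t \<subseteq> supp f"
  shows "is_functor M B (restr t f)"
proof -
  have t: "u \<subseteq> supp f" if "u \<subseteq> t" for u using that assms(2) by (rule order_trans)
  have t': "u \<subseteq> t" if "u \<subseteq> v" "v \<subseteq> t" for u v :: "nat set" using that by (rule order_trans)
  have restr: "obj (restr t f) u = obj f u" if "u \<subseteq> t" for u using that by (simp add: restr_def)
  have mor: "mor (restr t f) u v = mor f u v" if "u \<subseteq> v" "v \<subseteq> t" for u v
    using that by (simp add: restr_def)
  show ?thesis
    unfolding is_functor_def supp_restr
  proof (intro conjI allI impI ballI)
    fix u assume u: "u \<subseteq> t"
    show "small M (obj (restr t f) u)" "B \<subseteq> obj (restr t f) u"
      unfolding restr[OF u] by (rule functor_small[OF assms(1) t[OF u]], rule functor_base[OF assms(1) t[OF u]])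
    fix x assume "x \<in> obj (restr t f) u"
    then show "mor (restr t f) u u x = x"
      unfolding restr[OF u] mor[OF order_refl u] by (rule functor_id[OF assms(1) t[OF u]])
  next
    fix u v assume "u \<subseteq> v \<and> v \<subseteq> t"
    then have uv: "u \<subseteq> v" "v \<subseteq> t" by simp_all
    note u = t'[OF uv]
    show "mor (restr t f) u v ` obj (restr t f) u \<subseteq> obj (restr t f) v"
      unfolding restr[OF u] restr[OF uv(2)] mor[OF uv] by (rule functor_maps[OF assms(1) uv(1) t[OF uv(2)]])
    show "elementary_map M (obj (restr t f) u) (mor (restr t f) u v)"
      unfolding restr[OF u] mor[OF uv] by (rule functor_elementary[OF assms(1) uv(1) t[OF uv(2)]])
    show "mor (restr t f) u v \<in> extensional (obj (restr t f) u)"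
      unfolding restr[OF u] mor[OF uv] by (rule functor_extensional[OF assms(1) uv(1) t[OF uv(2)]])
    show "mor (restr t f) u v b = b" if "b \<in> B" for b
      unfolding mor[OF uv] by (rule functor_fixes[OF assms(1) uv(1) t[OF uv(2)] that])
  next
    fix u v w x assume "u \<subseteq> v \<and> v \<subseteq> w \<and> w \<subseteq> t" and x: "x \<in> obj (restr t f) u"
    then have uvw: "u \<subseteq> v" "v \<subseteq> w" "w \<subseteq> t" by simp_all
    have vt: "v \<subseteq> t" "u \<subseteq> w" using uvw by auto
    note u = t'[OF uvw(1) vt(1)]
    show "mor (restr t f) v w (mor (restr t f) u v x) = mor (restr t f) u w x"
      using x unfolding restr[OF u] mor[OF uvw(1) vt(1)] mor[OF uvw(2,3)] mor[OF vt(2) uvw(3)]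
      by (rule functor_comp[OF assms(1) uvw(1,2) t[OF uvw(3)]])
  qed (auto simp: restr_def)
qed

lemma restr_is_simplex:
  assumes f: "is_simplex M ind B p n f" and t: "t \<subseteq> supp f" "card t = m + 1"
  shows "is_simplex M ind B p m (restr t f)"
proof -
  have img: "img (restr t f) {i} u = img f {i} u" if "i \<in> u" "u \<subseteq> t" for i u
  proof -
    have "i \<in> t" using that by blast
    then show ?thesis using that by (simp add: img_def restr_def)
  qed
  have "obj (restr t f) u = acl M (\<Union>i\<in>u. img (restr t f) {i} u) \<and>
      independent_family ind B u (\<lambda>i. img (restr t f) {i} u)" if u: "u \<subseteq> t" "u \<noteq> {}" for u
  proof -
    have us: "u \<subseteq> supp f" using u t by blast
    have "obj (restr t f) u = obj f u" using u by (simp add: restr_def)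
    moreover have "(\<Union>i\<in>u. img (restr t f) {i} u) = (\<Union>i\<in>u. img f {i} u)"
      using img u by simp
    moreover have "independent_family ind B u (\<lambda>i. img (restr t f) {i} u) =
        independent_family ind B u (\<lambda>i. img f {i} u)"
      unfolding independent_family_def using img u by simp
    ultimately show ?thesis
      using simplex_closure[OF f us u(2)] simplex_independent[OF f us u(2)] by simp
  qed
  moreover have "is_functor M B (restr t f)" by (rule restr_is_functor[OF simplex_functor[OF f] t(1)])
  moreover have "finite t" using t(1) simplex_finite[OF f] by (rule finite_subset)
  moreover have "\<exists>b. realizes M B p b \<and> obj (restr t f) {i} = acl M (range b)" if "i \<in> t" for i
  proof -
    have "obj (restr t f) {i} = obj f {i}" using that by (simp add: restr_def)
    then show ?thesis using simplex_vertex[OF f, of i] that t(1) by auto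
  qed
  moreover have "obj (restr t f) {} = B" using simplex_empty[OF f] by (simp add: restr_def)
  ultimately show ?thesis unfolding is_simplex_def using t(2) by simp
qed

section \<open>Standard simplices\<close>

text \<open>Place realizations \<open>x i\<close> of the type in the monster and move the closure of each part \<open>u\<close>
  of the support by an automorphism \<open>\<rho> u\<close>; the transition maps are forced.  Every \<open>1\<close>-simplex has
  this form.\<close>

context homology_setting
begin

definition clo :: "(nat \<Rightarrow> 'i \<Rightarrow> 'm) \<Rightarrow> nat set \<Rightarrow> 'm set" where
  "clo x u = acl M (\<Union>i\<in>u. cl (x i))"

definition std :: "nat set \<Rightarrow> (nat \<Rightarrow> 'i \<Rightarrow> 'm) \<Rightarrow> (nat set \<Rightarrow> 'm \<Rightarrow> 'm) \<Rightarrow> 'm psimplex" where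
  "std s x \<rho> = \<lparr>supp = s,
     obj = (\<lambda>u. if u \<subseteq> s then \<rho> u ` clo x u else undefined),
     mor = (\<lambda>u v. if u \<subseteq> v \<and> v \<subseteq> s
        then restrict (\<rho> v \<circ> inv_map (\<rho> u)) (\<rho> u ` clo x u) else undefined)\<rparr>"

lemma std_simps [simp]:
  "supp (std s x \<rho>) = s"
  "u \<subseteq> s \<Longrightarrow> obj (std s x \<rho>) u = \<rho> u ` clo x u"
  "u \<subseteq> v \<Longrightarrow> v \<subseteq> s \<Longrightarrow> mor (std s x \<rho>) u v = restrict (\<rho> v \<circ> inv_map (\<rho> u)) (\<rho> u ` clo x u)"
  by (simp_all add: std_def)

lemma clo_empty: "clo x {} = B"
  by (simp add: clo_def acl_empty)

lemma clo_single: "clo x {i} = cl (x i)"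
  by (simp add: clo_def acl_cl)

lemma clo_mono: "u \<subseteq> v \<Longrightarrow> clo x u \<subseteq> clo x v"
  unfolding clo_def by (rule acl_mono) blast

lemma small_union_cl: "finite u \<Longrightarrow> small M (\<Union>i\<in>u. cl (x i))"
  by (intro small_UN_finite small_cl)

lemma small_clo: "finite u \<Longrightarrow> small M (clo x u)"
  unfolding clo_def by (intro small_acl small_union_cl)

lemma B_subset_clo: "finite u \<Longrightarrow> B \<subseteq> clo x u"
  unfolding clo_def by (intro B_subset_acl small_union_cl)

lemma restr_std: "t \<subseteq> s \<Longrightarrow> restr t (std s x \<rho>) = std t x \<rho>"
  unfolding restr_def std_def by (auto simp: fun_eq_iff)

lemma std_cong:
  assumes "\<And>i. i \<in> s \<Longrightarrow> x i = x' i" "\<And>u. u \<subseteq> s \<Longrightarrow> \<rho> u = \<rho>' u"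
  shows "std s x \<rho> = std s x' \<rho>'"
proof -
  have clo: "clo x u = clo x' u" if "u \<subseteq> s" for u
  proof -
    have "(\<Union>i\<in>u. cl (x i)) = (\<Union>i\<in>u. cl (x' i))" using assms(1) that by (intro SUP_cong) auto
    then show ?thesis by (simp add: clo_def)
  qed
  have "(\<lambda>u. if u \<subseteq> s then \<rho> u ` clo x u else undefined) =
      (\<lambda>u. if u \<subseteq> s then \<rho>' u ` clo x' u else undefined)"
    by (rule ext) (simp add: clo assms(2))
  moreover have "(\<lambda>u v. if u \<subseteq> v \<and> v \<subseteq> s then restrict (\<rho> v \<circ> inv_map (\<rho> u)) (\<rho> u ` clo x u) else undefined) =
      (\<lambda>u v. if u \<subseteq> v \<and> v \<subseteq> s then restrict (\<rho>' v \<circ> inv_map (\<rho>' u)) (\<rho>' u ` clo x' u) else undefined)"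
  proof (rule ext, rule ext)
    fix u v :: "nat set"
    have "restrict (\<rho> v \<circ> inv_map (\<rho> u)) (\<rho> u ` clo x u) =
        restrict (\<rho>' v \<circ> inv_map (\<rho>' u)) (\<rho>' u ` clo x' u)" if "u \<subseteq> v \<and> v \<subseteq> s"
    proof -
      have "u \<subseteq> s" "v \<subseteq> s" using that by auto
      then show ?thesis by (simp only: clo assms(2))
    qed
    then show "(if u \<subseteq> v \<and> v \<subseteq> s then restrict (\<rho> v \<circ> inv_map (\<rho> u)) (\<rho> u ` clo x u) else undefined) =
        (if u \<subseteq> v \<and> v \<subseteq> s then restrict (\<rho>' v \<circ> inv_map (\<rho>' u)) (\<rho>' u ` clo x' u) else undefined)"
      by (rule if_cong[OF refl _ refl])
  qed
  ultimately show ?thesis unfolding std_def by (simp only:)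
qed

lemma img_std:
  assumes "i \<in> u" "u \<subseteq> s" "\<rho> {i} \<in> G"
  shows "img (std s x \<rho>) {i} u = \<rho> u ` cl (x i)"
proof -
  have "{i} \<subseteq> u" "{i} \<subseteq> s" using assms by auto
  then have "img (std s x \<rho>) {i} u = (\<rho> u \<circ> inv_map (\<rho> {i})) ` \<rho> {i} ` cl (x i)"
    using assms by (simp add: img_def clo_single)
  also have "\<dots> = \<rho> u ` cl (x i)" using assms(3) by (simp add: image_image)
  finally show ?thesis .
qed

lemma std_is_functor:
  assumes "finite s" "\<And>u. \<rho> u \<in> G"
  shows "is_functor M B (std s x \<rho>)"
proof -
  have sub: "u \<subseteq> s" if "u \<subseteq> v" "v \<subseteq> s" for u v :: "nat set" using that by (rule order_trans)
  have fin: "finite u" if "u \<subseteq> s" for u using that assms(1) by (rule finite_subset)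
  have B: "b \<in> \<rho> u ` clo x u" if "u \<subseteq> s" "b \<in> B" for u b
  proof -
    have "\<rho> u b \<in> \<rho> u ` clo x u" using B_subset_clo[OF fin[OF that(1)]] that(2) by blast
    then show ?thesis using G_fixes_B[OF assms(2) that(2)] by simp
  qed
  have "mor (std s x \<rho>) u v ` obj (std s x \<rho>) u \<subseteq> obj (std s x \<rho>) v \<and>
      elementary_map M (obj (std s x \<rho>) u) (mor (std s x \<rho>) u v) \<and>
      (\<forall>b\<in>B. mor (std s x \<rho>) u v b = b) \<and> mor (std s x \<rho>) u v \<in> extensional (obj (std s x \<rho>) u)"
    if uv: "u \<subseteq> v" "v \<subseteq> s" for u v
  proof (intro conjI ballI)
    note u = sub[OF uv]
    show "mor (std s x \<rho>) u v ` obj (std s x \<rho>) u \<subseteq> obj (std s x \<rho>) v"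
    proof
      fix z assume "z \<in> mor (std s x \<rho>) u v ` obj (std s x \<rho>) u"
      then obtain y where "y \<in> clo x u" "z = \<rho> v y" using uv u assms(2) by auto
      then show "z \<in> obj (std s x \<rho>) v" using clo_mono[OF uv(1), of x] uv(2) by auto
    qed
    show "elementary_map M (obj (std s x \<rho>) u) (mor (std s x \<rho>) u v)"
      using uv u assms(2)
      by (intro elementary_map_automorphism[of "\<rho> v \<circ> inv_map (\<rho> u)"] G_comp G_inv) auto
    fix b assume b: "b \<in> B"
    have "inv_map (\<rho> u) b = b" using G_fixes_B[OF G_inv[OF assms(2)] b] .
    then show "mor (std s x \<rho>) u v b = b"
      using uv B[OF u b] G_fixes_B[OF assms(2) b] by simp
  qed (use uv sub[OF uv] in simp)
  moreover have "mor (std s x \<rho>) v w (mor (std s x \<rho>) u v y) = mor (std s x \<rho>) u w y"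
    if uvw: "u \<subseteq> v" "v \<subseteq> w" "w \<subseteq> s" and y: "y \<in> obj (std s x \<rho>) u" for u v w y
  proof -
    have v: "v \<subseteq> s" "u \<subseteq> s" "u \<subseteq> w" using uvw by auto
    then obtain z where z: "z \<in> clo x u" "y = \<rho> u z" using y by auto
    then have "\<rho> v z \<in> \<rho> v ` clo x v" "\<rho> u z \<in> \<rho> u ` clo x u" using clo_mono[OF uvw(1)] by auto
    then show ?thesis using uvw v z assms(2) by simp
  qed
  moreover have "mor (std s x \<rho>) u u y = y" if "u \<subseteq> s" "y \<in> obj (std s x \<rho>) u" for u y
    using that assms(2) by auto
  moreover have "small M (obj (std s x \<rho>) u) \<and> B \<subseteq> obj (std s x \<rho>) u" if "u \<subseteq> s" for u
    using that B small_image[OF small_clo[OF fin[OF that]]] by auto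
  ultimately show ?thesis
    unfolding is_functor_def std_simps(1) by (simp add: std_def)
qed

lemma std_is_simplex:
  assumes "finite s" "card s = n + 1" "\<And>u. \<rho> u \<in> G" "\<And>i. i \<in> s \<Longrightarrow> x i \<in> X"
    and indep: "\<And>i. i \<in> s \<Longrightarrow> ind (cl (x i)) B (\<Union>j\<in>s - {i}. cl (x j))"
  shows "is_simplex M ind B p n (std s x \<rho>)"
  unfolding is_simplex_def std_simps(1)
proof (intro conjI ballI allI impI)
  show "is_functor M B (std s x \<rho>)" by (rule std_is_functor[OF assms(1,3)])
  show "obj (std s x \<rho>) {} = B" using G_image_B[OF assms(3)] by (simp add: clo_empty)
  show "\<exists>b. realizes M B p b \<and> obj (std s x \<rho>) {i} = acl M (range b)" if "i \<in> s" for i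
  proof -
    have "\<rho> {i} \<circ> x i \<in> X" using assms(3,4) that by simp
    moreover have "obj (std s x \<rho>) {i} = cl (\<rho> {i} \<circ> x i)"
      using that by (simp add: clo_single cl_image[OF assms(3)])
    ultimately show ?thesis unfolding X_def cl_def by blast
  qed
  fix u assume u: "u \<subseteq> s \<and> u \<noteq> {}"
  have img: "img (std s x \<rho>) {i} u = \<rho> u ` cl (x i)" if "i \<in> u" for i
    using img_std that u assms(3) by simp
  have "(\<Union>i\<in>u. img (std s x \<rho>) {i} u) = \<rho> u ` (\<Union>i\<in>u. cl (x i))"
    using img by (simp add: image_UN)
  then show "obj (std s x \<rho>) u = acl M (\<Union>i\<in>u. img (std s x \<rho>) {i} u)"
    using u by (simp add: clo_def acl_image[OF assms(3)])
  show "independent_family ind B u (\<lambda>i. img (std s x \<rho>) {i} u)"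
    unfolding independent_family_def
  proof
    fix i assume i: "i \<in> u"
    have fin: "finite (s - {i})" using assms(1) by simp
    have "ind (cl (x i)) B (\<Union>j\<in>u - {i}. cl (x j))"
      using u i by (intro ind_mono[OF indep[of i] small_cl small_B small_union_cl[OF fin]]) auto
    moreover have "finite (u - {i})" using u assms(1) finite_subset by auto
    ultimately have "ind (\<rho> u ` cl (x i)) B (\<rho> u ` (\<Union>j\<in>u - {i}. cl (x j)))"
      using ind_invariant[OF assms(3) small_cl small_union_cl, THEN iffD2] by blast
    moreover have "\<rho> u ` (\<Union>j\<in>u - {i}. cl (x j)) = (\<Union>j\<in>u - {i}. img (std s x \<rho>) {j} u)"
      using img by (simp add: image_UN)
    ultimately show "ind (img (std s x \<rho>) {i} u) B (\<Union>j\<in>u - {i}. img (std s x \<rho>) {j} u)"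
      using img[OF i] by simp
  qed
qed (use assms in auto)

lemma std_edge_is_simplex:
  assumes "i \<noteq> j" "\<And>u. \<rho> u \<in> G" "x i \<in> X" "x j \<in> X" "ind2 (x i) (x j)"
  shows "is_simplex M ind B p 1 (std {i, j} x \<rho>)"
proof (rule std_is_simplex)
  show "ind (cl (x k)) B (\<Union>l\<in>{i, j} - {k}. cl (x l))" if "k \<in> {i, j}" for k
  proof -
    have "{i, j} - {i} = {j}" "{i, j} - {j} = {i}" using assms(1) by auto
    moreover have "ind (cl (x i)) B (cl (x j))" "ind (cl (x j)) B (cl (x i))"
      using assms(5) ind2_sym[OF assms(5)] by (simp_all only: ind2_def)
    moreover have "k = i \<or> k = j" using that by simp
    ultimately show ?thesis by (elim disjE) simp_all
  qed
  show "card {i, j} = 1 + 1" using assms(1) by simp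
  show "x k \<in> X" if "k \<in> {i, j}" for k using that assms(3,4) by auto
qed (rule finite.intros assms(2))+

lemma std_triangle_is_simplex:
  assumes "i < j" "j < k" "\<And>u. \<rho> u \<in> G" "x i \<in> X" "x j \<in> X" "x k \<in> X" "ind3 (x i) (x j) (x k)"
  shows "is_simplex M ind B p 2 (std {i, j, k} x \<rho>)"
proof (rule std_is_simplex)
  show "ind (cl (x l)) B (\<Union>l'\<in>{i, j, k} - {l}. cl (x l'))" if "l \<in> {i, j, k}" for l
  proof -
    have "{i, j, k} - {i} = {j, k}" "{i, j, k} - {j} = {i, k}" "{i, j, k} - {k} = {i, j}"
      using assms(1,2) by auto
    moreover have "ind (cl (x i)) B (cl (x j) \<union> cl (x k))" "ind (cl (x j)) B (cl (x i) \<union> cl (x k))"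
      "ind (cl (x k)) B (cl (x i) \<union> cl (x j))"
      using assms(7) by (simp_all only: ind3_def)
    moreover have "l = i \<or> l = j \<or> l = k" using that by simp
    ultimately show ?thesis by (elim disjE) simp_all
  qed
  show "card {i, j, k} = 2 + 1" using assms(1,2) by simp
  show "x l \<in> X" if "l \<in> {i, j, k}" for l using that assms(4-6) by auto
qed (rule finite.intros assms(3))+

section \<open>Every edge is a standard simplex\<close>

text \<open>A vertex map is elementary on a small set and so extends to an automorphism by
  homogeneity. Through \<open>agree_on_cl\<close> the map is then controlled by its value on the
  single tuple \<open>e\<close>.\<close>

lemma edge_map:
  assumes f: "is_simplex M ind B p 1 f" and s: "supp f = {i, j}"
    and e: "e \<in> X" "cl e = obj f {k}" and k: "k \<in> {i, j}"
  obtains \<sigma> where "\<sigma> \<in> G" "mor f {k} {i, j} = restrict \<sigma> (cl e)"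
    "mor f {k} {i, j} \<circ> e = \<sigma> \<circ> e"
proof -
  note F = simplex_functor[OF f]
  have k': "{k} \<subseteq> {i, j}" "{i, j} \<subseteq> supp f" using k s by auto
  have "elementary_map M (obj f {k}) (mor f {k} {i, j})"
    "mor f {k} {i, j} \<in> extensional (obj f {k})"
    by (rule functor_elementary[OF F k'], rule functor_extensional[OF F k'])
  then have m: "elementary_map M (cl e) (mor f {k} {i, j})" "mor f {k} {i, j} \<in> extensional (cl e)"
    using e(2) by simp_all
  obtain \<sigma> where \<sigma>: "\<sigma> \<in> G" "\<And>x. x \<in> cl e \<Longrightarrow> \<sigma> x = mor f {k} {i, j} x"
    using elementary_map_extends[OF m(1) small_cl] by blast
  have "mor f {k} {i, j} = restrict \<sigma> (cl e)"
    by (rule extensionalityI[OF m(2)]) (auto simp: \<sigma>(2))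
  moreover have "mor f {k} {i, j} \<circ> e = \<sigma> \<circ> e"
  proof
    fix n
    have "e n \<in> cl e" using range_subset_cl by blast
    then show "(mor f {k} {i, j} \<circ> e) n = (\<sigma> \<circ> e) n" using \<sigma>(2) by simp
  qed
  ultimately show thesis using that \<sigma>(1) by blast
qed

lemma simplex_vertex_enumeration:
  assumes f: "is_simplex M ind B p n f" and i: "i \<in> supp f"
  obtains e where "e \<in> X" "cl e = obj f {i}"
proof -
  obtain b where "realizes M B p b" "obj f {i} = acl M (range b)"
    using simplex_vertex[OF f i] by blast
  then show thesis using that[of b] by (simp add: X_def cl_def)
qed

lemma edge_points:
  assumes f: "is_simplex M ind B p 1 f" and s: "supp f = {i, j}" "i \<noteq> j"
    and e: "e \<in> X" "cl e = obj f {i}" and e': "e' \<in> X" "cl e' = obj f {j}"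
  shows "mor f {i} {i, j} \<circ> e \<in> X" "mor f {j} {i, j} \<circ> e' \<in> X"
    "ind2 (mor f {i} {i, j} \<circ> e) (mor f {j} {i, j} \<circ> e')"
    "img f {i} {i, j} = cl (mor f {i} {i, j} \<circ> e)" "img f {j} {i, j} = cl (mor f {j} {i, j} \<circ> e')"
proof -
  obtain \<sigma> where \<sigma>: "\<sigma> \<in> G" "mor f {i} {i, j} = restrict \<sigma> (cl e)" "mor f {i} {i, j} \<circ> e = \<sigma> \<circ> e"
    by (rule edge_map[OF f s(1) e]) simp
  obtain \<tau> where \<tau>: "\<tau> \<in> G" "mor f {j} {i, j} = restrict \<tau> (cl e')" "mor f {j} {i, j} \<circ> e' = \<tau> \<circ> e'"
    by (rule edge_map[OF f s(1) e']) simp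
  show "mor f {i} {i, j} \<circ> e \<in> X" "mor f {j} {i, j} \<circ> e' \<in> X"
    unfolding \<sigma>(3) \<tau>(3) using \<sigma>(1) \<tau>(1) e(1) e'(1) by simp_all
  show i: "img f {i} {i, j} = cl (mor f {i} {i, j} \<circ> e)"
  proof -
    have "img f {i} {i, j} = \<sigma> ` cl e" by (simp add: img_def \<sigma>(2) e(2)[symmetric])
    then show ?thesis by (simp only: \<sigma>(3) cl_image[OF \<sigma>(1)])
  qed
  show j: "img f {j} {i, j} = cl (mor f {j} {i, j} \<circ> e')"
  proof -
    have "img f {j} {i, j} = \<tau> ` cl e'" by (simp add: img_def \<tau>(2) e'(2)[symmetric])
    then show ?thesis by (simp only: \<tau>(3) cl_image[OF \<tau>(1)])
  qed
  have "independent_family ind B {i, j} (\<lambda>k. img f {k} {i, j})"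
    by (rule simplex_independent[OF f]) (simp_all add: s(1))
  moreover have "{i, j} - {i} = {j}" using s(2) by auto
  ultimately have "ind (img f {i} {i, j}) B (img f {j} {i, j})"
    unfolding independent_family_def by simp
  then show "ind2 (mor f {i} {i, j} \<circ> e) (mor f {j} {i, j} \<circ> e')"
    unfolding ind2_def i j .
qed

text \<open>An edge is recovered from enumerations \<open>e\<close>, \<open>e'\<close> of its
  vertices and the images of these in its top object. Maps out of \<open>cl e\<close> are determined
  by their values on \<open>e\<close>, maps out of the base fix \<open>B\<close>, and the objects
  are closures of the images; hence any placements \<open>\<rho>\<close> that produce the right
  tuples reproduce the whole functor.\<close>

lemma edge_eq_std:
  assumes f: "is_simplex M ind B p 1 f" and s: "supp f = {i, j}" "i \<noteq> j"
    and e: "e \<in> X" "cl e = obj f {i}" and e': "e' \<in> X" "cl e' = obj f {j}"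
    and x: "x i \<in> X" "x j \<in> X" and \<rho>: "\<And>u. \<rho> u \<in> G"
    and v: "\<rho> {i} \<circ> x i = e" "\<rho> {j} \<circ> x j = e'"
    and m: "\<rho> {i, j} \<circ> x i = mor f {i} {i, j} \<circ> e" "\<rho> {i, j} \<circ> x j = mor f {j} {i, j} \<circ> e'"
  shows "f = std {i, j} x \<rho>"
proof -
  note F = simplex_functor[OF f] and obj_empty = simplex_empty[OF f]
  have transition: "mor f {k} {i, j} = restrict (\<rho> {i, j} \<circ> inv_map (\<rho> {k})) (cl e)"
    if k: "k \<in> {i, j}" "e \<in> X" "cl e = obj f {k}" "\<rho> {k} \<circ> x k = e"
      "\<rho> {i, j} \<circ> x k = mor f {k} {i, j} \<circ> e" for k e
  proof -
    obtain \<sigma> where \<sigma>: "\<sigma> \<in> G" "mor f {k} {i, j} = restrict \<sigma> (cl e)" "mor f {k} {i, j} \<circ> e = \<sigma> \<circ> e"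
      by (rule edge_map[OF f s(1) k(2,3,1)])
    have "(\<rho> {i, j} \<circ> inv_map (\<rho> {k})) \<circ> e = \<rho> {i, j} \<circ> x k"
      unfolding k(4)[symmetric] using \<rho> by (simp add: fun_eq_iff)
    then have "\<sigma> d = (\<rho> {i, j} \<circ> inv_map (\<rho> {k})) d" if "d \<in> cl e" for d
      using \<sigma>(3) k(5) that \<rho> by (intro agree_on_cl[OF \<sigma>(1) G_comp[OF \<rho> G_inv[OF \<rho>]] k(2)]) simp_all
    then show ?thesis unfolding \<sigma>(2) by (intro restrict_ext)
  qed
  have obj_vertex: "obj f {i} = \<rho> {i} ` clo x {i}" "obj f {j} = \<rho> {j} ` clo x {j}"
    unfolding clo_single cl_image[OF \<rho>] v e(2)[symmetric] e'(2)[symmetric] by (rule refl)+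
  have img: "img f {i} {i, j} = \<rho> {i, j} ` cl (x i)" "img f {j} {i, j} = \<rho> {i, j} ` cl (x j)"
    using edge_points(4,5)[OF f s e e'] by (simp_all only: cl_image[OF \<rho>] m)
  have "obj f {i, j} = acl M (\<Union>k\<in>{i, j}. img f {k} {i, j})"
    by (rule simplex_closure[OF f]) (simp_all add: s(1))
  also have "(\<Union>k\<in>{i, j}. img f {k} {i, j}) = \<rho> {i, j} ` (\<Union>k\<in>{i, j}. cl (x k))"
    using img by (simp add: image_Un)
  finally have obj_edge: "obj f {i, j} = \<rho> {i, j} ` clo x {i, j}"
    unfolding clo_def by (simp only: acl_image[OF \<rho>])
  have subsets: "u = {} \<or> u = {i} \<or> u = {j} \<or> u = {i, j}" if "u \<subseteq> {i, j}" for u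
    using that by blast
  have obj: "obj f u = obj (std {i, j} x \<rho>) u" for u
  proof (cases "u \<subseteq> {i, j}")
    case True
    have "obj f {} = \<rho> {} ` clo x {}" unfolding clo_empty G_image_B[OF \<rho>] by (rule obj_empty)
    then have "obj f u = \<rho> u ` clo x u" using subsets[OF True] obj_vertex obj_edge by metis
    then show ?thesis using True by simp
  next
    case False
    then show ?thesis using functor_undefined(1)[OF F, of u] s(1) by (simp add: std_def)
  qed
  have F': "is_functor M B (std {i, j} x \<rho>)" by (rule std_is_functor) (use \<rho> in simp_all)
  have mor: "mor f u v = mor (std {i, j} x \<rho>) u v" for u v
  proof (cases "u \<subseteq> v \<and> v \<subseteq> {i, j}")
    case True
    then have u: "u \<subseteq> {i, j}" by blast
    have uv: "u \<subseteq> v" "v \<subseteq> supp f" "v \<subseteq> supp (std {i, j} x \<rho>)" using True s(1) by simp_all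
    have ext: "mor f u v \<in> extensional (obj f u)" "mor (std {i, j} x \<rho>) u v \<in> extensional (obj f u)"
      using functor_extensional[OF F uv(1,2)] functor_extensional[OF F' uv(1,3)] by (simp_all only: obj)
    consider "u = {}" | "u = v" | "u = {i}" "v = {i, j}" | "u = {j}" "v = {i, j}"
      using True subsets[OF u] subsets[of v] by (metis subset_empty subset_singletonD insert_absorb2 subset_insertI)
    then show ?thesis
    proof cases
      case 1
      show ?thesis
      proof (rule extensionalityI[OF ext])
        fix b assume "b \<in> obj f u"
        then have "b \<in> B" using 1 obj_empty by simp
        then show "mor f u v b = mor (std {i, j} x \<rho>) u v b"
          using functor_fixes[OF F uv(1,2)] functor_fixes[OF F' uv(1,3)] by simp
      qed
    next
      case 2
      show ?thesis
      proof (rule extensionalityI[OF ext])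
        fix b assume b: "b \<in> obj f u"
        then have b': "b \<in> obj (std {i, j} x \<rho>) u" by (simp only: obj)
        have "mor f u u b = b" using functor_id[OF F _ b] u s(1) by simp
        moreover have "mor (std {i, j} x \<rho>) u u b = b"
          by (rule functor_id[OF F' _ b']) (use u in \<open>simp only: std_simps(1)\<close>)
        ultimately show "mor f u v b = mor (std {i, j} x \<rho>) u v b" by (simp only: 2)
      qed
    next
      case 3
      have "mor f {i} {i, j} = restrict (\<rho> {i, j} \<circ> inv_map (\<rho> {i})) (\<rho> {i} ` clo x {i})"
        unfolding obj_vertex(1)[symmetric] e(2)[symmetric]
        by (rule transition) (use e v m in simp_all)
      then show ?thesis unfolding 3 by simp
    next
      case 4
      have "mor f {j} {i, j} = restrict (\<rho> {i, j} \<circ> inv_map (\<rho> {j})) (\<rho> {j} ` clo x {j})"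
        unfolding obj_vertex(2)[symmetric] e'(2)[symmetric]
        by (rule transition) (use e' v m in simp_all)
      then show ?thesis unfolding 4 by simp
    qed
  next
    case False
    then show ?thesis using functor_undefined(2)[OF F, of u v] s(1) by (auto simp: std_def)
  qed
  show ?thesis
    by (rule psimplex.equality) (use s obj mor in \<open>auto simp: fun_eq_iff\<close>)
qed

end

section \<open>Chains, boundaries and the classes of edges\<close>

section \<open>Boundaries\<close>

lemma boundary_diff: "boundary n (c - d) = boundary n c - boundary n d"
  by (simp add: boundary_def frag_extend_diff)

lemma boundary_add: "boundary n (c + d) = boundary n c + boundary n d"
  by (simp add: boundary_def frag_extend_add)

lemma boundary_0 [simp]: "boundary n 0 = 0"
  by (simp add: boundary_def)

lemma boundary_edge: "boundary 1 (frag_of f) = frag_of (face 0 f) - frag_of (face 1 f)"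
  by (simp add: boundary_def)

lemma boundary_triangle:
  "boundary 2 (frag_of f) = frag_of (face 0 f) - frag_of (face 1 f) + frag_of (face 2 f)"
  by (simp add: boundary_def numeral_2_eq_2)

context homology_setting
begin

abbreviation simplices :: "nat \<Rightarrow> 'm psimplex set" where
  "simplices n \<equiv> {f. is_simplex M ind B p n f}"

lemma edge_cases:
  assumes "f \<in> simplices 1"
  obtains i j where "supp f = {i, j}" "i < j"
  using edge_supp[of "supp f"] simplex_card[of M ind B p 1 f] assms by auto

lemma triangle_cases:
  assumes "f \<in> simplices 2"
  obtains i j k where "supp f = {i, j, k}" "i < j" "j < k"
  using triangle_supp[of "supp f"] simplex_card[of M ind B p 2 f] simplex_finite[of M ind B p 2 f] assms
  by auto

lemma restr_simplices: "f \<in> simplices n \<Longrightarrow> t \<subseteq> supp f \<Longrightarrow> card t = m + 1 \<Longrightarrow> restr t f \<in> simplices m"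
  using restr_is_simplex by blast

lemma triangle_faces:
  assumes "f \<in> simplices 2"
  shows "face 0 f \<in> simplices 1" "face 1 f \<in> simplices 1" "face 2 f \<in> simplices 1"
proof -
  obtain i j k where s: "supp f = {i, j, k}" "i < j" "j < k" by (rule triangle_cases[OF assms])
  have "restr {j, k} f \<in> simplices 1"
    by (rule restr_simplices[OF assms]) (use s in simp_all)
  moreover have "restr {i, k} f \<in> simplices 1"
    by (rule restr_simplices[OF assms]) (use s in simp_all)
  moreover have "restr {i, j} f \<in> simplices 1"
    by (rule restr_simplices[OF assms]) (use s in simp_all)
  ultimately show "face 0 f \<in> simplices 1" "face 1 f \<in> simplices 1" "face 2 f \<in> simplices 1"
    by (simp_all only: face_triangle[OF s])
qed

lemma boundary_boundary_triangle:
  assumes "f \<in> simplices 2"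
  shows "boundary 1 (boundary 2 (frag_of f)) = 0"
proof -
  obtain i j k where s: "supp f = {i, j, k}" "i < j" "j < k" by (rule triangle_cases[OF assms])
  have "i < k" using s by simp
  have "boundary 1 (frag_of (restr {a, b} f)) = frag_of (restr {b} f) - frag_of (restr {a} f)"
    if "a < b" for a b
    using face_edge[of "restr {a, b} f", OF supp_restr that]
    by (simp only: boundary_edge) (simp add: restr_restr)
  from this[OF s(2)] this[OF s(3)] this[OF \<open>i < k\<close>] show ?thesis
    by (simp only: boundary_triangle face_triangle[OF s] boundary_add boundary_diff) simp
qed

definition Bd :: "('m psimplex \<Rightarrow>\<^sub>0 int) set" where
  "Bd = boundaries M ind B p 1"

lemma Bd_alt: "Bd = boundary 2 ` {c. Poly_Mapping.keys c \<subseteq> simplices 2}"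
proof -
  have "carrier (chains M ind B p 2) = {c. Poly_Mapping.keys c \<subseteq> simplices 2}"
    by (auto simp: chains_def)
  then show ?thesis by (simp only: Bd_def boundaries_def one_add_one)
qed

lemma Bd_diff:
  assumes "c \<in> Bd" "d \<in> Bd"
  shows "c - d \<in> Bd"
proof -
  obtain c' d' where *: "c = boundary 2 c'" "Poly_Mapping.keys c' \<subseteq> simplices 2"
    "d = boundary 2 d'" "Poly_Mapping.keys d' \<subseteq> simplices 2"
    using assms unfolding Bd_alt by blast
  have "c - d = boundary 2 (c' - d')" by (simp only: * boundary_diff)
  moreover have "Poly_Mapping.keys (c' - d') \<subseteq> simplices 2"
    using keys_diff[of c' d'] *(2,4) by blast
  ultimately show ?thesis unfolding Bd_alt by blast
qed

lemma Bd_0: "0 \<in> Bd"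
  unfolding Bd_alt by (rule image_eqI[of _ _ 0]) simp_all

lemma Bd_minus: "c \<in> Bd \<Longrightarrow> - c \<in> Bd"
  using Bd_diff[OF Bd_0] by simp

lemma Bd_add: "c \<in> Bd \<Longrightarrow> d \<in> Bd \<Longrightarrow> c + d \<in> Bd"
  using Bd_diff[OF _ Bd_minus, of c d] by simp

lemma Bd_triangle:
  assumes "f \<in> simplices 2"
  shows "frag_of (face 0 f) - frag_of (face 1 f) + frag_of (face 2 f) \<in> Bd"
  unfolding Bd_alt
  by (rule image_eqI[of _ _ "frag_of f"]) (use assms in \<open>simp_all add: boundary_triangle\<close>)

lemma Bd_cycle:
  assumes "c \<in> Bd"
  shows "Poly_Mapping.keys c \<subseteq> simplices 1" "boundary 1 c = 0"
proof -
  obtain d where d: "c = boundary 2 d" "Poly_Mapping.keys d \<subseteq> simplices 2"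
    using assms unfolding Bd_alt by blast
  have "Poly_Mapping.keys (boundary 2 d) \<subseteq> simplices 1 \<and> boundary 1 (boundary 2 d) = 0"
    using d(2)
  proof (induction d rule: frag_induction)
    case (one f)
    have "Poly_Mapping.keys (boundary 2 (frag_of f)) \<subseteq>
        Poly_Mapping.keys (frag_of (face 0 f) - frag_of (face 1 f)) \<union> Poly_Mapping.keys (frag_of (face 2 f))"
      unfolding boundary_triangle by (rule Poly_Mapping.keys_add)
    also have "\<dots> \<subseteq> Poly_Mapping.keys (frag_of (face 0 f)) \<union> Poly_Mapping.keys (frag_of (face 1 f)) \<union>
        Poly_Mapping.keys (frag_of (face 2 f))"
      by (intro Un_mono keys_diff order_refl)
    also have "\<dots> \<subseteq> simplices 1" using triangle_faces[OF one] by simp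
    finally show ?case using boundary_boundary_triangle[OF one] by simp
  next
    case (diff a b)
    then show ?case using keys_diff[of "boundary 2 a" "boundary 2 b"] by (auto simp: boundary_diff)
  qed simp
  then show "Poly_Mapping.keys c \<subseteq> simplices 1" "boundary 1 c = 0" using d(1) by simp_all
qed

definition homologous :: "('m psimplex \<Rightarrow>\<^sub>0 int) \<Rightarrow> ('m psimplex \<Rightarrow>\<^sub>0 int) \<Rightarrow> bool" (infix \<open>\<simeq>\<close> 50) where
  "c \<simeq> d \<longleftrightarrow> c - d \<in> Bd"

lemma homologous_refl [simp]: "c \<simeq> c"
  by (simp add: homologous_def Bd_0)

lemma homologous_sym: "c \<simeq> d \<Longrightarrow> d \<simeq> c"
  using Bd_minus[of "c - d"] by (simp add: homologous_def)

lemma homologous_add: "c \<simeq> d \<Longrightarrow> c' \<simeq> d' \<Longrightarrow> c + c' \<simeq> d + d'"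
  using Bd_add[of "c - d" "c' - d'"] by (simp add: homologous_def algebra_simps)

lemma homologous_diff: "c \<simeq> d \<Longrightarrow> c' \<simeq> d' \<Longrightarrow> c - c' \<simeq> d - d'"
  using Bd_diff[of "c - d" "c' - d'"] by (simp add: homologous_def algebra_simps)

lemma homologous_minus: "c \<simeq> d \<Longrightarrow> - c \<simeq> - d"
  using homologous_diff[of 0 0 c d] by simp

lemma homologous_trans [trans]: "c \<simeq> d \<Longrightarrow> d \<simeq> e \<Longrightarrow> c \<simeq> e"
  using Bd_add[of "c - d" "d - e"] by (simp add: homologous_def)

section \<open>Classes of edges\<close>

text \<open>Any automorphism taking \<open>a\<close> to \<open>b\<close> would serve: by
  \<open>std_edge_eq\<close> an edge depends on its placements only through the tuples they
  produce.\<close>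

definition mover :: "('i \<Rightarrow> 'm) \<Rightarrow> ('i \<Rightarrow> 'm) \<Rightarrow> 'm \<Rightarrow> 'm" where
  "mover a b = (SOME \<sigma>. \<sigma> \<in> G \<and> \<sigma> \<circ> a = b)"

lemma mover:
  assumes "a \<in> X" "b \<in> X"
  shows "mover a b \<in> G" "mover a b \<circ> a = b"
proof -
  have "\<exists>\<sigma>. \<sigma> \<in> G \<and> \<sigma> \<circ> a = b" using X_conjugate[OF assms] by blast
  then have "mover a b \<in> G \<and> mover a b \<circ> a = b" unfolding mover_def by (rule someI_ex)
  then show "mover a b \<in> G" "mover a b \<circ> a = b" by simp_all
qed

lemma std_transition:
  assumes "k \<in> u" "u \<subseteq> s" "\<And>u. \<rho> u \<in> G"
  shows "mor (std s x \<rho>) {k} u \<circ> (\<rho> {k} \<circ> x k) = \<rho> u \<circ> x k"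
proof
  fix n
  have "{k} \<subseteq> u" using assms(1) by simp
  moreover have "x k n \<in> clo x {k}" unfolding clo_single using range_subset_cl by blast
  ultimately show "(mor (std s x \<rho>) {k} u \<circ> (\<rho> {k} \<circ> x k)) n = (\<rho> u \<circ> x k) n"
    using assms(2,3) by simp
qed

lemma std_edge_eq:
  assumes ij: "i \<noteq> j" and x: "x i \<in> X" "x j \<in> X" "x' i \<in> X" "x' j \<in> X" "ind2 (x i) (x j)"
    and \<rho>: "\<And>u. \<rho> u \<in> G" "\<And>u. \<rho>' u \<in> G"
    and v: "\<rho> {i} \<circ> x i = \<rho>' {i} \<circ> x' i" "\<rho> {j} \<circ> x j = \<rho>' {j} \<circ> x' j"
    and m: "\<rho> {i, j} \<circ> x i = \<rho>' {i, j} \<circ> x' i" "\<rho> {i, j} \<circ> x j = \<rho>' {i, j} \<circ> x' j"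
  shows "std {i, j} x \<rho> = std {i, j} x' \<rho>'"
proof (rule edge_eq_std)
  show "is_simplex M ind B p 1 (std {i, j} x \<rho>)"
    by (rule std_edge_is_simplex[OF ij \<rho>(1) x(1,2,5)])
  show "\<rho> {i} \<circ> x i \<in> X" "\<rho> {j} \<circ> x j \<in> X" using \<rho>(1) x by simp_all
  show "cl (\<rho> {i} \<circ> x i) = obj (std {i, j} x \<rho>) {i}" "cl (\<rho> {j} \<circ> x j) = obj (std {i, j} x \<rho>) {j}"
    using cl_image[OF \<rho>(1)] by (simp_all add: clo_single)
  show "\<rho>' {i, j} \<circ> x' i = mor (std {i, j} x \<rho>) {i} {i, j} \<circ> (\<rho> {i} \<circ> x i)"
    using std_transition[of i "{i, j}" "{i, j}" \<rho> x] \<rho>(1) m(1) by simp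
  show "\<rho>' {i, j} \<circ> x' j = mor (std {i, j} x \<rho>) {j} {i, j} \<circ> (\<rho> {j} \<circ> x j)"
    using std_transition[of j "{i, j}" "{i, j}" \<rho> x] \<rho>(1) m(2) by simp
qed (use ij x \<rho> v in simp_all)

lemma Bd_std:
  assumes "i < j" "j < k" "\<And>u. \<rho> u \<in> G" "x i \<in> X" "x j \<in> X" "x k \<in> X" "ind3 (x i) (x j) (x k)"
  shows "frag_of (std {j, k} x \<rho>) - frag_of (std {i, k} x \<rho>) + frag_of (std {i, j} x \<rho>) \<in> Bd"
proof -
  have "std {i, j, k} x \<rho> \<in> simplices 2"
    using std_triangle_is_simplex[OF assms] by simp
  from Bd_triangle[OF this] show ?thesis
    unfolding face_triangle[OF std_simps(1) assms(1,2)]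
    using restr_std[of "{j, k}" "{i, j, k}" x \<rho>] restr_std[of "{i, k}" "{i, j, k}" x \<rho>]
      restr_std[of "{i, j}" "{i, j, k}" x \<rho>] by simp
qed

text \<open>Two edges that differ only in the embedding of their top object are completed to triangles with
  the same two remaining faces.\<close>

lemma std_edge_homologous:
  assumes ij: "i < j" and x: "x i \<in> X" "x j \<in> X" "ind2 (x i) (x j)"
    and \<rho>: "\<And>u. \<rho> u \<in> G" "\<And>u. \<rho>' u \<in> G"
    and v: "\<rho> {i} \<circ> x i = \<rho>' {i} \<circ> x i" "\<rho> {j} \<circ> x j = \<rho>' {j} \<circ> x j"
  shows "frag_of (std {i, j} x \<rho>) \<simeq> frag_of (std {i, j} x \<rho>')"
proof -
  obtain z where z: "z \<in> X" "ind (cl z) B (\<Union>(cl ` {x i, x j}))"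
    using ind_exists_finite[of "{x i, x j}"] x by auto
  \<comment> \<open>The auxiliary vertex comes after \<open>j\<close>, so that the three vertices
    are in increasing order as \<open>Bd_std\<close> requires.\<close>
  define k where "k = Suc j"
  define x' where "x' = x(k := z)"
  have k: "j < k" "i \<noteq> k" "j \<noteq> k" "i \<noteq> j" using ij by (simp_all add: k_def)
  have x': "x' i = x i" "x' j = x j" "x' k = z" using k by (simp_all add: x'_def)
  have ind3: "ind3 (x' i) (x' j) (x' k)"
    unfolding x' by (rule ind3I) (use x(3) z(2) in simp_all)
  \<comment> \<open>\<open>\<rho>2\<close> differs from \<open>\<rho>\<close> at the top object of
    the edge alone. The two triangles thus share their faces on \<open>{i, k}\<close> and
    \<open>{j, k}\<close>, which cancel when their boundaries are subtracted.\<close>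
  define \<rho>2 where "\<rho>2 = \<rho>({i, j} := \<rho>' {i, j})"
  have \<rho>2: "\<rho>2 u \<in> G" for u using \<rho> by (simp add: \<rho>2_def)
  have ne: "{i} \<noteq> {i, j}" "{j} \<noteq> {i, j}" using k(4) by auto
  have "std {i, j} x \<rho>' = std {i, j} x \<rho>2"
    by (rule std_edge_eq[OF k(4) x(1,2,1,2,3) \<rho>(2) \<rho>2]) (use v ne in \<open>simp_all add: \<rho>2_def\<close>)
  also have "\<dots> = std {i, j} x' \<rho>2" by (rule std_cong) (use x' in auto)
  finally have 2: "std {i, j} x \<rho>' = std {i, j} x' \<rho>2" .
  have 1: "std {i, j} x \<rho> = std {i, j} x' \<rho>" by (rule std_cong) (use x' in auto)
  have same: "std {l, k} x' \<rho>2 = std {l, k} x' \<rho>" if "l = i \<or> l = j" for l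
  proof (rule std_cong)
    fix u assume "u \<subseteq> {l, k}"
    then have "u \<noteq> {i, j}" using k that by auto
    then show "\<rho>2 u = \<rho> u" by (simp add: \<rho>2_def)
  qed simp
  have "frag_of (std {j, k} x' \<rho>) - frag_of (std {i, k} x' \<rho>) + frag_of (std {i, j} x' \<rho>) \<in> Bd"
    by (rule Bd_std[OF ij k(1) \<rho>(1) _ _ _ ind3]) (simp_all only: x' x z)
  moreover have "frag_of (std {j, k} x' \<rho>2) - frag_of (std {i, k} x' \<rho>2) + frag_of (std {i, j} x' \<rho>2) \<in> Bd"
    by (rule Bd_std[OF ij k(1) \<rho>2 _ _ _ ind3]) (simp_all only: x' x z)
  ultimately have "(frag_of (std {j, k} x' \<rho>) - frag_of (std {i, k} x' \<rho>) + frag_of (std {i, j} x' \<rho>)) -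
      (frag_of (std {j, k} x' \<rho>2) - frag_of (std {i, k} x' \<rho>2) + frag_of (std {i, j} x' \<rho>2)) \<in> Bd"
    by (rule Bd_diff)
  then show ?thesis unfolding homologous_def 1 2 by (simp add: same)
qed

text \<open>The points \<open>x\<close> and \<open>y\<close> sit in the top object exactly as they
  do in the monster, since the placement there is \<open>id\<close>; the vertices are
  \<open>cl e\<close> and \<open>cl e'\<close>, and the vertex maps take \<open>e\<close> to
  \<open>x\<close> and \<open>e'\<close> to \<open>y\<close>.\<close>

definition edge :: "nat \<Rightarrow> nat \<Rightarrow> ('i \<Rightarrow> 'm) \<Rightarrow> ('i \<Rightarrow> 'm) \<Rightarrow> ('i \<Rightarrow> 'm) \<Rightarrow> ('i \<Rightarrow> 'm) \<Rightarrow> 'm psimplex" where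
  "edge i j x y e e' = std {i, j} (\<lambda>n. if n = i then x else y)
     (\<lambda>u. if u = {i} then mover x e else if u = {j} then mover y e' else id)"

lemma edge_props:
  assumes "i \<noteq> j" "x \<in> X" "y \<in> X" "e \<in> X" "e' \<in> X" "ind2 x y"
  shows "edge i j x y e e' \<in> simplices 1" "supp (edge i j x y e e') = {i, j}"
    "obj (edge i j x y e e') {i} = cl e" "obj (edge i j x y e e') {j} = cl e'"
    "mor (edge i j x y e e') {i} {i, j} \<circ> e = x" "mor (edge i j x y e e') {j} {i, j} \<circ> e' = y"
proof -
  let ?x = "\<lambda>n. if n = i then x else y"
  let ?\<rho> = "\<lambda>u. if u = {i} then mover x e else if u = {j} then mover y e' else id"
  have \<rho>: "?\<rho> u \<in> G" for u using mover assms G_id by simp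
  have ne: "{i, j} \<noteq> {i}" "{i, j} \<noteq> {j}" "{j} \<noteq> {i}" using assms(1) by auto
  have v: "?\<rho> {i} \<circ> ?x i = e" "?\<rho> {j} \<circ> ?x j = e'" using assms mover by simp_all
  show "edge i j x y e e' \<in> simplices 1"
    using std_edge_is_simplex[of i j ?\<rho> ?x, OF assms(1) \<rho>] assms by (simp add: edge_def)
  show "supp (edge i j x y e e') = {i, j}" by (simp add: edge_def)
  show "obj (edge i j x y e e') {i} = cl e"
    unfolding edge_def using cl_image[OF \<rho>, of "{i}" "?x i"] v(1) by (simp add: clo_single)
  show "obj (edge i j x y e e') {j} = cl e'"
    unfolding edge_def using cl_image[OF \<rho>, of "{j}" "?x j"] v(2) ne by (simp add: clo_single)
  show "mor (edge i j x y e e') {i} {i, j} \<circ> e = x"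
    using std_transition[of i "{i, j}" "{i, j}" ?\<rho> ?x, OF _ _ \<rho>] ne unfolding v edge_def by simp
  show "mor (edge i j x y e e') {j} {i, j} \<circ> e' = y"
    using std_transition[of j "{i, j}" "{i, j}" ?\<rho> ?x, OF _ _ \<rho>] ne assms(1) unfolding v edge_def by simp
qed

lemma std_homologous_edge:
  assumes "i < j" "x i \<in> X" "x j \<in> X" "ind2 (x i) (x j)" "\<And>u. \<rho> u \<in> G"
    and "\<rho> {i} \<circ> x i = e" "\<rho> {j} \<circ> x j = e'"
  shows "frag_of (std {i, j} x \<rho>) \<simeq> frag_of (edge i j (x i) (x j) e e')"
proof -
  have e: "e \<in> X" "e' \<in> X" unfolding assms(6,7)[symmetric] using assms(2,3,5) by simp_all
  let ?\<rho> = "\<lambda>u. if u = {i} then mover (x i) e else if u = {j} then mover (x j) e' else id"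
  have \<rho>: "?\<rho> u \<in> G" for u using mover assms e G_id by simp
  have "edge i j (x i) (x j) e e' = std {i, j} x ?\<rho>"
    unfolding edge_def by (rule std_cong) auto
  moreover have "frag_of (std {i, j} x \<rho>) \<simeq> frag_of (std {i, j} x ?\<rho>)"
  proof (rule std_edge_homologous[OF assms(1-5) \<rho>])
    show "\<rho> {i} \<circ> x i = ?\<rho> {i} \<circ> x i" using mover(2)[OF assms(2) e(1)] assms(6) by simp
    show "\<rho> {j} \<circ> x j = ?\<rho> {j} \<circ> x j" using mover(2)[OF assms(3) e(2)] assms(1,7) by simp
  qed
  ultimately show ?thesis by simp
qed

text \<open>Moving both points by \<open>\<tau>\<close> while keeping the vertices amounts to
  another placement of the top object, and that costs a boundary only.\<close>

lemma edge_invariant: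
  assumes "i < j" "x \<in> X" "y \<in> X" "e \<in> X" "e' \<in> X" "ind2 x y" "\<tau> \<in> G"
  shows "frag_of (edge i j (\<tau> \<circ> x) (\<tau> \<circ> y) e e') \<simeq> frag_of (edge i j x y e e')"
proof -
  let ?x = "\<lambda>n. if n = i then x else y" and ?x' = "\<lambda>n. if n = i then \<tau> \<circ> x else \<tau> \<circ> y"
  let ?\<rho> = "\<lambda>u. if u = {i} then mover (\<tau> \<circ> x) e else if u = {j} then mover (\<tau> \<circ> y) e' else id"
  have \<tau>X: "\<tau> \<circ> x \<in> X" "\<tau> \<circ> y \<in> X" using assms by simp_all
  have \<rho>: "?\<rho> u \<in> G" for u using mover assms \<tau>X G_id by simp
  have \<rho>': "?\<rho> u \<circ> \<tau> \<in> G" for u by (rule G_comp[OF \<rho> assms(7)])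
  have "edge i j (\<tau> \<circ> x) (\<tau> \<circ> y) e e' = std {i, j} ?x (\<lambda>u. ?\<rho> u \<circ> \<tau>)"
    unfolding edge_def
    by (rule std_edge_eq[OF _ _ _ _ _ _ \<rho> \<rho>'])
      (use assms \<tau>X ind2_invariant in \<open>simp_all add: comp_assoc\<close>)
  moreover have "frag_of (std {i, j} ?x (\<lambda>u. ?\<rho> u \<circ> \<tau>)) \<simeq> frag_of (edge i j (?x i) (?x j) e e')"
    by (rule std_homologous_edge[OF _ _ _ _ \<rho>'])
      (use assms mover[OF \<tau>X(1) assms(4)] mover[OF \<tau>X(2) assms(5)] in \<open>simp_all add: comp_assoc\<close>)
  ultimately show ?thesis using assms(1) by simp
qed

text \<open>The triangle spanned by the three points has the right vertices by the choice of its
  placements; each of its faces is a standard edge and thus homologous to the corresponding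
  \<open>edge\<close>.\<close>

lemma edge_cocycle:
  assumes "i < j" "j < k" and X: "x \<in> X" "y \<in> X" "z \<in> X" "e \<in> X" "e' \<in> X" "e'' \<in> X" and "ind3 x y z"
  shows "frag_of (edge i j x y e e') + frag_of (edge j k y z e' e'') \<simeq> frag_of (edge i k x z e e'')"
proof -
  let ?x = "\<lambda>n. if n = i then x else if n = j then y else z"
  let ?\<rho> = "\<lambda>u. if u = {i} then mover x e else if u = {j} then mover y e' else if u = {k} then mover z e'' else id"
  have \<rho>: "?\<rho> u \<in> G" for u using mover X G_id by simp
  have ne: "i \<noteq> j" "i \<noteq> k" "j \<noteq> k" "i < k" using assms(1,2) by simp_all
  have xs: "?x i = x" "?x j = y" "?x k = z" using ne by simp_all
  have \<rho>x: "?\<rho> {i} \<circ> ?x i = e" "?\<rho> {j} \<circ> ?x j = e'" "?\<rho> {k} \<circ> ?x k = e''"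
    using mover[OF X(1,4)] mover[OF X(2,5)] mover[OF X(3,6)] ne by simp_all
  have ind: "ind2 x y" "ind2 y z" "ind2 x z"
    using ind3_ind2 ind3_perm assms(9) by blast+
  have "frag_of (std {j, k} ?x ?\<rho>) - frag_of (std {i, k} ?x ?\<rho>) + frag_of (std {i, j} ?x ?\<rho>) \<in> Bd"
    by (rule Bd_std[OF assms(1,2) \<rho>]) (simp_all only: xs X assms(9))
  then have "frag_of (std {i, j} ?x ?\<rho>) + frag_of (std {j, k} ?x ?\<rho>) \<simeq> frag_of (std {i, k} ?x ?\<rho>)"
    by (simp add: homologous_def algebra_simps)
  moreover have "frag_of (std {i, j} ?x ?\<rho>) \<simeq> frag_of (edge i j (?x i) (?x j) e e')"
    by (rule std_homologous_edge[OF assms(1) _ _ _ \<rho> \<rho>x(1,2)]) (simp_all only: xs X ind)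
  moreover have "frag_of (std {j, k} ?x ?\<rho>) \<simeq> frag_of (edge j k (?x j) (?x k) e' e'')"
    by (rule std_homologous_edge[OF assms(2) _ _ _ \<rho> \<rho>x(2,3)]) (simp_all only: xs X ind)
  moreover have "frag_of (std {i, k} ?x ?\<rho>) \<simeq> frag_of (edge i k (?x i) (?x k) e e'')"
    by (rule std_homologous_edge[OF ne(4) _ _ _ \<rho> \<rho>x(1,3)]) (simp_all only: xs X ind)
  ultimately show ?thesis
    unfolding xs using homologous_add homologous_sym homologous_trans by meson
qed

text \<open>The sign convention frees the later identities from any assumption on the order of the
  vertices.\<close>

definition W :: "nat \<Rightarrow> nat \<Rightarrow> ('i \<Rightarrow> 'm) \<Rightarrow> ('i \<Rightarrow> 'm) \<Rightarrow> ('i \<Rightarrow> 'm) \<Rightarrow> ('i \<Rightarrow> 'm) \<Rightarrow> 'm psimplex \<Rightarrow>\<^sub>0 int" where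
  "W i j x y e e' = (if i < j then frag_of (edge i j x y e e') else - frag_of (edge j i y x e' e))"

lemma W_swap: "i \<noteq> j \<Longrightarrow> W j i y x e' e = - W i j x y e e'"
  by (simp add: W_def)

lemma W_invariant:
  assumes "i \<noteq> j" "x \<in> X" "y \<in> X" "e \<in> X" "e' \<in> X" "ind2 x y" "\<tau> \<in> G"
  shows "W i j (\<tau> \<circ> x) (\<tau> \<circ> y) e e' \<simeq> W i j x y e e'"
proof (cases "i < j")
  case True
  then show ?thesis using edge_invariant[OF True assms(2-7)] by (simp add: W_def)
next
  case False
  then have "j < i" using assms(1) by simp
  from edge_invariant[OF this assms(3,2,5,4) ind2_sym[OF assms(6)] assms(7)] show ?thesis
    using False by (simp add: W_def homologous_minus)
qed

text \<open>The relation \<open>C\<close> is preserved by exchanging the first two or the last two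
  vertices, because its defining chain then only changes sign. These exchanges generate all six
  orders, so the sorted case suffices.\<close>

lemma W_cocycle:
  assumes "i \<noteq> j" "j \<noteq> k" "i \<noteq> k"
    and "x \<in> X" "y \<in> X" "z \<in> X" "e \<in> X" "e' \<in> X" "e'' \<in> X" "ind3 x y z"
  shows "W i j x y e e' + W j k y z e' e'' \<simeq> W i k x z e e''"
proof -
  define C where "C i j k x y z e e' e'' \<longleftrightarrow> W i j x y e e' + W j k y z e' e'' - W i k x z e e'' \<in> Bd"
    for i j k x y z e e' e''
  have sorted: "C i j k x y z e e' e''" if "i < j" "j < k"
    "x \<in> X" "y \<in> X" "z \<in> X" "e \<in> X" "e' \<in> X" "e'' \<in> X" "ind3 x y z" for i j k x y z e e' e''
    using edge_cocycle[OF that] that(1,2) by (simp add: C_def W_def homologous_def)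
  have left: "C i j k x y z e e' e''" if "C j i k y x z e' e e''" "i \<noteq> j" for i j k x y z e e' e''
  proof -
    have "W i j x y e e' + W j k y z e' e'' - W i k x z e e'' =
        - (W j i y x e' e + W i k x z e e'' - W j k y z e' e'')"
      using W_swap[OF that(2), of y x e' e] by simp
    then show ?thesis using Bd_minus that(1) unfolding C_def by metis
  qed
  have right: "C i j k x y z e e' e''" if "C i k j x z y e e'' e'" "j \<noteq> k" for i j k x y z e e' e''
  proof -
    have "W i j x y e e' + W j k y z e' e'' - W i k x z e e'' =
        - (W i k x z e e'' + W k j z y e'' e' - W i j x y e e')"
      using W_swap[OF that(2), of z y e'' e'] by simp
    then show ?thesis using Bd_minus that(1) unfolding C_def by metis
  qed
  note ind = assms(10) ind3_perm[OF assms(10)] ind3_perm[OF ind3_perm(1)[OF assms(10)]]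
    ind3_perm[OF ind3_perm(2)[OF assms(10)]] ind3_perm[OF ind3_perm(1)[OF ind3_perm(2)[OF assms(10)]]]
  consider "i < j" "j < k" | "j < i" "i < k" | "i < k" "k < j" | "j < k" "k < i" | "k < i" "i < j"
    | "k < j" "j < i"
    using assms(1-3) by linarith
  then have "C i j k x y z e e' e''"
  proof cases
    case 1
    then show ?thesis using assms by (intro sorted)
  next
    case 2
    then show ?thesis using assms ind by (intro left[OF sorted])
  next
    case 3
    then show ?thesis using assms ind by (intro right[OF sorted])
  next
    case 4
    then show ?thesis using assms ind by (intro left[OF right[OF sorted]]) simp_all
  next
    case 5
    then show ?thesis using assms ind by (intro right[OF left[OF sorted]]) simp_all
  next
    case 6
    then show ?thesis using assms ind by (intro left[OF right[OF left[OF sorted]]]) simp_all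
  qed
  then show ?thesis by (simp add: C_def homologous_def)
qed

section \<open>The difference class of two realizations, and the classes of shells\<close>

section \<open>The difference class of two realizations\<close>

text \<open>The source of all triangles: one point independent from all of \<open>Y\<close> jointly
  completes every independent pair from \<open>Y\<close> to an independent triple. It is listed in
  the middle because cocycles will be split at it.\<close>

lemma indep_element:
  assumes "finite Y" "Y \<subseteq> X"
  shows "\<exists>u. u \<in> X \<and> (\<forall>x\<in>Y. ind2 x u) \<and> (\<forall>x\<in>Y. \<forall>y\<in>Y. ind2 x y \<longrightarrow> ind3 x u y)"
proof -
  obtain u where u: "u \<in> X" "ind (cl u) B (\<Union>(cl ` Y))" using ind_exists_finite[OF assms] .
  have "ind2 x u" if "x \<in> Y" for x
    by (rule ind2_sym) (use ind_cl_mono[OF u(2) assms(1), of "cl x"] that in \<open>auto simp: ind2_def\<close>)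
  moreover have "ind3 x u y" if "x \<in> Y" "y \<in> Y" "ind2 x y" for x y
  proof -
    have "ind (cl u) B (cl x \<union> cl y)" by (rule ind_cl_mono[OF u(2) assms(1)]) (use that in auto)
    then have "ind3 x y u" using that(3) by (intro ind3I)
    then show ?thesis by (rule ind3_perm)
  qed
  ultimately show ?thesis using u(1) by blast
qed

lemma fresh_nat:
  assumes "finite (N :: nat set)"
  obtains j where "j \<notin> N"
  using assms ex_new_if_finite infinite_UNIV_nat by blast

text \<open>Vertex \<open>i\<close>, enumerated by \<open>e\<close>, carries the two points to be
  compared, and vertex \<open>k\<close>, enumerated by \<open>e'\<close>, carries the common apex
  \<open>z\<close>.\<close>

definition dif :: "nat \<Rightarrow> nat \<Rightarrow> ('i \<Rightarrow> 'm) \<Rightarrow> ('i \<Rightarrow> 'm) \<Rightarrow> ('i \<Rightarrow> 'm) \<Rightarrow> ('i \<Rightarrow> 'm) \<Rightarrow> ('i \<Rightarrow> 'm) \<Rightarrow>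
    'm psimplex \<Rightarrow>\<^sub>0 int" where
  "dif i k x y z e e' = W i k x z e e' - W i k y z e e'"

text \<open>Both edges are split at the new apex \<open>u\<close>. Their second halves are the same
  edge from \<open>u\<close> to \<open>z\<close> and cancel.\<close>

lemma dif_change_apex:
  assumes "i \<noteq> j" "i \<noteq> k" "j \<noteq> k" "x \<in> X" "y \<in> X" "z \<in> X" "u \<in> X" "e \<in> X" "e' \<in> X" "e'' \<in> X"
    and "ind3 x u z" "ind3 y u z"
  shows "dif i k x y z e e' \<simeq> dif i j x y u e e''"
proof -
  have "W i j x u e e'' + W j k u z e'' e' \<simeq> W i k x z e e'"
    by (rule W_cocycle) (use assms in simp_all)
  moreover have "W i j y u e e'' + W j k u z e'' e' \<simeq> W i k y z e e'"
    by (rule W_cocycle) (use assms in simp_all)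
  ultimately have "(W i j x u e e'' + W j k u z e'' e') - (W i j y u e e'' + W j k u z e'' e') \<simeq> dif i k x y z e e'"
    unfolding dif_def by (rule homologous_diff)
  then have "dif i j x y u e e'' \<simeq> dif i k x y z e e'" by (simp add: dif_def)
  then show ?thesis by (rule homologous_sym)
qed

lemma dif_apex_irrelevant:
  assumes X: "x \<in> X" "y \<in> X" "z \<in> X" "z' \<in> X" "e \<in> X" "f \<in> X" "f' \<in> X" and "i \<noteq> k" "i \<noteq> k'"
    and ind: "ind2 x z" "ind2 y z" "ind2 x z'" "ind2 y z'"
  shows "dif i k x y z e f \<simeq> dif i k' x y z' e f'"
proof -
  have "\<exists>u. u \<in> X \<and> (\<forall>a\<in>{x, y, z, z'}. ind2 a u) \<and> (\<forall>a\<in>{x, y, z, z'}. \<forall>b\<in>{x, y, z, z'}. ind2 a b \<longrightarrow> ind3 a u b)"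
    by (rule indep_element) (use X in simp_all)
  then obtain u where u: "u \<in> X" "\<forall>a\<in>{x, y, z, z'}. ind2 a u"
    "\<forall>a\<in>{x, y, z, z'}. \<forall>b\<in>{x, y, z, z'}. ind2 a b \<longrightarrow> ind3 a u b"
    by (elim exE conjE) (rule that; assumption)
  obtain j where j: "j \<notin> {i, k, k'}" using fresh_nat[of "{i, k, k'}"] by auto
  have "dif i k x y z e f \<simeq> dif i j x y u e f"
    by (rule dif_change_apex) (use assms u j in simp_all)
  also have "dif i j x y u e f \<simeq> dif i k' x y z' e f'"
    by (rule homologous_sym, rule dif_change_apex) (use assms u j in simp_all)
  finally show ?thesis .
qed

text \<open>Moving \<open>y\<close> back to \<open>x\<close> turns a difference at the vertex \<open>i\<close> into one at the vertex \<open>k\<close>; so the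
  difference class depends neither on \<open>i\<close> nor on the enumeration \<open>e\<close> of its vertex set.\<close>

lemma dif_turn:
  assumes X: "x \<in> X" "y \<in> X" "z \<in> X" "e \<in> X" "f \<in> X" and "i \<noteq> k" and \<tau>: "\<tau> \<in> G" "\<tau> \<circ> x = y"
    and ind: "ind2 x z" "ind2 y z"
  shows "dif i k x y z e f \<simeq> dif k i (inv_map \<tau> \<circ> z) z x f e"
    and "ind2 (inv_map \<tau> \<circ> z) x"
proof -
  let ?z = "inv_map \<tau> \<circ> z"
  have inv: "inv_map \<tau> \<in> G" by (rule G_inv[OF \<tau>(1)])
  have \<tau>z: "\<tau> \<circ> ?z = z" using \<tau>(1) by (simp add: fun_eq_iff)
  have "ind2 (\<tau> \<circ> x) (\<tau> \<circ> ?z)" unfolding \<tau>z \<tau>(2) by (rule ind(2))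
  then have i: "ind2 x ?z" using ind2_invariant[OF \<tau>(1)] by simp
  then show "ind2 ?z x" by (rule ind2_sym)
  have "W i k (\<tau> \<circ> x) (\<tau> \<circ> ?z) e f \<simeq> W i k x ?z e f"
    by (rule W_invariant) (use assms i inv in simp_all)
  then have "dif i k x y z e f \<simeq> W i k x z e f - W i k x ?z e f"
    unfolding dif_def \<tau>z \<tau>(2) by (intro homologous_diff) simp_all
  moreover have "W i k x z e f - W i k x ?z e f = dif k i ?z z x f e"
    using W_swap[of i k x z f e] W_swap[of i k x ?z f e] W_swap[OF assms(6), of z x f e] W_swap[OF assms(6), of ?z x f e]
    unfolding dif_def by simp
  ultimately show "dif i k x y z e f \<simeq> dif k i ?z z x f e" by simp
qed

text \<open>Only the apex data can be changed directly. To change \<open>i\<close> and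
  \<open>e\<close> as well, the difference is turned so that they become apex data, replaced there,
  and the result is turned back. The vertex \<open>l\<close> avoids both \<open>i\<close> and
  \<open>i'\<close>, so that both turns are possible.\<close>

lemma dif_irrelevant:
  assumes X: "x \<in> X" "y \<in> X" "z \<in> X" "z' \<in> X" "e \<in> X" "e' \<in> X" "f \<in> X" "f' \<in> X" and "i \<noteq> k" "i' \<noteq> k'"
    and ind: "ind2 x z" "ind2 y z" "ind2 x z'" "ind2 y z'"
  shows "dif i k x y z e f \<simeq> dif i' k' x y z' e' f'"
proof -
  obtain \<tau> where \<tau>: "\<tau> \<in> G" "\<tau> \<circ> x = y" by (rule X_conjugate[OF X(1,2)])
  obtain l where l: "l \<notin> {i, i'}" using fresh_nat[of "{i, i'}"] by auto
  let ?z = "inv_map \<tau> \<circ> z"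
  have z: "?z \<in> X" using G_inv[OF \<tau>(1)] X(3) by simp
  have turn: "dif j l x y z e f \<simeq> dif l j ?z z x f e" if "j \<in> {i, i'}" "e \<in> X" for j e
    by (rule dif_turn) (use assms \<tau> l that in auto)
  have "ind2 ?z x" by (rule dif_turn(2)[of x y z e f 0 1]) (use assms \<tau> in simp_all)
  have "dif i k x y z e f \<simeq> dif i l x y z e f"
    by (rule dif_apex_irrelevant) (use assms l in simp_all)
  also have "\<dots> \<simeq> dif l i ?z z x f e" by (rule turn) (use assms in simp_all)
  also have "\<dots> \<simeq> dif l i' ?z z x f e'"
    by (rule dif_apex_irrelevant) (use assms l z \<open>ind2 ?z x\<close> ind2_sym in simp_all)
  also have "\<dots> \<simeq> dif i' l x y z e' f"
    by (rule homologous_sym, rule turn) (use assms in simp_all)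
  also have "\<dots> \<simeq> dif i' k' x y z' e' f'"
    by (rule dif_apex_irrelevant) (use assms l in simp_all)
  finally show ?thesis .
qed

text \<open>The vertices 0 and 1 and the enumerations are arbitrary choices, which
  \<open>dif_homologous_D\<close> exchanges for any others. A chain is kept instead of its class so
  that computations stay in the group of chains.\<close>

definition D :: "('i \<Rightarrow> 'm) \<Rightarrow> ('i \<Rightarrow> 'm) \<Rightarrow> 'm psimplex \<Rightarrow>\<^sub>0 int" where
  "D x y = dif 0 1 x y (SOME z. z \<in> X \<and> ind2 x z \<and> ind2 y z) x x"

lemma dif_homologous_D:
  assumes "x \<in> X" "y \<in> X" "z \<in> X" "e \<in> X" "f \<in> X" "i \<noteq> k" "ind2 x z" "ind2 y z"
  shows "dif i k x y z e f \<simeq> D x y"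
proof -
  let ?P = "\<lambda>z. z \<in> X \<and> ind2 x z \<and> ind2 y z"
  have "?P (SOME z. ?P z)" by (rule someI[of ?P z]) (use assms in simp)
  then show ?thesis unfolding D_def by (intro dif_irrelevant) (use assms in simp_all)
qed

text \<open>With one apex common to all three points the sum telescopes as an identity of
  chains.\<close>

lemma D_add:
  assumes "x \<in> X" "y \<in> X" "z \<in> X"
  shows "D x y + D y z \<simeq> D x z"
proof -
  have "\<exists>u. u \<in> X \<and> (\<forall>a\<in>{x, y, z}. ind2 a u) \<and> (\<forall>a\<in>{x, y, z}. \<forall>b\<in>{x, y, z}. ind2 a b \<longrightarrow> ind3 a u b)"
    by (rule indep_element) (use assms in simp_all)
  then obtain u where u: "u \<in> X" "\<forall>a\<in>{x, y, z}. ind2 a u"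
    "\<forall>a\<in>{x, y, z}. \<forall>b\<in>{x, y, z}. ind2 a b \<longrightarrow> ind3 a u b"
    by (elim exE conjE) (rule that; assumption)
  have *: "dif 0 1 a b u x x \<simeq> D a b" if "a \<in> {x, y, z}" "b \<in> {x, y, z}" for a b
    by (rule dif_homologous_D) (use assms u that in auto)
  have "dif 0 1 x y u x x + dif 0 1 y z u x x \<simeq> D x y + D y z"
    by (intro homologous_add *) simp_all
  moreover have "dif 0 1 x y u x x + dif 0 1 y z u x x = dif 0 1 x z u x x" by (simp add: dif_def)
  moreover have "dif 0 1 x z u x x \<simeq> D x z" by (intro *) simp_all
  ultimately show ?thesis using homologous_sym homologous_trans by metis
qed

lemma D_refl:
  assumes "x \<in> X"
  shows "D x x \<simeq> 0"
  using homologous_diff[OF D_add[OF assms assms assms] homologous_refl[of "D x x"]] by simp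

lemma D_swap:
  assumes "x \<in> X" "y \<in> X"
  shows "- D x y \<simeq> D y x"
proof -
  have "D x y + D y x \<simeq> 0" using D_add[OF assms assms(1)] D_refl[OF assms(1)] by (rule homologous_trans)
  then have "(D x y + D y x) - D x y \<simeq> 0 - D x y" by (intro homologous_diff homologous_refl)
  then show ?thesis by (simp add: homologous_sym)
qed

lemma D_invariant:
  assumes "x \<in> X" "y \<in> X" "\<tau> \<in> G"
  shows "D (\<tau> \<circ> x) (\<tau> \<circ> y) \<simeq> D x y"
proof -
  have "\<exists>u. u \<in> X \<and> (\<forall>a\<in>{x, y}. ind2 a u) \<and> (\<forall>a\<in>{x, y}. \<forall>b\<in>{x, y}. ind2 a b \<longrightarrow> ind3 a u b)"
    by (rule indep_element) (use assms in simp_all)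
  then obtain u where u: "u \<in> X" "\<forall>a\<in>{x, y}. ind2 a u"
    "\<forall>a\<in>{x, y}. \<forall>b\<in>{x, y}. ind2 a b \<longrightarrow> ind3 a u b"
    by (elim exE conjE) (rule that; assumption)
  have "dif 0 1 (\<tau> \<circ> x) (\<tau> \<circ> y) (\<tau> \<circ> u) x x \<simeq> D (\<tau> \<circ> x) (\<tau> \<circ> y)"
    by (rule dif_homologous_D) (use assms u ind2_invariant in simp_all)
  moreover have "dif 0 1 (\<tau> \<circ> x) (\<tau> \<circ> y) (\<tau> \<circ> u) x x \<simeq> dif 0 1 x y u x x"
    unfolding dif_def by (intro homologous_diff W_invariant) (use assms u in simp_all)
  moreover have "dif 0 1 x y u x x \<simeq> D x y"
    by (rule dif_homologous_D) (use assms u in simp_all)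
  ultimately show ?thesis using homologous_sym homologous_trans by metis
qed

section \<open>Shells\<close>

text \<open>A representation prescribes only the type of the pair, so \<open>(a, b)\<close> is
  conjugate to the actual points of \<open>f\<close>. The conjugating automorphism serves as the
  placement of the top object and exhibits \<open>f\<close> as a standard edge on \<open>a\<close>
  and \<open>b\<close>.\<close>

lemma edge_homologous:
  assumes f: "f \<in> simplices 1" "supp f = {i, j}" "i < j"
    and e: "e \<in> X" "cl e = obj f {i}" and e': "e' \<in> X" "cl e' = obj f {j}"
    and a: "a \<in> X" "b \<in> X"
    and tp: "tp M {} (case_sum a b) = tp M {} (case_sum (mor f {i} {i, j} \<circ> e) (mor f {j} {i, j} \<circ> e'))"
  shows "frag_of f \<simeq> W i j a b e e'" "ind2 a b"
proof -
  have f': "is_simplex M ind B p 1 f" using f(1) by simp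
  have ij: "i \<noteq> j" using f(3) by simp
  note pts = edge_points[OF f' f(2) ij e e']
  have "small M (UNIV :: ('i + 'i) set)"
    using small_Un[OF small_image[OF small_index, of Inl] small_image[OF small_index, of Inr]]
    by (simp add: UNIV_sum)
  then obtain \<tau> where \<tau>: "\<tau> \<in> G"
    "\<tau> \<circ> case_sum a b = case_sum (mor f {i} {i, j} \<circ> e) (mor f {j} {i, j} \<circ> e')"
    using tp by (auto simp: tp_empty_eq_iff_conjugate)
  have \<tau>a: "\<tau> \<circ> a = mor f {i} {i, j} \<circ> e"
  proof
    fix n show "(\<tau> \<circ> a) n = (mor f {i} {i, j} \<circ> e) n" using fun_cong[OF \<tau>(2), of "Inl n"] by simp
  qed
  have \<tau>b: "\<tau> \<circ> b = mor f {j} {i, j} \<circ> e'"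
  proof
    fix n show "(\<tau> \<circ> b) n = (mor f {j} {i, j} \<circ> e') n" using fun_cong[OF \<tau>(2), of "Inr n"] by simp
  qed
  have "ind2 (\<tau> \<circ> a) (\<tau> \<circ> b)" unfolding \<tau>a \<tau>b by (rule pts(3))
  then show ind: "ind2 a b" using ind2_invariant[OF \<tau>(1)] by simp
  let ?x = "\<lambda>n. if n = i then a else b"
  let ?\<rho> = "\<lambda>u. if u = {i} then mover a e else if u = {j} then mover b e' else \<tau>"
  have \<rho>: "?\<rho> u \<in> G" for u using mover a e(1) e'(1) \<tau>(1) by simp
  have ne: "{i, j} \<noteq> {i}" "{i, j} \<noteq> {j}" using ij by auto
  have v: "?\<rho> {i} \<circ> ?x i = e" "?\<rho> {j} \<circ> ?x j = e'"
    using mover[OF a(1) e(1)] mover[OF a(2) e'(1)] ij by simp_all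
  have "f = std {i, j} ?x ?\<rho>"
    by (rule edge_eq_std[OF f' f(2) ij e e' _ _ \<rho> v]) (use ij ne a \<tau>a \<tau>b in simp_all)
  moreover have "frag_of (std {i, j} ?x ?\<rho>) \<simeq> frag_of (edge i j (?x i) (?x j) e e')"
    by (rule std_homologous_edge[OF f(3) _ _ _ \<rho> v]) (use ij a ind in simp_all)
  ultimately show "frag_of f \<simeq> W i j a b e e'" using f(3) ij by (simp add: W_def)
qed

text \<open>The cocycle identity rewritten so that both summands run from a vertex to the new point
  \<open>u\<close>: in sums of several edges, the terms of a shared point at a shared vertex then
  cancel.\<close>

lemma W_split:
  assumes "i \<noteq> j" "i \<noteq> k" "j \<noteq> k" "x \<in> X" "y \<in> X" "u \<in> X" "e \<in> X" "e' \<in> X" "e'' \<in> X" "ind3 x u y"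
  shows "W i j x y e e' \<simeq> W i k x u e e'' - W j k y u e' e''"
proof -
  have "W i k x u e e'' + W k j u y e'' e' \<simeq> W i j x y e e'"
    by (rule W_cocycle) (use assms in simp_all)
  moreover have "W i k x u e e'' + W k j u y e'' e' = W i k x u e e'' - W j k y u e' e''"
    by (simp add: W_swap[OF assms(3)])
  ultimately show ?thesis by (simp only: homologous_sym)
qed

text \<open>All three edges are split at one \<open>u\<close> independent from the four points,
  placed beyond the last vertex. The terms of \<open>a1\<close> and \<open>a2\<close> cancel, while
  vertex \<open>n0\<close> is met at two different points, \<open>a0\<close> and \<open>a3\<close>;
  their difference is all that remains.\<close>

lemma representation_homologous:
  assumes n: "n0 < n1" "n1 < n2" and X: "a0 \<in> X" "a1 \<in> X" "a2 \<in> X" "a3 \<in> X" "e0 \<in> X" "e1 \<in> X" "e2 \<in> X"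
    and ind: "ind2 a0 a1" "ind2 a1 a2" "ind2 a3 a2"
  shows "W n1 n2 a1 a2 e1 e2 - W n0 n2 a3 a2 e0 e2 + W n0 n1 a0 a1 e0 e1 \<simeq> D a0 a3"
proof -
  let ?k = "Suc n2"
  have "\<exists>u. u \<in> X \<and> (\<forall>a\<in>{a0, a1, a2, a3}. ind2 a u) \<and> (\<forall>a\<in>{a0, a1, a2, a3}. \<forall>b\<in>{a0, a1, a2, a3}. ind2 a b \<longrightarrow> ind3 a u b)"
    by (rule indep_element) (use X in simp_all)
  then obtain u where u: "u \<in> X" "\<forall>a\<in>{a0, a1, a2, a3}. ind2 a u"
    "\<forall>a\<in>{a0, a1, a2, a3}. \<forall>b\<in>{a0, a1, a2, a3}. ind2 a b \<longrightarrow> ind3 a u b"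
    by (elim exE conjE) (rule that; assumption)
  have "W n1 n2 a1 a2 e1 e2 \<simeq> W n1 ?k a1 u e1 u - W n2 ?k a2 u e2 u"
    by (rule W_split) (use n X u ind in simp_all)
  moreover have "W n0 n2 a3 a2 e0 e2 \<simeq> W n0 ?k a3 u e0 u - W n2 ?k a2 u e2 u"
    by (rule W_split) (use n X u ind in simp_all)
  moreover have "W n0 n1 a0 a1 e0 e1 \<simeq> W n0 ?k a0 u e0 u - W n1 ?k a1 u e1 u"
    by (rule W_split) (use n X u ind in simp_all)
  ultimately have "W n1 n2 a1 a2 e1 e2 - W n0 n2 a3 a2 e0 e2 + W n0 n1 a0 a1 e0 e1 \<simeq>
      (W n1 ?k a1 u e1 u - W n2 ?k a2 u e2 u) - (W n0 ?k a3 u e0 u - W n2 ?k a2 u e2 u) +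
      (W n0 ?k a0 u e0 u - W n1 ?k a1 u e1 u)"
    by (intro homologous_add homologous_diff)
  moreover have "(W n1 ?k a1 u e1 u - W n2 ?k a2 u e2 u) - (W n0 ?k a3 u e0 u - W n2 ?k a2 u e2 u) +
      (W n0 ?k a0 u e0 u - W n1 ?k a1 u e1 u) = dif n0 ?k a0 a3 u e0 u"
    by (simp add: dif_def)
  moreover have "dif n0 ?k a0 a3 u e0 u \<simeq> D a0 a3"
    by (rule dif_homologous_D) (use n X u in simp_all)
  ultimately show ?thesis using homologous_trans by metis
qed

lemma shell_supports:
  assumes "is_shell M ind B p f12 f02 f01"
  obtains n0 n1 n2 where "n0 < n1" "n1 < n2" "supp f12 = {n1, n2}" "supp f02 = {n0, n2}" "supp f01 = {n0, n1}"
    "shell_supp f12 f02 f01 = {n0, n1, n2}"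
proof -
  have S: "f12 \<in> simplices 1" "f02 \<in> simplices 1" "f01 \<in> simplices 1"
    and F: "face 0 f02 = face 0 f12" "face 0 f01 = face 1 f12" "face 1 f01 = face 1 f02"
    using assms by (auto simp: is_shell_def)
  obtain n1 n2 where s12: "supp f12 = {n1, n2}" "n1 < n2" by (rule edge_cases[OF S(1)])
  obtain m0 m2 where s02: "supp f02 = {m0, m2}" "m0 < m2" by (rule edge_cases[OF S(2)])
  obtain l0 l1 where s01: "supp f01 = {l0, l1}" "l0 < l1" by (rule edge_cases[OF S(3)])
  have "{m2} = {n2}" "{l1} = {n1}" "{l0} = {m0}"
    using F unfolding face_edge[OF s12] face_edge[OF s02] face_edge[OF s01] by (metis supp_restr)+
  then have eq: "m2 = n2" "l1 = n1" "l0 = m0" by simp_all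
  show thesis
    by (rule that[of m0 n1 n2]) (use s12 s02 s01 eq in \<open>auto simp: shell_supp_def\<close>)
qed

definition cycle :: "('m psimplex \<Rightarrow>\<^sub>0 int) \<Rightarrow> bool" where
  "cycle c \<longleftrightarrow> Poly_Mapping.keys c \<subseteq> simplices 1 \<and> boundary 1 c = 0"

lemma shell_cycle:
  assumes "is_shell M ind B p f12 f02 f01"
  shows "cycle (shell_chain f12 f02 f01)"
proof -
  have S: "f12 \<in> simplices 1" "f02 \<in> simplices 1" "f01 \<in> simplices 1"
    and F: "face 0 f02 = face 0 f12" "face 0 f01 = face 1 f12" "face 1 f01 = face 1 f02"
    using assms by (auto simp: is_shell_def)
  have "Poly_Mapping.keys (shell_chain f12 f02 f01) \<subseteq>
      Poly_Mapping.keys (frag_of f12 - frag_of f02) \<union> Poly_Mapping.keys (frag_of f01)"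
    unfolding shell_chain_def by (rule Poly_Mapping.keys_add)
  also have "\<dots> \<subseteq> Poly_Mapping.keys (frag_of f12) \<union> Poly_Mapping.keys (frag_of f02) \<union>
      Poly_Mapping.keys (frag_of f01)"
    by (intro Un_mono keys_diff order_refl)
  also have "\<dots> \<subseteq> simplices 1" using S by simp
  finally show ?thesis
    unfolding cycle_def shell_chain_def boundary_add boundary_diff boundary_edge F by simp
qed

lemma shell_homologous:
  assumes shell: "is_shell M ind B p f12 f02 f01" and ab: "is_endpoint_pair M B p f12 f02 f01 a b"
  shows "a \<in> X" "b \<in> X" "shell_chain f12 f02 f01 \<simeq> D a b"
proof -
  obtain n0 n1 n2 where n: "n0 < n1" "n1 < n2" and s: "supp f12 = {n1, n2}" "supp f02 = {n0, n2}"
    "supp f01 = {n0, n1}" "shell_supp f12 f02 f01 = {n0, n1, n2}"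
    by (rule shell_supports[OF shell])
  have S: "f12 \<in> simplices 1" "f02 \<in> simplices 1" "f01 \<in> simplices 1"
    using shell by (auto simp: is_shell_def)
  obtain a1 a2 where rep: "is_representation M B p f12 f02 f01 a a1 a2 b"
    using ab unfolding is_endpoint_pair_def by blast
  have nth: "[n0, n1, n2] ! 0 = n0" "[n0, n1, n2] ! 1 = n1" "[n0, n1, n2] ! 2 = n2"
    by (simp_all add: numeral_2_eq_2)
  from rep[unfolded is_representation_def s(4) sorted_list_triple[OF n] Let_def nth]
  obtain e0 e1 e2 where R: "realizes M B p a" "realizes M B p a1" "realizes M B p a2" "realizes M B p b"
      "realizes M B p e0" "realizes M B p e1" "realizes M B p e2"
    and V: "acl M (range e0) = obj f01 {n0}" "acl M (range e0) = obj f02 {n0}"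
      "acl M (range e1) = obj f01 {n1}" "acl M (range e1) = obj f12 {n1}"
      "acl M (range e2) = obj f02 {n2}" "acl M (range e2) = obj f12 {n2}"
    and t: "tp M {} (case_sum a a1) =
              tp M {} (case_sum (mor f01 {n0} {n0, n1} \<circ> e0) (mor f01 {n1} {n0, n1} \<circ> e1))"
      "tp M {} (case_sum a1 a2) =
              tp M {} (case_sum (mor f12 {n1} {n1, n2} \<circ> e1) (mor f12 {n2} {n1, n2} \<circ> e2))"
      "tp M {} (case_sum b a2) =
              tp M {} (case_sum (mor f02 {n0} {n0, n2} \<circ> e0) (mor f02 {n2} {n0, n2} \<circ> e2))"
    by (elim conjE exE) (rule that; assumption)
  have X: "a \<in> X" "a1 \<in> X" "a2 \<in> X" "b \<in> X" "e0 \<in> X" "e1 \<in> X" "e2 \<in> X"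
    using R by (simp_all only: X_def mem_Collect_eq)
  note v = V[folded cl_def]
  have "n0 < n2" using n by simp
  note 01 = edge_homologous[OF S(3) s(3) n(1) X(5) v(1) X(6) v(3) X(1,2) t(1)]
  note 12 = edge_homologous[OF S(1) s(1) n(2) X(6) v(4) X(7) v(6) X(2,3) t(2)]
  note 02 = edge_homologous[OF S(2) s(2) \<open>n0 < n2\<close> X(5) v(2) X(7) v(5) X(4,3) t(3)]
  show "a \<in> X" "b \<in> X" by (rule X)+
  have "shell_chain f12 f02 f01 \<simeq>
      W n1 n2 a1 a2 e1 e2 - W n0 n2 b a2 e0 e2 + W n0 n1 a a1 e0 e1"
    unfolding shell_chain_def by (intro homologous_add homologous_diff 01 12 02)
  also have "\<dots> \<simeq> D a b"
    by (rule representation_homologous[OF n X(1-7) 01(2) 12(2) 02(2)])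
  finally show "shell_chain f12 f02 f01 \<simeq> D a b" .
qed

text \<open>On a single vertex the only maps are identities and the inclusion of the base, and these
  are forced. The functor is thus determined by its object, and matching faces reduces to matching
  vertex sets.\<close>

lemma vertex_face_eq:
  assumes f: "is_simplex M ind B p n f" and g: "is_simplex M ind B p m g"
    and i: "i \<in> supp f" "i \<in> supp g" "obj f {i} = obj g {i}"
  shows "restr {i} f = restr {i} g"
proof -
  note F = simplex_functor[OF f] and G = simplex_functor[OF g]
  have sub: "u = {} \<or> u = {i}" if "u \<subseteq> {i}" for u using that by blast
  have obj: "obj f u = obj g u" if "u \<subseteq> {i}" for u
    using sub[OF that] i(3) simplex_empty[OF f] simplex_empty[OF g] by auto
  have mor: "mor f u v = mor g u v" if uv: "u \<subseteq> v" "v \<subseteq> {i}" for u v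
  proof -
    have u: "u \<subseteq> {i}" using uv by blast
    have s: "v \<subseteq> supp f" "v \<subseteq> supp g" "u \<subseteq> supp f" "u \<subseteq> supp g" using uv i(1,2) by auto
    show ?thesis
    proof (rule extensionalityI)
      show "mor f u v \<in> extensional (obj f u)" by (rule functor_extensional[OF F uv(1) s(1)])
      show "mor g u v \<in> extensional (obj f u)"
        unfolding obj[OF u] by (rule functor_extensional[OF G uv(1) s(2)])
      fix b assume b: "b \<in> obj f u"
      show "mor f u v b = mor g u v b"
      proof (cases "u = v")
        case True
        then show ?thesis
          using functor_id[OF F s(3) b] functor_id[OF G s(4) b[unfolded obj[OF u]]] by simp
      next
        case False
        then have "u = {}" using uv sub[OF u] sub[OF uv(2)] by auto
        then have "b \<in> B" using b simplex_empty[OF f] by simp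
        then show ?thesis using functor_fixes[OF F uv(1) s(1)] functor_fixes[OF G uv(1) s(2)] by simp
      qed
    qed
  qed
  show ?thesis unfolding restr_def
    by (auto simp: fun_eq_iff obj mor)
qed

lemma shell_exists:
  assumes a: "a \<in> X" and b: "b \<in> X"
  obtains f12 f02 f01 where "is_shell M ind B p f12 f02 f01" "shell_supp f12 f02 f01 = {0, 1, 2}"
    "is_endpoint_pair M B p f12 f02 f01 a b"
proof -
  have "\<exists>u. u \<in> X \<and> (\<forall>a\<in>{a}. ind2 a u) \<and> (\<forall>a\<in>{a}. \<forall>b\<in>{a}. ind2 a b \<longrightarrow> ind3 a u b)"
    using indep_element[of "{a}"] a by simp
  then obtain a1 where a1: "a1 \<in> X" "\<forall>a\<in>{a}. ind2 a a1"
    "\<forall>a\<in>{a}. \<forall>b\<in>{a}. ind2 a b \<longrightarrow> ind3 a a1 b"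
    by (elim exE conjE) (rule that; assumption)
  have "\<exists>u. u \<in> X \<and> (\<forall>a\<in>{a1, b}. ind2 a u) \<and> (\<forall>a\<in>{a1, b}. \<forall>b\<in>{a1, b}. ind2 a b \<longrightarrow> ind3 a u b)"
    using indep_element[of "{a1, b}"] a1 b by simp
  then obtain a2 where a2: "a2 \<in> X" "\<forall>a\<in>{a1, b}. ind2 a a2"
    "\<forall>a\<in>{a1, b}. \<forall>b\<in>{a1, b}. ind2 a b \<longrightarrow> ind3 a a2 b"
    by (elim exE conjE) (rule that; assumption)
  \<comment> \<open>Every vertex is taken to be \<open>cl a\<close>, enumerated by \<open>a\<close>,
    so that the faces match automatically. The edges differ only in the points to which these
    vertices are sent, and at vertex 0 these points are \<open>a\<close> in one edge and
    \<open>b\<close> in the other.\<close>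
  define f12 f02 f01 where "f12 = edge 1 2 a1 a2 a a" and "f02 = edge 0 2 b a2 a a"
    and "f01 = edge 0 1 a a1 a a"
  note e12 = edge_props[of 1 2 a1 a2 a a, folded f12_def] and e02 = edge_props[of 0 2 b a2 a a, folded f02_def]
    and e01 = edge_props[of 0 1 a a1 a a, folded f01_def]
  have S: "is_simplex M ind B p 1 f12" "is_simplex M ind B p 1 f02" "is_simplex M ind B p 1 f01"
    using e12(1) e02(1) e01(1) a b a1 a2 by simp_all
  have s: "supp f12 = {1, 2}" "supp f02 = {0, 2}" "supp f01 = {0, 1}"
    using e12(2) e02(2) e01(2) a b a1 a2 by simp_all
  have v: "obj f12 {1} = cl a" "obj f12 {2} = cl a" "obj f02 {0} = cl a" "obj f02 {2} = cl a"
    "obj f01 {0} = cl a" "obj f01 {1} = cl a"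
    using e12(3,4) e02(3,4) e01(3,4) a b a1 a2 by simp_all
  have m: "mor f12 {1} {1, 2} \<circ> a = a1" "mor f12 {2} {1, 2} \<circ> a = a2" "mor f02 {0} {0, 2} \<circ> a = b"
    "mor f02 {2} {0, 2} \<circ> a = a2" "mor f01 {0} {0, 1} \<circ> a = a" "mor f01 {1} {0, 1} \<circ> a = a1"
    using e12(5,6) e02(5,6) e01(5,6) a b a1 a2 by simp_all
  have "(1::nat) < 2" "(0::nat) < 2" "(0::nat) < 1" by simp_all
  note faces = face_edge[OF s(1) this(1)] face_edge[OF s(2) this(2)] face_edge[OF s(3) this(3)]
  have "is_shell M ind B p f12 f02 f01"
    unfolding is_shell_def faces
  proof (intro conjI)
    show "\<forall>f\<in>{f12, f02, f01}. is_simplex M ind B p 1 f" using S by simp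
    show "restr {2} f02 = restr {2} f12" by (rule vertex_face_eq[OF S(2,1)]) (simp_all add: s v)
    show "restr {1} f01 = restr {1} f12" by (rule vertex_face_eq[OF S(3,1)]) (simp_all add: s v v[unfolded One_nat_def])
    show "restr {0} f01 = restr {0} f02" by (rule vertex_face_eq[OF S(3,2)]) (simp_all add: s v)
  qed
  moreover have supp: "shell_supp f12 f02 f01 = {0, 1, 2}" unfolding shell_supp_def s by auto
  moreover have "is_representation M B p f12 f02 f01 a a1 a2 b"
  proof -
    have l: "sorted_list_of_set {0, 1, 2 :: nat} = [0, 1, 2]" by (rule sorted_list_triple) simp_all
    have nth: "[0, 1, 2] ! 0 = (0 :: nat)" "[0, 1, 2] ! 1 = (1 :: nat)" "[0, 1, 2] ! 2 = (2 :: nat)"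
      by (simp_all add: numeral_2_eq_2)
    have R: "realizes M B p c" if "c \<in> X" for c using that by (simp add: X_def)
    show ?thesis
      unfolding is_representation_def supp l Let_def nth cl_def[symmetric]
      by (intro conjI R a a1 a2 b exI[of _ a]) (simp_all only: v m)
  qed
  then have "is_endpoint_pair M B p f12 f02 f01 a b" unfolding is_endpoint_pair_def by blast
  ultimately show thesis by (rule that)
qed

section \<open>The group \<open>H1\<close>, the bracket, and reduction of cycles to a
  difference\<close>

section \<open>The first homology group\<close>

abbreviation Z1 :: "('m psimplex \<Rightarrow>\<^sub>0 int) monoid" where
  "Z1 \<equiv> cycles M ind B p 1"

abbreviation H1 :: "('m psimplex \<Rightarrow>\<^sub>0 int) set monoid" where
  "H1 \<equiv> homology M ind B p 1"

abbreviation cls :: "('m psimplex \<Rightarrow>\<^sub>0 int) \<Rightarrow> ('m psimplex \<Rightarrow>\<^sub>0 int) set" where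
  "cls \<equiv> homology_class M ind B p 1"

lemma cycle_diff: "cycle c \<Longrightarrow> cycle d \<Longrightarrow> cycle (c - d)"
  unfolding cycle_def using keys_diff[of c d] by (auto simp: boundary_diff)

lemma cycle_0: "cycle 0"
  by (simp add: cycle_def)

lemma cycle_add: "cycle c \<Longrightarrow> cycle d \<Longrightarrow> cycle (c + d)"
  using cycle_diff[OF _ cycle_diff[OF cycle_0], of c d] by simp

lemma kernel_eq: "kernel (chains M ind B p 1) (chains M ind B p 0) (boundary 1) = {c. cycle c}"
  unfolding kernel_def chains_def cycle_def by auto

lemma subgroup_cycles: "subgroup {c. cycle c} (chains M ind B p 1)"
proof (rule group.subgroupI)
  show "Group.group (chains M ind B p 1)" by (simp add: chains_def)
  show "{c. cycle c} \<subseteq> carrier (chains M ind B p 1)" by (auto simp: chains_def cycle_def)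
  show "{c. cycle c} \<noteq> {}" using cycle_0 by blast
  fix c d assume c: "c \<in> {c. cycle c}" and d: "d \<in> {c. cycle c}"
  have "Poly_Mapping.keys c \<subseteq> simplices 1" using c by (simp add: cycle_def)
  then have "inv\<^bsub>chains M ind B p 1\<^esub> c = - c" by (simp add: chains_def)
  then show "inv\<^bsub>chains M ind B p 1\<^esub> c \<in> {c. cycle c}" using cycle_diff[OF cycle_0, of c] c by simp
  show "c \<otimes>\<^bsub>chains M ind B p 1\<^esub> d \<in> {c. cycle c}" using cycle_add c d by (simp add: chains_def)
qed

lemma carrier_Z1: "carrier Z1 = {c. cycle c}"
  unfolding cycles_def diff_self_eq_0 kernel_eq
  by (rule subgroup.carrier_subgroup_generated_subgroup[OF subgroup_cycles])

lemma mult_Z1: "c \<otimes>\<^bsub>Z1\<^esub> d = c + d"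
  by (simp add: cycles_def chains_def)

lemma one_Z1: "\<one>\<^bsub>Z1\<^esub> = 0"
  by (simp add: cycles_def chains_def)

lemma comm_group_Z1: "comm_group Z1"
  unfolding cycles_def chains_def
  by (rule group.abelian_subgroup_generated) (simp_all add: abelian_free_Abelian_group)

lemma normal_Bd: "Bd \<lhd> Z1"
proof -
  interpret Z: comm_group Z1 by (rule comm_group_Z1)
  have "subgroup Bd Z1"
  proof (rule Z.subgroupI)
    show "Bd \<subseteq> carrier Z1" unfolding carrier_Z1 cycle_def using Bd_cycle by blast
    show "Bd \<noteq> {}" using Bd_0 by blast
    fix c d assume c: "c \<in> Bd" and d: "d \<in> Bd"
    have cyc: "cycle c" using Bd_cycle[OF c] by (simp add: cycle_def)
    have "inv\<^bsub>Z1\<^esub> c = - c"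
    proof (rule Z.inv_equality)
      show "- c \<otimes>\<^bsub>Z1\<^esub> c = \<one>\<^bsub>Z1\<^esub>" unfolding mult_Z1 one_Z1 by simp
      show "c \<in> carrier Z1" unfolding carrier_Z1 using cyc by simp
      show "- c \<in> carrier Z1" unfolding carrier_Z1 using cycle_diff[OF cycle_0 cyc] by simp
    qed
    then show "inv\<^bsub>Z1\<^esub> c \<in> Bd" using Bd_minus[OF c] by simp
    show "c \<otimes>\<^bsub>Z1\<^esub> d \<in> Bd" unfolding mult_Z1 by (rule Bd_add[OF c d])
  qed
  then show ?thesis by (rule Z.subgroup_imp_normal)
qed

lemma cls_eq: "cls c = {b + c |b. b \<in> Bd}"
  unfolding homology_class_def r_coset_def Bd_def[symmetric] mult_Z1 by auto

lemma cls_cong: "cls c = cls d \<longleftrightarrow> c \<simeq> d"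
proof
  assume "cls c = cls d"
  moreover have "0 + c \<in> cls c" unfolding cls_eq using Bd_0 by blast
  ultimately have "c \<in> cls d" by simp
  then show "c \<simeq> d" unfolding cls_eq homologous_def by auto
next
  have sub: "cls c \<subseteq> cls d" if "c \<simeq> d" for c d
  proof
    fix x assume "x \<in> cls c"
    then obtain b where "b \<in> Bd" "x = b + c" unfolding cls_eq by blast
    then have "b + (c - d) \<in> Bd" "x = (b + (c - d)) + d"
      using that Bd_add by (simp_all add: homologous_def)
    then show "x \<in> cls d" unfolding cls_eq by blast
  qed
  assume "c \<simeq> d"
  then show "cls c = cls d" using sub[of c d] sub[of d c] homologous_sym by blast
qed

lemma group_H1: "Group.group H1"
  unfolding homology_def Bd_def[symmetric] by (rule normal.factorgroup_is_group[OF normal_Bd])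

lemma carrier_H1: "carrier H1 = cls ` {c. cycle c}"
  unfolding homology_def carrier_FactGroup carrier_Z1 homology_class_def ..

lemma mult_H1: "cycle c \<Longrightarrow> cycle d \<Longrightarrow> cls c \<otimes>\<^bsub>H1\<^esub> cls d = cls (c + d)"
  using normal.rcos_sum[OF normal_Bd, of c d, unfolded carrier_Z1 mult_Z1]
  unfolding homology_def homology_class_def Bd_def[symmetric] mult_FactGroup by simp

lemma one_H1: "\<one>\<^bsub>H1\<^esub> = cls 0"
  unfolding cls_eq homology_def one_FactGroup Bd_def[symmetric] by simp

text \<open>The definite description is legitimate because every shell with endpoint pair
  \<open>(a, b)\<close> is homologous to the same chain \<open>D a b\<close>.\<close>

lemma bracket_shell:
  assumes shell: "is_shell M ind B p f12 f02 f01" "shell_supp f12 f02 f01 = {0, 1, 2}"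
    "is_endpoint_pair M B p f12 f02 f01 a b"
  shows "bracket M ind B p a b = cls (shell_chain f12 f02 f01)"
  unfolding bracket_def
proof (rule the_equality)
  show "\<exists>g12 g02 g01. is_shell M ind B p g12 g02 g01 \<and> shell_supp g12 g02 g01 = {0, 1, 2} \<and>
      is_endpoint_pair M B p g12 g02 g01 a b \<and>
      cls (shell_chain f12 f02 f01) = cls (shell_chain g12 g02 g01)"
    using shell by blast
  fix h assume "\<exists>g12 g02 g01. is_shell M ind B p g12 g02 g01 \<and> shell_supp g12 g02 g01 = {0, 1, 2} \<and>
      is_endpoint_pair M B p g12 g02 g01 a b \<and> h = cls (shell_chain g12 g02 g01)"
  then obtain g12 g02 g01 where g: "is_shell M ind B p g12 g02 g01" "is_endpoint_pair M B p g12 g02 g01 a b"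
    "h = cls (shell_chain g12 g02 g01)" by (elim exE conjE) (rule that; assumption)
  have "shell_chain g12 g02 g01 \<simeq> shell_chain f12 f02 f01"
    by (rule homologous_trans[OF shell_homologous(3)[OF g(1,2)]
          homologous_sym[OF shell_homologous(3)[OF shell(1,3)]]])
  then show "h = cls (shell_chain f12 f02 f01)" unfolding g(3) cls_cong .
qed

abbreviation brk :: "('i \<Rightarrow> 'm) \<Rightarrow> ('i \<Rightarrow> 'm) \<Rightarrow> ('m psimplex \<Rightarrow>\<^sub>0 int) set" where
  "brk \<equiv> bracket M ind B p"

text \<open>The product in \<open>H1\<close> is computed on cycles; a shell provides a
  representative already known to be one, next to the more convenient chain
  \<open>D a b\<close>.\<close>

lemma bracket_cycle:
  assumes "a \<in> X" "b \<in> X"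
  obtains c where "cycle c" "c \<simeq> D a b" "brk a b = cls c"
proof -
  obtain f12 f02 f01 where f: "is_shell M ind B p f12 f02 f01" "shell_supp f12 f02 f01 = {0, 1, 2}"
    "is_endpoint_pair M B p f12 f02 f01 a b"
    by (rule shell_exists[OF assms])
  show thesis
    by (rule that[OF shell_cycle[OF f(1)] shell_homologous(3)[OF f(1,3)] bracket_shell[OF f]])
qed

lemma bracket_eq:
  assumes "a \<in> X" "b \<in> X" "c \<simeq> D a b"
  shows "brk a b = cls c"
proof -
  obtain d where "d \<simeq> D a b" "brk a b = cls d" by (rule bracket_cycle[OF assms(1,2)])
  then show ?thesis using assms(3) cls_cong homologous_sym homologous_trans by metis
qed

lemma bracket_cong:
  assumes "a \<in> X" "b \<in> X" "a' \<in> X" "b' \<in> X" "D a b \<simeq> D a' b'"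
  shows "brk a b = brk a' b'"
proof -
  obtain d where d: "d \<simeq> D a b" "brk a b = cls d" by (rule bracket_cycle[OF assms(1,2)])
  have "brk a' b' = cls d"
    by (rule bracket_eq[OF assms(3,4) homologous_trans[OF d(1) assms(5)]])
  then show ?thesis using d(2) by simp
qed

lemma bracket_carrier: "a \<in> X \<Longrightarrow> b \<in> X \<Longrightarrow> brk a b \<in> carrier H1"
  using bracket_cycle[of a b] carrier_H1 by blast

lemma bracket_mult:
  assumes "a \<in> X" "b \<in> X" "c \<in> X"
  shows "brk a b \<otimes>\<^bsub>H1\<^esub> brk b c = brk a c"
proof -
  obtain x where x: "cycle x" "x \<simeq> D a b" "brk a b = cls x" by (rule bracket_cycle[OF assms(1,2)])
  obtain y where y: "cycle y" "y \<simeq> D b c" "brk b c = cls y" by (rule bracket_cycle[OF assms(2,3)])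
  have "x + y \<simeq> D a c" by (rule homologous_trans[OF homologous_add[OF x(2) y(2)] D_add[OF assms]])
  then have "brk a c = cls (x + y)" by (rule bracket_eq[OF assms(1,3)])
  then show ?thesis using mult_H1[OF x(1) y(1)] x(3) y(3) by simp
qed

lemma bracket_invariant: "a \<in> X \<Longrightarrow> b \<in> X \<Longrightarrow> \<tau> \<in> G \<Longrightarrow> brk (\<tau> \<circ> a) (\<tau> \<circ> b) = brk a b"
  by (rule bracket_cong) (simp_all add: D_invariant)

lemma bracket_refl: "a \<in> X \<Longrightarrow> brk a a = \<one>\<^bsub>H1\<^esub>"
  unfolding one_H1 by (rule bracket_eq) (simp_all add: D_refl homologous_sym)

section \<open>Every cycle is homologous to a shell\<close>

text \<open>By additivity the left side is \<open>D b2 b1\<close>, and an automorphism taking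
  \<open>b2\<close> to \<open>a\<close> restores the base point. The classes of the chains
  \<open>D a b\<close> with \<open>a\<close> fixed are thus closed under subtraction, which is what
  an induction over chains needs.\<close>

lemma D_difference:
  assumes "a \<in> X" "b1 \<in> X" "b2 \<in> X"
  shows "\<exists>b\<in>X. D a b1 - D a b2 \<simeq> D a b"
proof -
  obtain \<tau> where \<tau>: "\<tau> \<in> G" "\<tau> \<circ> b2 = a" by (rule X_conjugate[OF assms(3,1)])
  have "D a b2 + D b2 b1 \<simeq> D a b1" by (rule D_add[OF assms(1,3,2)])
  then have "(D a b2 + D b2 b1) - D a b2 \<simeq> D a b1 - D a b2" by (rule homologous_diff) simp
  then have "D a b1 - D a b2 \<simeq> D b2 b1" by (simp add: homologous_sym)
  also have "D b2 b1 \<simeq> D (\<tau> \<circ> b2) (\<tau> \<circ> b1)"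
    by (rule homologous_sym[OF D_invariant[OF assms(3,2) \<tau>(1)]])
  finally have "D a b1 - D a b2 \<simeq> D a (\<tau> \<circ> b1)" unfolding \<tau>(2) .
  then show ?thesis using \<tau>(1) assms(2) by (intro bexI[of _ "\<tau> \<circ> b1"]) simp_all
qed

text \<open>After moving \<open>x\<close> to \<open>a\<close>, the edge shares its point at vertex
  \<open>i\<close> with the fixed edge on \<open>(a, u)\<close>. Read from vertex \<open>k\<close>,
  the two form a difference with apex \<open>a\<close>, whose class is then transported to the base
  point \<open>a\<close>.\<close>

lemma W_vertex:
  assumes X: "a \<in> X" "u \<in> X" "x \<in> X" "z \<in> X" "e \<in> X" "e' \<in> X" and "i \<noteq> k"
    and ind: "ind2 a u" "ind2 x z"
  shows "\<exists>b\<in>X. W i k x z e e' \<simeq> W i k a u e e' + D a b"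
proof -
  obtain \<tau> where \<tau>: "\<tau> \<in> G" "\<tau> \<circ> x = a" by (rule X_conjugate[OF X(3,1)])
  obtain \<sigma> where \<sigma>: "\<sigma> \<in> G" "\<sigma> \<circ> u = a" by (rule X_conjugate[OF X(2,1)])
  let ?z = "\<tau> \<circ> z"
  have z: "?z \<in> X" "\<sigma> \<circ> ?z \<in> X" using \<tau>(1) \<sigma>(1) X(4) by simp_all
  have "ind2 (\<tau> \<circ> x) (\<tau> \<circ> z)" using ind(2) ind2_invariant[OF \<tau>(1)] by simp
  then have az: "ind2 ?z a" unfolding \<tau>(2) by (rule ind2_sym)
  have "W i k (\<tau> \<circ> x) ?z e e' \<simeq> W i k x z e e'"
    by (rule W_invariant) (use assms \<tau>(1) in simp_all)
  then have 1: "W i k x z e e' \<simeq> W i k a ?z e e'" unfolding \<tau>(2) by (rule homologous_sym)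
  have "dif k i u ?z a e' e \<simeq> D u ?z"
    by (rule dif_homologous_D) (use assms z az ind2_sym[OF ind(1)] in simp_all)
  moreover have "dif k i u ?z a e' e = W i k a ?z e e' - W i k a u e e'"
    by (simp add: dif_def W_swap[OF assms(7)])
  moreover have "D u ?z \<simeq> D a (\<sigma> \<circ> ?z)"
    using homologous_sym[OF D_invariant[OF X(2) z(1) \<sigma>(1)]] unfolding \<sigma>(2) .
  ultimately have "W i k a ?z e e' - W i k a u e e' \<simeq> D a (\<sigma> \<circ> ?z)"
    using homologous_trans by simp
  then have "W i k a ?z e e' \<simeq> W i k a u e e' + D a (\<sigma> \<circ> ?z)"
    by (simp add: homologous_def algebra_simps)
  then show ?thesis using homologous_trans[OF 1] z(2) by blast
qed

text \<open>A cochain on vertices: it assigns to a vertex an edge from it to the outside vertex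
  \<open>k\<close>, always placed at the same pair \<open>(a, u)\<close>. The enumeration is chosen
  from the vertex set alone, so edges that share a vertex receive the same value there.\<close>

definition potential :: "nat \<Rightarrow> ('i \<Rightarrow> 'm) \<Rightarrow> ('i \<Rightarrow> 'm) \<Rightarrow> 'm psimplex \<Rightarrow> 'm psimplex \<Rightarrow>\<^sub>0 int" where
  "potential k a u g =
     (let i = the_elem (supp g) in W i k a u (SOME e. e \<in> X \<and> cl e = obj g {i}) u)"

text \<open>The edge is split at a point placed at \<open>k\<close>, and \<open>W_vertex\<close>
  normalizes both halves to the fixed pair \<open>(a, u)\<close>. As for the signs,
  \<open>face 1 f\<close> keeps the smaller vertex, where the edge starts, and
  \<open>face 0 f\<close> the larger one.\<close>

lemma edge_potential:
  assumes a: "a \<in> X" and u: "u \<in> X" "ind2 a u"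
    and f: "f \<in> simplices 1" "k \<notin> supp f"
  shows "\<exists>b\<in>X. frag_of f \<simeq> potential k a u (face 1 f) - potential k a u (face 0 f) + D a b"
proof -
  let ?P = "potential k a u"
  obtain i j where s: "supp f = {i, j}" "i < j" by (rule edge_cases[OF f(1)])
  have f': "is_simplex M ind B p 1 f" using f(1) by simp
  have ij: "i \<noteq> j" "i \<noteq> k" "j \<noteq> k" using s f(2) by auto
  define e where "e l = (SOME e. e \<in> X \<and> cl e = obj f {l})" for l
  have e: "e l \<in> X" "cl (e l) = obj f {l}" if l: "l \<in> {i, j}" for l
  proof -
    obtain b where "b \<in> X" "cl b = obj f {l}" by (rule simplex_vertex_enumeration[OF f']) (use l s in auto)
    then have "\<exists>b. b \<in> X \<and> cl b = obj f {l}" by blast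
    then have "e l \<in> X \<and> cl (e l) = obj f {l}" unfolding e_def by (rule someI_ex)
    then show "e l \<in> X" "cl (e l) = obj f {l}" by simp_all
  qed
  have ei: "e i \<in> X" "cl (e i) = obj f {i}" and ej: "e j \<in> X" "cl (e j) = obj f {j}"
    using e by simp_all
  define x y where "x = mor f {i} {i, j} \<circ> e i" and "y = mor f {j} {i, j} \<circ> e j"
  have xy: "x \<in> X" "y \<in> X" "ind2 x y"
    unfolding x_def y_def using edge_points(1-3)[OF f' s(1) ij(1) ei ej] by simp_all
  have "\<exists>z. z \<in> X \<and> (\<forall>a\<in>{x, y}. ind2 a z) \<and> (\<forall>a\<in>{x, y}. \<forall>b\<in>{x, y}. ind2 a b \<longrightarrow> ind3 a z b)"
    by (rule indep_element) (use xy in simp_all)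
  then obtain z where z: "z \<in> X" "\<forall>a\<in>{x, y}. ind2 a z" "\<forall>a\<in>{x, y}. \<forall>b\<in>{x, y}. ind2 a b \<longrightarrow> ind3 a z b"
    by (elim exE conjE) (rule that; assumption)
  have "frag_of f \<simeq> W i j x y (e i) (e j)"
    by (rule edge_homologous(1)[OF f(1) s ei ej xy(1,2)]) (simp add: x_def y_def)
  also have "\<dots> \<simeq> W i k x z (e i) u - W j k y z (e j) u"
    by (rule W_split) (use ij xy z u ei ej in simp_all)
  finally have 1: "frag_of f \<simeq> W i k x z (e i) u - W j k y z (e j) u" .
  obtain b1 where b1: "b1 \<in> X" "W i k x z (e i) u \<simeq> W i k a u (e i) u + D a b1"
    using W_vertex[OF a u(1) xy(1) z(1) ei(1) u(1) ij(2) u(2)] z(2) by auto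
  obtain b2 where b2: "b2 \<in> X" "W j k y z (e j) u \<simeq> W j k a u (e j) u + D a b2"
    using W_vertex[OF a u(1) xy(2) z(1) ej(1) u(1) ij(3) u(2)] z(2) by auto
  obtain b where b: "b \<in> X" "D a b1 - D a b2 \<simeq> D a b" using D_difference[OF a b1(1) b2(1)] by blast
  have P: "?P (face 1 f) = W i k a u (e i) u" "?P (face 0 f) = W j k a u (e j) u"
    unfolding face_edge[OF s] potential_def e_def by (simp_all add: restr_def)
  have "frag_of f \<simeq> (W i k a u (e i) u + D a b1) - (W j k a u (e j) u + D a b2)"
    by (rule homologous_trans[OF 1 homologous_diff[OF b1(2) b2(2)]])
  also have "\<dots> = ?P (face 1 f) - ?P (face 0 f) + (D a b1 - D a b2)" unfolding P by simp
  also have "\<dots> \<simeq> ?P (face 1 f) - ?P (face 0 f) + D a b"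
    by (rule homologous_add[OF homologous_refl b(2)])
  finally show ?thesis using b(1) by blast
qed

lemma cycle_homologous_D:
  assumes a: "a \<in> X" and c: "cycle c"
  shows "\<exists>b\<in>X. c \<simeq> D a b"
proof -
  have "\<exists>u. u \<in> X \<and> (\<forall>x\<in>{a}. ind2 x u) \<and> (\<forall>x\<in>{a}. \<forall>y\<in>{a}. ind2 x y \<longrightarrow> ind3 x u y)"
    using indep_element[of "{a}"] a by simp
  then obtain u where u: "u \<in> X" "ind2 a u" by auto
  have "finite (\<Union>f\<in>Poly_Mapping.keys c. supp f)"
    using c simplex_finite unfolding cycle_def by (intro finite_UN_I finite_keys) blast
  then obtain k where k: "k \<notin> (\<Union>f\<in>Poly_Mapping.keys c. supp f)" by (rule fresh_nat)
  define P where "P = potential k a u"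
  have "Poly_Mapping.keys c \<subseteq> {f \<in> simplices 1. k \<notin> supp f}"
    using c k unfolding cycle_def by auto
  \<comment> \<open>The correction term makes the claim meaningful for arbitrary chains avoiding
    \<open>k\<close> and stable under subtraction, so that induction on generators applies; on a
    cycle it vanishes.\<close>
  then have "\<exists>b\<in>X. c + frag_extend P (boundary 1 c) \<simeq> D a b"
  proof (induction c rule: frag_induction)
    case zero
    then show ?case using a D_refl[OF a] homologous_sym by auto
  next
    case (one f)
    then obtain b where b: "b \<in> X" "frag_of f \<simeq> P (face 1 f) - P (face 0 f) + D a b"
      using edge_potential[OF a u, of f k] unfolding P_def by auto
    have eq: "frag_extend P (boundary 1 (frag_of f)) = P (face 0 f) - P (face 1 f)"
      by (simp only: boundary_edge frag_extend_diff frag_extend_of)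
    have "frag_of f + frag_extend P (boundary 1 (frag_of f)) \<simeq> D a b"
      using b(2) unfolding eq homologous_def by (simp add: algebra_simps)
    then show ?case using b(1) by blast
  next
    case (diff c d)
    then obtain b1 b2 where b: "b1 \<in> X" "c + frag_extend P (boundary 1 c) \<simeq> D a b1"
      "b2 \<in> X" "d + frag_extend P (boundary 1 d) \<simeq> D a b2" by auto
    obtain b where b': "b \<in> X" "D a b1 - D a b2 \<simeq> D a b" using D_difference[OF a b(1,3)] by blast
    have "(c + frag_extend P (boundary 1 c)) - (d + frag_extend P (boundary 1 d)) \<simeq> D a b"
      by (rule homologous_trans[OF homologous_diff[OF b(2,4)] b'(2)])
    moreover have "(c - d) + frag_extend P (boundary 1 (c - d)) =
        (c + frag_extend P (boundary 1 c)) - (d + frag_extend P (boundary 1 d))"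
      by (simp add: boundary_diff frag_extend_diff)
    ultimately have "(c - d) + frag_extend P (boundary 1 (c - d)) \<simeq> D a b" by (simp only:)
    then show ?case using b'(1) by (rule bexI)
  qed
  then show ?thesis using c by (simp add: cycle_def)
qed

section \<open>The epimorphism from the automorphism group\<close>

section \<open>The homomorphism from the automorphism group\<close>

abbreviation phi :: "('i \<Rightarrow> 'm) \<Rightarrow> ('m \<Rightarrow> 'm) \<Rightarrow> ('m psimplex \<Rightarrow>\<^sub>0 int) set" where
  "phi \<equiv> phi_star M ind B p"

lemma phi_apply: "\<sigma> \<in> G \<Longrightarrow> phi a \<sigma> = brk a (\<sigma> \<circ> a)"
  by (simp add: phi_star_def)

lemma mult_Aut [simp]: "\<sigma> \<otimes>\<^bsub>Aut M\<^esub> \<tau> = \<sigma> \<circ> \<tau>"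
  by (simp add: Aut_def)

text \<open>The bracket from \<open>a\<close> to \<open>\<sigma>\<tau>a\<close> is split at
  \<open>\<sigma>a\<close>; invariance under \<open>\<sigma>\<close> turns the second piece into the
  bracket from \<open>a\<close> to \<open>\<tau>a\<close>.\<close>

lemma phi_hom:
  assumes "a \<in> X"
  shows "phi a \<in> hom (Aut M) H1"
proof (rule homI)
  show "phi a \<sigma> \<in> carrier H1" if "\<sigma> \<in> carrier (Aut M)" for \<sigma>
    unfolding phi_apply[OF that] by (rule bracket_carrier[OF assms G_X[OF that assms]])
  fix \<sigma> \<tau> assume \<sigma>: "\<sigma> \<in> carrier (Aut M)" and \<tau>: "\<tau> \<in> carrier (Aut M)"
  have X: "\<sigma> \<circ> a \<in> X" "\<tau> \<circ> a \<in> X" "\<sigma> \<circ> (\<tau> \<circ> a) \<in> X" using \<sigma> \<tau> assms by simp_all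
  have "phi a (\<sigma> \<circ> \<tau>) = brk a (\<sigma> \<circ> (\<tau> \<circ> a))"
    by (simp add: phi_apply G_comp[OF \<sigma> \<tau>] comp_assoc)
  also have "\<dots> = brk a (\<sigma> \<circ> a) \<otimes>\<^bsub>H1\<^esub> brk (\<sigma> \<circ> a) (\<sigma> \<circ> (\<tau> \<circ> a))"
    by (rule bracket_mult[OF assms X(1,3), symmetric])
  also have "\<dots> = phi a \<sigma> \<otimes>\<^bsub>H1\<^esub> phi a \<tau>"
    using bracket_invariant[OF assms X(2) \<sigma>] by (simp add: phi_apply \<sigma> \<tau>)
  finally show "phi a (\<sigma> \<otimes>\<^bsub>Aut M\<^esub> \<tau>) = phi a \<sigma> \<otimes>\<^bsub>H1\<^esub> phi a \<tau>" by simp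
qed

lemma phi_surj:
  assumes "a \<in> X"
  shows "phi a ` carrier (Aut M) = carrier H1"
proof
  show "phi a ` carrier (Aut M) \<subseteq> carrier H1" using phi_hom[OF assms] by (auto simp: hom_def)
  show "carrier H1 \<subseteq> phi a ` carrier (Aut M)"
  proof
    fix h assume "h \<in> carrier H1"
    then obtain c where c: "cycle c" "h = cls c" unfolding carrier_H1 by blast
    obtain b where b: "b \<in> X" "c \<simeq> D a b" using cycle_homologous_D[OF assms c(1)] by blast
    obtain \<sigma> where \<sigma>: "\<sigma> \<in> G" "\<sigma> \<circ> a = b" by (rule X_conjugate[OF assms b(1)])
    have "h = phi a \<sigma>" using bracket_eq[OF assms b] c(2) \<sigma> by (simp add: phi_apply)
    then show "h \<in> phi a ` carrier (Aut M)" using \<sigma>(1) by blast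
  qed
qed

text \<open>Along the path \<open>b\<close>, \<open>a\<close>, \<open>\<sigma>a\<close>,
  \<open>\<sigma>b\<close> the two outer differences cancel, since the last one is the translate by
  \<open>\<sigma>\<close> of the reversed first one.\<close>

lemma phi_independent:
  assumes "a \<in> X" "b \<in> X"
  shows "phi a = phi b"
proof
  fix \<sigma>
  show "phi a \<sigma> = phi b \<sigma>"
  proof (cases "\<sigma> \<in> G")
    case True
    have X: "\<sigma> \<circ> a \<in> X" "\<sigma> \<circ> b \<in> X" using True assms by simp_all
    have "D b a + D a (\<sigma> \<circ> a) \<simeq> D b (\<sigma> \<circ> a)" by (rule D_add[OF assms(2,1) X(1)])
    then have "(D b a + D a (\<sigma> \<circ> a)) + D (\<sigma> \<circ> a) (\<sigma> \<circ> b) \<simeq> D b (\<sigma> \<circ> a) + D (\<sigma> \<circ> a) (\<sigma> \<circ> b)"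
      by (rule homologous_add) simp
    also have "\<dots> \<simeq> D b (\<sigma> \<circ> b)" by (rule D_add[OF assms(2) X])
    finally have 1: "(D b a + D a (\<sigma> \<circ> a)) + D (\<sigma> \<circ> a) (\<sigma> \<circ> b) \<simeq> D b (\<sigma> \<circ> b)" .
    have "D (\<sigma> \<circ> a) (\<sigma> \<circ> b) \<simeq> - D b a"
      by (rule homologous_trans[OF D_invariant[OF assms True] homologous_sym[OF D_swap[OF assms(2,1)]]])
    then have "(D b a + D a (\<sigma> \<circ> a)) + D (\<sigma> \<circ> a) (\<sigma> \<circ> b) \<simeq> (D b a + D a (\<sigma> \<circ> a)) + - D b a"
      by (intro homologous_add homologous_refl)
    then have "(D b a + D a (\<sigma> \<circ> a)) + D (\<sigma> \<circ> a) (\<sigma> \<circ> b) \<simeq> D a (\<sigma> \<circ> a)" by simp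
    then have "D a (\<sigma> \<circ> a) \<simeq> D b (\<sigma> \<circ> b)" by (rule homologous_trans[OF homologous_sym 1])
    then have "brk a (\<sigma> \<circ> a) = brk b (\<sigma> \<circ> b)" using assms X by (intro bracket_cong)
    then show ?thesis using True by (simp add: phi_apply)
  next
    case False
    then show ?thesis by (simp add: phi_star_def)
  qed
qed

end

section \<open>Automorphisms fixing a submodel, and the factorization through the Lascar
  group\<close>

section \<open>Strong automorphisms\<close>

lemma definable_reindex:
  assumes "definable M ss K P" "\<And>k. k \<in> K \<Longrightarrow> ss (h k) = ss k" "\<And>w. well_sorted M ss w \<Longrightarrow> well_sorted M ss (w \<circ> h)"
  shows "definable M ss (h ` K) (\<lambda>w. P (w \<circ> h))"
proof -
  obtain \<phi> \<tau> where 1: "wf_fm M \<phi>" "\<forall>x\<in>fv \<phi>. \<tau> x \<in> K \<and> ss (\<tau> x) = fst x"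
    "\<forall>w. well_sorted M ss w \<longrightarrow> P w = sat M UNIV (w \<circ> \<tau>) \<phi>"
    using assms(1) unfolding definable_def by blast
  show ?thesis
    by (rule definableI[of _ \<phi> "h \<circ> \<tau>"]) (use 1 assms(2,3) in \<open>simp_all add: comp_assoc[symmetric]\<close>)
qed

lemma definable_iff:
  assumes "definable M ss K P" "definable M ss K Q"
  shows "definable M ss K (\<lambda>w. P w \<longleftrightarrow> Q w)"
proof -
  have "definable M ss K (\<lambda>w. \<not> (P w \<and> \<not> Q w) \<and> \<not> (Q w \<and> \<not> P w))"
    by (intro definable_conj definable_not assms)
  moreover have "(\<lambda>w. \<not> (P w \<and> \<not> Q w) \<and> \<not> (Q w \<and> \<not> P w)) = (\<lambda>w. P w \<longleftrightarrow> Q w)" by auto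
  ultimately show ?thesis by simp
qed

text \<open>Used for normality: a conjugate of an automorphism fixing \<open>N\<close> pointwise
  fixes the image of \<open>N\<close>, which must again be an elementary submodel.\<close>

lemma elementary_submodel_image:
  assumes "is_structure M" "automorphism M \<sigma>" "elementary_submodel M N"
  shows "elementary_submodel M (\<sigma> ` N)"
  unfolding elementary_submodel_def
proof (intro conjI ballI allI impI)
  have sort: "sort_of M (\<sigma> x) = sort_of M x" for x
    using assms(2) unfolding automorphism_def by blast
  fix f xs assume f: "f \<in> funs M" and xs: "set xs \<subseteq> \<sigma> ` N \<and> map (sort_of M) xs = fun_dom M f"
  then have "xs \<in> lists (\<sigma> ` N)" by auto
  then have "xs \<in> map \<sigma> ` lists N" by (simp only: lists_image)
  then obtain ys where ys: "ys \<in> lists N" "xs = map \<sigma> ys" by blast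
  have "map (sort_of M) xs = map (sort_of M) ys" unfolding ys(2) using sort by simp
  then have dom: "map (sort_of M) ys = fun_dom M f" using xs by simp
  moreover have "set ys \<subseteq> N" using ys(1) by auto
  ultimately have "fun_int M f ys \<in> N" using assms(3) f unfolding elementary_submodel_def by simp
  moreover have "\<sigma> (fun_int M f ys) = fun_int M f xs"
    using assms(2) f dom ys(2) unfolding automorphism_def by simp
  ultimately show "fun_int M f xs \<in> \<sigma> ` N" by (metis image_eqI)
next
  have sort: "sort_of M (\<sigma> x) = sort_of M x" for x
    using assms(2) unfolding automorphism_def by blast
  have inj: "inj \<sigma>" and surj: "surj \<sigma>" using assms(2) unfolding automorphism_def bij_def by simp_all
  fix \<phi> v assume *: "wf_fm M \<phi> \<and> params_in M (\<sigma> ` N) (fv \<phi>) v"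
  define u where "u = inv_into UNIV \<sigma> \<circ> v"
  have v: "v = \<sigma> \<circ> u" unfolding u_def using surj by (simp add: fun_eq_iff surj_f_inv_f)
  have "params_in M N (fv \<phi>) u"
    unfolding params_in_def
  proof
    fix x assume "x \<in> fv \<phi>"
    then have "\<sigma> (u x) \<in> \<sigma> ` N" "sort_of M (\<sigma> (u x)) = fst x"
      using * unfolding v params_in_def by simp_all
    then show "u x \<in> N \<and> sort_of M (u x) = fst x" using inj sort by (simp add: inj_image_mem_iff)
  qed
  then have "sat M N u \<phi> = sat M UNIV u \<phi>" and s: "\<And>x. x \<in> fv \<phi> \<Longrightarrow> sort_of M (u x) = fst x"
    using assms(3) * unfolding elementary_submodel_def params_in_def by simp_all
  then show "sat M (\<sigma> ` N) v \<phi> = sat M UNIV v \<phi>"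
    using sat_image_automorphism[OF assms(1,2) _ s] sat_automorphism[OF assms(1,2) _ s] * unfolding v by simp
qed

context monster_model
begin

text \<open>The Tarski-Vaught argument: the existential formula holds in the monster with parameters
  from \<open>N\<close>, hence in \<open>N\<close>, and a witness found there satisfies the matrix
  in the monster too.\<close>

lemma submodel_witness:
  assumes N: "elementary_submodel M N" and w: "well_sorted M ss w" and P: "definable M ss (insert j K) P"
    and K: "\<And>k. k \<in> K \<Longrightarrow> w k \<in> N" and ex: "sort_of M y = ss j" "P (w(j := y))"
  obtains z where "z \<in> N" "sort_of M z = ss j" "P (w(j := z))"
proof -
  obtain \<phi> v where \<phi>: "wf_fm M \<phi>" "params_in M (w ` K) (fv \<phi> - {(ss j, 0)}) v"
    "\<And>y. sort_of M y = ss j \<Longrightarrow> y \<in> solutions M (ss j, 0) \<phi> v \<longleftrightarrow> P (w(j := y))"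
    using definable_solutions[OF w P] by metis
  let ?x = "(ss j, 0)"
  have "w ` K \<subseteq> N" using K by (rule image_subsetI)
  then have par: "params_in M N (fv \<phi> - {?x}) v"
    using \<phi>(2) unfolding params_in_def by (meson subsetD)
  have sat_eq: "sat M N u \<psi> = sat M UNIV u \<psi>" if "wf_fm M \<psi>" "params_in M N (fv \<psi>) u" for \<psi> u
    using N that unfolding elementary_submodel_def by simp
  have "sat M UNIV (v(?x := y)) \<phi>" using \<phi>(3)[OF ex(1)] ex(2) by (simp add: solutions_def)
  then have "sat M UNIV v (Ex ?x \<phi>)" using ex(1) by auto
  moreover have "wf_fm M (Ex ?x \<phi>)" using \<phi>(1) well_sorted_sorts[OF w] by simp
  ultimately have "sat M N v (Ex ?x \<phi>)" using sat_eq[of "Ex ?x \<phi>" v] par by simp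
  then obtain z where z: "z \<in> N" "sort_of M z = ss j" "sat M N (v(?x := z)) \<phi>" by auto
  have "params_in M N (fv \<phi>) (v(?x := z))" using par z(1,2) by (simp add: params_in_def)
  then have "sat M UNIV (v(?x := z)) \<phi>" using sat_eq[OF \<phi>(1)] z(3) by (simp del: fun_upd_apply)
  then have "z \<in> solutions M ?x \<phi> v" using z(2) by (simp add: solutions_def)
  then show thesis using that[OF z(1,2)] \<phi>(3)[OF z(2)] by simp
qed

text \<open>The witness step iterated over a finite block. A coordinate \<open>j\<close> is first
  quantified away, the induction hypothesis moves the others into \<open>N\<close>, and only then is
  a value for \<open>j\<close> chosen, when all other relevant coordinates lie in
  \<open>N\<close>.\<close>

lemma submodel_realize:
  assumes N: "elementary_submodel M N" and J: "finite J"
    and w: "well_sorted M ss w" and P: "definable M ss K P" "P w"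
    and K: "\<And>k. k \<in> K - J \<Longrightarrow> w k \<in> N"
  shows "\<exists>w'. well_sorted M ss w' \<and> (\<forall>k. k \<notin> J \<longrightarrow> w' k = w k) \<and> (\<forall>k\<in>J \<inter> K. w' k \<in> N) \<and> P w'"
  using J P K
proof (induction J arbitrary: K P rule: finite_induct)
  case empty
  then show ?case using w by auto
next
  case (insert j J)
  show ?case
  proof (cases "j \<in> K")
    case False
    then have "\<And>k. k \<in> K - J \<Longrightarrow> w k \<in> N" using insert.prems(3) by auto
    from insert.IH[OF insert.prems(1,2) this] obtain w'
      where "well_sorted M ss w'" "\<forall>k. k \<notin> J \<longrightarrow> w' k = w k" "\<forall>k\<in>J \<inter> K. w' k \<in> N" "P w'" by auto
    then show ?thesis using False by (intro exI[of _ w']) auto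
  next
    case True
    define E where "E = (\<lambda>w. \<exists>y. sort_of M y = ss j \<and> P (w(j := y)))"
    have E: "definable M ss (K - {j}) E"
      unfolding E_def by (rule definable_ex[OF insert.prems(1) well_sorted_sorts[OF w]])
    have "E w" unfolding E_def using insert.prems(2) w
      by (intro exI[of _ "w j"]) (simp add: well_sorted_def)
    moreover have "\<And>k. k \<in> (K - {j}) - J \<Longrightarrow> w k \<in> N" using insert.prems(3) by auto
    ultimately have "\<exists>w'. well_sorted M ss w' \<and> (\<forall>k. k \<notin> J \<longrightarrow> w' k = w k) \<and>
        (\<forall>k\<in>J \<inter> (K - {j}). w' k \<in> N) \<and> E w'"
      by (intro insert.IH[OF E])
    then obtain w1 where w1: "well_sorted M ss w1" "\<forall>k. k \<notin> J \<longrightarrow> w1 k = w k"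
      "\<forall>k\<in>J \<inter> (K - {j}). w1 k \<in> N" "E w1"
      by (elim exE conjE) (rule that; assumption)
    obtain y where y: "sort_of M y = ss j" "P (w1(j := y))" using w1(4) unfolding E_def by auto
    have P': "definable M ss (insert j (K - {j})) P" by (rule definable_mono[OF insert.prems(1)]) auto
    have N': "w1 k \<in> N" if "k \<in> K - {j}" for k
    proof (cases "k \<in> J")
      case True
      then show ?thesis using w1(3) that by blast
    next
      case False
      then show ?thesis using w1(2) insert.prems(3)[of k] that by auto
    qed
    obtain z where z: "z \<in> N" "sort_of M z = ss j" "P (w1(j := z))"
      by (rule submodel_witness[OF N w1(1) P' N' y])
    have "well_sorted M ss (w1(j := z))" using w1(1) z(2) by blast
    moreover have "(w1(j := z)) k = w k" if "k \<notin> insert j J" for k using w1(2) that by simp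
    moreover have "(w1(j := z)) k \<in> N" if "k \<in> insert j J \<inter> K" for k using w1(3) z(1) that by auto
    ultimately show ?thesis using z(3) by blast
  qed
qed

end

context homology_setting
begin

lemma B_subset_submodel:
  assumes "elementary_submodel M N"
  shows "B \<subseteq> N"
proof
  fix b assume "b \<in> B"
  then obtain c where c: "c \<in> funs M" "fun_dom M c = []" "fun_int M c [] = b"
    using base unfolding named_base_def by blast
  have "set [] \<subseteq> N \<and> map (sort_of M) [] = fun_dom M c" using c(2) by simp
  then have "fun_int M c [] \<in> N" using assms c(1) unfolding elementary_submodel_def by blast
  then show "b \<in> N" using c(3) by simp
qed

text \<open>Any finite part of the type to be realized is realized by a tuple from \<open>N\<close>, on which \<open>\<sigma>\<close> is
  the identity.\<close>

lemma common_fixed_realization: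
  assumes \<sigma>: "\<sigma> \<in> G" and N: "elementary_submodel M N" "\<And>x. x \<in> N \<Longrightarrow> \<sigma> x = x" and a: "a \<in> X"
  obtains c \<tau> where "c \<in> X" "\<tau> \<in> G" "\<tau> \<circ> c = c" "\<tau> \<circ> a = \<sigma> \<circ> a"
proof -
  define w :: "'i + 'm \<Rightarrow> 'm" where "w = case_sum a id"
  define ss where "ss k = sort_of M (w k)" for k
  have w: "well_sorted M ss w" by (simp add: well_sorted_def ss_def)
  have \<sigma>_sort: "sort_of M (\<sigma> x) = sort_of M x" for x
    using \<sigma> unfolding carrier_Aut automorphism_def by blast
  \<comment> \<open>The coordinates \<open>Inl i\<close> form the unknown tuple \<open>c\<close>,
    and \<open>Inr m\<close> names the parameter \<open>m\<close>. Precomposition with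
    \<open>h\<close> keeps \<open>c\<close> and replaces each parameter by its image under
    \<open>\<sigma>\<close>.\<close>
  define h :: "'i + 'm \<Rightarrow> 'i + 'm" where "h = case_sum Inl (\<lambda>m. Inr (\<sigma> m))"
  have h_ss: "ss (h k) = ss k" for k by (cases k) (simp_all add: h_def ss_def w_def \<sigma>_sort)
  have h_ws: "well_sorted M ss (u \<circ> h)" if "well_sorted M ss u" for u
    using that h_ss unfolding well_sorted_def by simp
  let ?Kp = "range Inl \<union> Inr ` B :: ('i + 'm) set"
  let ?Ke = "range Inl \<union> Inr ` range a :: ('i + 'm) set"
  let ?K = "?Kp \<union> ?Ke \<union> h ` ?Ke"
  \<comment> \<open>\<open>Qe P\<close> demands that \<open>P\<close> does not distinguish
    \<open>c a\<close> from \<open>c \<sigma>(a)\<close>. Imposing it for all \<open>P\<close> on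
    \<open>?Ke\<close> expresses that the two have the same type, and \<open>\<Q>p\<close> expresses
    that \<open>c\<close> realizes \<open>p\<close>.\<close>
  define Qe where "Qe P = (\<lambda>u. P u \<longleftrightarrow> P (u \<circ> h))" for P :: "('i + 'm \<Rightarrow> 'm) \<Rightarrow> bool"
  define \<Q>p where "\<Q>p = {P. definable M ss ?Kp P \<and> P w}"
  define \<P>e where "\<P>e = {P. definable M ss ?Ke P}"
  have smallK: "small M ?K"
    by (intro small_Un small_image small_index small_B)
  have "\<exists>w'. well_sorted M ss w' \<and> (\<forall>k\<in>range Inr. w' k = w k) \<and> (\<forall>Q\<in>\<Q>p \<union> Qe ` \<P>e. Q w')"
  proof (rule compactness[OF w smallK])
    fix Q assume "Q \<in> \<Q>p \<union> Qe ` \<P>e"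
    then show "definable M ss ?K Q"
    proof
      assume "Q \<in> \<Q>p"
      then have "definable M ss ?Kp Q" by (simp add: \<Q>p_def)
      then show ?thesis by (rule definable_mono) blast
    next
      assume "Q \<in> Qe ` \<P>e"
      then obtain P where P: "definable M ss ?Ke P" "Q = Qe P" unfolding \<P>e_def by blast
      have "definable M ss ?K P" by (rule definable_mono[OF P(1)]) blast
      moreover have "definable M ss ?K (\<lambda>u. P (u \<circ> h))"
      proof (rule definable_mono)
        show "definable M ss (h ` ?Ke) (\<lambda>u. P (u \<circ> h))"
          using P(1) h_ss h_ws by (rule definable_reindex)
      qed (rule Un_upper2)
      ultimately show ?thesis unfolding P(2) Qe_def by (rule definable_iff)
    qed
  next
    fix F assume F: "finite F" "F \<subseteq> \<Q>p \<union> Qe ` \<P>e"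
    have "finite (F \<inter> Qe ` \<P>e)" using F(1) by simp
    then obtain Fe where Fe: "Fe \<subseteq> \<P>e" "finite Fe" "F \<inter> Qe ` \<P>e = Qe ` Fe"
      using finite_subset_image[of "F \<inter> Qe ` \<P>e" Qe \<P>e] by blast
    have "\<exists>S. finite S \<and> S \<subseteq> ?Ke \<and> definable M ss S P" if "P \<in> Fe" for P
    proof -
      have "definable M ss ?Ke P" using that Fe(1) unfolding \<P>e_def by auto
      then show ?thesis by (rule definable_finite_support) (intro exI conjI)
    qed
    then obtain S where S: "\<And>P. P \<in> Fe \<Longrightarrow> finite (S P)" "\<And>P. P \<in> Fe \<Longrightarrow> S P \<subseteq> ?Ke"
      "\<And>P. P \<in> Fe \<Longrightarrow> definable M ss (S P) P" by metis
    define P where "P u \<longleftrightarrow> (\<forall>Q\<in>F \<inter> \<Q>p. Q u)" for u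
    have "definable M ss ?Kp P"
      unfolding P_def by (rule definable_conj_finite) (use F in \<open>auto simp: \<Q>p_def\<close>)
    then obtain S0 where S0: "finite S0" "S0 \<subseteq> ?Kp" "definable M ss S0 P"
      by (rule definable_finite_support)
    \<comment> \<open>These finitely many coordinates of the unknown tuple are all that the finite
      part can see. The remaining coordinates of \<open>S0\<close> name elements of
      \<open>B\<close>, which lie in \<open>N\<close> because they are constants.\<close>
    define J where "J = (S0 \<union> (\<Union>P\<in>Fe. S P)) \<inter> range Inl"
    have J: "finite J" using S0(1) S(1) Fe(2) unfolding J_def by blast
    have defP: "definable M ss (S0 \<union> J) P" by (rule definable_mono[OF S0(3)]) blast
    have Pw: "P w" unfolding P_def \<Q>p_def by simp
    have "w k \<in> N" if "k \<in> S0 \<union> J - J" for k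
    proof -
      have "k \<in> Inr ` B" using that S0(2) unfolding J_def by blast
      then show ?thesis using B_subset_submodel[OF N(1)] by (auto simp: w_def)
    qed
    from submodel_realize[OF N(1) J w defP Pw this]
    have "\<exists>w'. well_sorted M ss w' \<and> (\<forall>k. k \<notin> J \<longrightarrow> w' k = w k) \<and> (\<forall>k\<in>J \<inter> (S0 \<union> J). w' k \<in> N) \<and> P w'" .
    then obtain w' where w': "well_sorted M ss w'" "\<forall>k. k \<notin> J \<longrightarrow> w' k = w k"
      "\<forall>k\<in>J \<inter> (S0 \<union> J). w' k \<in> N" "P w'"
      by (elim exE conjE) (rule that; assumption)
    have wInr: "w' (Inr m) = m" for m
    proof -
      have "Inr m \<notin> J" unfolding J_def by blast
      then show ?thesis using w'(2) by (simp add: w_def)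
    qed
    \<comment> \<open>On the support of \<open>R\<close> the assignments
      \<open>\<sigma> \<circ> w'\<close> and \<open>w' \<circ> h\<close> agree: the tuple takes
      values in \<open>N\<close>, which \<open>\<sigma>\<close> fixes, and parameters are moved by
      \<open>\<sigma>\<close> in both. The demand on \<open>R\<close> thereby reduces to invariance
      of definable predicates under \<open>\<sigma>\<close>.\<close>
    have "Qe R w'" if R: "R \<in> Fe" for R
    proof -
      have ws: "well_sorted M ss (\<sigma> \<circ> w')" using w'(1) \<sigma>_sort unfolding well_sorted_def by simp
      have "same_type M (S R) w' (\<sigma> \<circ> w')"
        by (rule same_type_automorphism) (use \<sigma> in \<open>simp only: carrier_Aut\<close>)
      then have "R w' = R (\<sigma> \<circ> w')"
        by (rule same_type_definable[OF _ w'(1) ws S(3)[OF R]])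
      also have "\<dots> = R (w' \<circ> h)"
      proof (rule definable_cong[OF S(3)[OF R] ws h_ws[OF w'(1)]])
        fix k assume k: "k \<in> S R"
        show "(\<sigma> \<circ> w') k = (w' \<circ> h) k"
        proof (cases k)
          case (Inl i)
          then have "k \<in> J" using k R unfolding J_def by blast
          then have "w' k \<in> N" using w'(3) by blast
          then show ?thesis using N(2) Inl by (simp add: h_def)
        next
          case (Inr m)
          then show ?thesis by (simp add: h_def wInr)
        qed
      qed
      finally show ?thesis by (simp add: Qe_def)
    qed
    note Fe_w' = this
    have "Q w'" if Q: "Q \<in> F" for Q
    proof (cases "Q \<in> \<Q>p")
      case True
      then have "Q \<in> F \<inter> \<Q>p" using Q by blast
      then show ?thesis by (rule bspec[OF w'(4)[unfolded P_def]])
    next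
      case False
      then have "Q \<in> F \<inter> Qe ` \<P>e" using F(2) Q by auto
      then have "Q \<in> Qe ` Fe" by (simp only: Fe(3))
      then obtain R where "R \<in> Fe" "Q = Qe R" by (rule imageE)
      then show ?thesis using Fe_w' by simp
    qed
    moreover have "w' k = w k" if "k \<in> range Inr" for k using wInr that by (auto simp: w_def)
    ultimately show "\<exists>w'. well_sorted M ss w' \<and> (\<forall>k\<in>range Inr. w' k = w k) \<and> (\<forall>Q\<in>F. Q w')"
      using w'(1) by (intro exI[of _ w'] conjI ballI)
  qed
  then obtain w' where w': "well_sorted M ss w'" "\<forall>k\<in>range Inr. w' k = w k"
    "\<forall>Q\<in>\<Q>p \<union> Qe ` \<P>e. Q w'"
    by (elim exE conjE) (rule that; assumption)
  define c where "c = w' \<circ> Inl"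
  have wInr: "w' (Inr m) = m" for m using w'(2) by (simp add: w_def)
  have w'_eq: "w' = case_sum c id"
  proof
    fix k show "w' k = case_sum c id k" by (cases k) (simp_all add: c_def wInr)
  qed
  have "same_type M ?Kp w w'"
  proof (rule same_typeI_definable[OF w w'(1)])
    fix P assume "definable M ss ?Kp P" "P w"
    then have "P \<in> \<Q>p \<union> Qe ` \<P>e" by (simp add: \<Q>p_def)
    then show "P w'" by (rule bspec[OF w'(3)])
  qed
  then have "tp M B a = tp M B c"
    unfolding tp_eq_iff_same_type w'_eq w_def .
  then have c: "c \<in> X" using a by (simp add: X_def realizes_def)
  have "same_type M ?Ke w' (w' \<circ> h)"
  proof (rule same_typeI_definable[OF w'(1) h_ws[OF w'(1)]])
    fix P assume P: "definable M ss ?Ke P" "P w'"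
    then have "Qe P \<in> \<Q>p \<union> Qe ` \<P>e" by (simp add: \<P>e_def)
    then have "Qe P w'" by (rule bspec[OF w'(3)])
    then show "P (w' \<circ> h)" using P(2) by (simp add: Qe_def)
  qed
  moreover have "small M ?Ke" by (intro small_Un small_image small_index)
  ultimately obtain \<tau> where \<tau>: "automorphism M \<tau>" "\<And>k. k \<in> ?Ke \<Longrightarrow> \<tau> (w' k) = (w' \<circ> h) k"
    using homogeneity by metis
  have "\<tau> (c i) = c i" for i using \<tau>(2)[of "Inl i"] by (simp add: c_def h_def)
  moreover have "\<tau> (a i) = \<sigma> (a i)" for i
    using \<tau>(2)[of "Inr (a i)"] by (simp add: wInr h_def)
  ultimately have "\<tau> \<circ> c = c" "\<tau> \<circ> a = \<sigma> \<circ> a" by auto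
  moreover have "\<tau> \<in> G" using \<tau>(1) by (simp only: carrier_Aut)
  ultimately show thesis using that c by blast
qed

text \<open>\<open>phi a \<sigma>\<close> depends on \<open>\<sigma>\<close> only through its value
  on \<open>a\<close>, so \<open>\<sigma>\<close> may be replaced by \<open>\<tau>\<close>. The base
  point may then be changed to \<open>c\<close>, which \<open>\<tau>\<close> fixes.\<close>

lemma phi_submodel:
  assumes \<sigma>: "\<sigma> \<in> G" and N: "elementary_submodel M N" "\<And>x. x \<in> N \<Longrightarrow> \<sigma> x = x" and a: "a \<in> X"
  shows "phi a \<sigma> = \<one>\<^bsub>H1\<^esub>"
proof -
  obtain c \<tau> where c: "c \<in> X" "\<tau> \<in> G" "\<tau> \<circ> c = c" "\<tau> \<circ> a = \<sigma> \<circ> a"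
    by (rule common_fixed_realization[OF assms])
  have "phi a \<sigma> = phi a \<tau>" using \<sigma> c(2,4) by (simp add: phi_apply)
  also have "\<dots> = phi c \<tau>" by (simp only: phi_independent[OF a c(1)])
  also have "\<dots> = \<one>\<^bsub>H1\<^esub>" using c by (simp add: phi_apply bracket_refl)
  finally show ?thesis .
qed

abbreviation Autf_gen :: "('m \<Rightarrow> 'm) set" where
  "Autf_gen \<equiv> {\<sigma> \<in> carrier (Aut M). \<exists>N. small M N \<and> elementary_submodel M N \<and> (\<forall>x\<in>N. \<sigma> x = x)}"

lemma normal_Autf: "Autf M \<lhd> Aut M"
proof -
  interpret A: Group.group "Aut M" by (rule group_Aut)
  show ?thesis
    unfolding Autf_def
  proof (rule A.normal_generateI)
    fix \<sigma> g assume "\<sigma> \<in> Autf_gen" and g: "g \<in> carrier (Aut M)"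
    then obtain N where \<sigma>: "\<sigma> \<in> G" and N: "small M N" "elementary_submodel M N" "\<forall>x\<in>N. \<sigma> x = x"
      by blast
    have inv: "inv\<^bsub>Aut M\<^esub> g = inv_map g"
    proof (rule A.inv_equality[OF _ g G_inv[OF g]])
      show "inv_map g \<otimes>\<^bsub>Aut M\<^esub> g = \<one>\<^bsub>Aut M\<^esub>" using g by (simp add: Aut_def fun_eq_iff)
    qed
    have "g \<circ> \<sigma> \<circ> inv_map g \<in> G" using g \<sigma> by (intro G_comp G_inv)
    moreover have "small M (g ` N)" using N(1) by (rule small_image)
    moreover have "elementary_submodel M (g ` N)"
      by (rule elementary_submodel_image[OF structure_axiom _ N(2)]) (use g in \<open>simp only: carrier_Aut\<close>)
    moreover have "\<forall>x\<in>g ` N. (g \<circ> \<sigma> \<circ> inv_map g) x = x" using N(3) g by simp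
    ultimately show "g \<otimes>\<^bsub>Aut M\<^esub> \<sigma> \<otimes>\<^bsub>Aut M\<^esub> inv\<^bsub>Aut M\<^esub> g \<in> Autf_gen"
      unfolding inv mult_Aut by blast
  qed blast
qed

theorem Lascar_epimorphism:
  "\<exists>\<Phi>\<in>epi (Gal_L M) H1. \<forall>a. a \<in> X \<longrightarrow> (\<forall>\<sigma>\<in>G. \<Phi> (Autf M #>\<^bsub>Aut M\<^esub> \<sigma>) = phi a \<sigma>)"
proof -
  obtain a where a: "a \<in> X" by (rule strong_type_witness)
  interpret A: group_hom "Aut M" H1 "phi a"
    using group_Aut group_H1 phi_hom[OF a] by (simp add: group_hom_def group_hom_axioms_def)
  have ker: "Autf M \<subseteq> kernel (Aut M) H1 (phi a)"
    unfolding Autf_def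
  proof (rule A.G.generate_subgroup_incl[OF _ A.subgroup_kernel])
    show "Autf_gen \<subseteq> kernel (Aut M) H1 (phi a)"
      using phi_submodel a by (auto simp: kernel_def)
  qed
  obtain \<Phi> where \<Phi>: "\<Phi> \<in> hom (Aut M Mod Autf M) H1"
    "\<And>\<sigma>. \<sigma> \<in> G \<Longrightarrow> \<Phi> (Autf M #>\<^bsub>Aut M\<^esub> \<sigma>) = phi a \<sigma>"
    using A.FactGroup_universal_kernel[OF normal_Autf ker] by metis
  have "\<Phi> ` carrier (Aut M Mod Autf M) = phi a ` G"
    unfolding carrier_FactGroup image_image using \<Phi>(2) by (rule image_cong[OF refl])
  then have "\<Phi> \<in> epi (Gal_L M) H1"
    using \<Phi>(1) phi_surj[OF a] by (simp add: epi_def Gal_L_def)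
  moreover have "\<Phi> (Autf M #>\<^bsub>Aut M\<^esub> \<sigma>) = phi b \<sigma>" if "b \<in> X" "\<sigma> \<in> G" for b \<sigma>
    using \<Phi>(2)[OF that(2)] phi_independent[OF a that(1)] by simp
  ultimately show ?thesis by blast
qed

end

theorem theorem2p7:
  fixes M :: "('s, 'f, 'r, 'm) mstruct"
    and ind :: "'m set \<Rightarrow> 'm set \<Rightarrow> 'm set \<Rightarrow> bool"
    and B :: "'m set"
    and p :: "('s, 'f, 'r, 'm, 'i) ctype"
  assumes "monster M"
    and "independence_relation M ind"
    and "named_base M B"
    and "strong_type M B p"
  shows "(\<forall>a. realizes M B p a \<longrightarrow> phi_star M ind B p a \<in> epi (Aut M) (homology M ind B p 1)) \<and>
         (\<forall>a b. realizes M B p a \<and> realizes M B p b \<longrightarrow>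
            phi_star M ind B p a = phi_star M ind B p b) \<and>
         (\<exists>\<Phi> \<in> epi (Gal_L M) (homology M ind B p 1).
            \<forall>a. realizes M B p a \<longrightarrow>
              (\<forall>\<sigma>\<in>carrier (Aut M). \<Phi> (Autf M #>\<^bsub>Aut M\<^esub> \<sigma>) = phi_star M ind B p a \<sigma>))"
proof -
  interpret homology_setting M ind B p
    using assms by (simp add: homology_setting_def homology_setting_axioms_def monster_model_def)
  have X: "realizes M B p a \<longleftrightarrow> a \<in> X" for a by (simp add: X_def)
  have "phi a \<in> epi (Aut M) H1" if "a \<in> X" for a
    unfolding epi_def using phi_hom[OF that] phi_surj[OF that] by simp
  then show ?thesis unfolding X using phi_independent Lascar_epimorphism by blast
qed

end
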